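(* Let $g(\lambda):=\sum_{n=0}^\infty c_n\lambda^n$, where $c_n\ge 0$ for all $n\ge 0$ and $\sum_{n=0}^\infty c_n=1$. Let $X$ be a complex Banach space, let $\sigma\ge 1$, and let $T$ be a Ritt operator of Stolz type $\sigma$ on $X$. Then the operator $g(T):=\sum_{n=0}^\infty c_nT^n$ is a Ritt operator on $X$ of the same Stolz type $\sigma$. Moreover, if $\omega\in[0,\pi/2)$ is a sectoriality angle of the Cayley transform $\mathcal{C}(T)=(1-T)(1+T)^{-1}$ of $T$, i.e. $\mathcal{C}(T)\in\mathrm{Sect}(\omega)$, then $g(T)$ is a Ritt operator of angle $\omega$.
   Context: $\mathbb{D}=\{\lambda\in\mathbb{C}:|\lambda|<1\}$; $\Sigma_0=(0,\infty)$ and $\Sigma_\beta=\{\lambda\in\mathbb{C}:|\arg\lambda|<\beta\}$ for $\beta\in(0,\pi]$; bars denote closures in $\mathbb{C}$. $\mathcal{L}(X)$ is the space of bounded linear operators on $X$; $\sigma(T)$ denotes the spectrum of $T$ (not to be confused with the number $\sigma\ge1$). Ritt operator: $T\in\mathcal{L}(X)$ is Ritt if $\sigma(T)\subset\overline{\mathbb{D}}$ and there is $C\ge1$ with $\|(z-T)^{-1}\|\le C/|z-1|$ for all $|z|>1$. A Ritt operator $T$ satisfies $\sigma(T)\subset\mathbb{D}\cup\{1\}$ and is power bounded, i.e. $\sup_{n\ge0}\|T^n\|<\infty$; hence the series for $g(T)$ converges in operator norm and $\mathcal{C}(T)$ is bounded. Ritt operator of angle $\omega\in[0,\pi/2)$: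 $\sigma(T)\subset\mathbb{D}\cup\{1\}$, and for every $\omega'\in(\omega,\pi)$ there is $C_{\omega'}\ge1$ with $\|(z-T)^{-1}\|\le C_{\omega'}/|z-1|$ for all $z\in\mathbb{C}\setminus(1-\overline{\Sigma}_{\omega'})$. Stolz domain: for $\sigma\ge1$, $S_\sigma:=\{z\in\mathbb{D}: |1-z|/(1-|z|)<\sigma\}\cup\{1\}$. An operator $T\in\mathcal{L}(X)$ is a Ritt operator of Stolz type $\sigma\in[1,\infty)$ if $\sigma(T)\subset\overline{S}_\sigma$ and for every $\delta>\sigma$ there is $C_\delta$ with $\|(1-z)(z-T)^{-1}\|\le C_\delta$ for all $z\in\mathbb{C}\setminus S_\delta$. Sectorial operator: $A\in\mathrm{Sect}(\alpha)$, $\alpha\in[0,\pi)$ (i.e. $A$ is sectorial with sectoriality angle $\alpha$), if $\sigma(A)\subset\overline{\Sigma}_\alpha$ and for every $\omega\in(\alpha,\pi)$ there is $C_\omega>0$ with $\|z(z-A)^{-1}\|\le C_\omega$ for all $z\notin\overline{\Sigma}_\omega$. *)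

theory Defs
  imports "HOL-Analysis.Analysis"
begin

text \<open>
  Complex Banach spaces. The class extends the real class \<^class>\<open>banach\<close>, the real structure being
  the restriction of the complex one; the law \<open>1 *\<^sub>C x = x\<close> follows from \<open>scaleR_scaleC\<close>.
\<close>

class complex_banach = banach +
  fixes scaleC :: "complex \<Rightarrow> 'a \<Rightarrow> 'a"  (infixr \<open>*\<^sub>C\<close> 75)
  assumes scaleR_scaleC: "r *\<^sub>R x = of_real r *\<^sub>C x"
    and scaleC_add_right: "a *\<^sub>C (x + y) = a *\<^sub>C x + a *\<^sub>C y"
    and scaleC_add_left: "(a + b) *\<^sub>C x = a *\<^sub>C x + b *\<^sub>C x"
    and scaleC_scaleC: "a *\<^sub>C b *\<^sub>C x = (a * b) *\<^sub>C x"
    and norm_scaleC: "norm (a *\<^sub>C x) = cmod a * norm x"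

instantiation complex :: complex_banach
begin

definition scaleC_complex :: "complex \<Rightarrow> complex \<Rightarrow> complex" where
  "scaleC_complex a x = a * x"

instance
  by standard (simp_all add: scaleC_complex_def scaleR_conv_of_real algebra_simps norm_mult)

end

lemma bounded_linear_scaleC: "bounded_linear (\<lambda>x :: 'a::complex_banach. z *\<^sub>C x)"
proof (rule bounded_linear_intro)
  show "z *\<^sub>C (r *\<^sub>R x) = r *\<^sub>R (z *\<^sub>C x)" for r and x :: 'a
    by (simp add: scaleR_scaleC scaleC_scaleC mult.commute)
  show "norm (z *\<^sub>C x) \<le> norm x * cmod z" for x :: 'a
    by (simp add: norm_scaleC)
qed (rule scaleC_add_right)

text \<open>
  The algebra \<open>\<L>(X)\<close>. The library type of bounded operators only guarantees real linearity, so
  complex linearity is added as a predicate; the operator norm is that of the library type.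
\<close>

definition cbounded_ops :: "('a::complex_banach \<Rightarrow>\<^sub>L 'a) set" where
  "cbounded_ops = {T. \<forall>z x. blinfun_apply T (z *\<^sub>C x) = z *\<^sub>C blinfun_apply T x}"

lift_definition scalar_op :: "complex \<Rightarrow> 'a::complex_banach \<Rightarrow>\<^sub>L 'a" is "\<lambda>z x. z *\<^sub>C x"
  by (rule bounded_linear_scaleC)

primrec op_power :: "('a::complex_banach \<Rightarrow>\<^sub>L 'a) \<Rightarrow> nat \<Rightarrow> 'a \<Rightarrow>\<^sub>L 'a" where
  "op_power T 0 = id_blinfun"
| "op_power T (Suc n) = T o\<^sub>L op_power T n"

definition is_op_inverse :: "('a::complex_banach \<Rightarrow>\<^sub>L 'a) \<Rightarrow> ('a \<Rightarrow>\<^sub>L 'a) \<Rightarrow> bool" where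
  "is_op_inverse U S \<longleftrightarrow> S \<in> cbounded_ops \<and> U o\<^sub>L S = id_blinfun \<and> S o\<^sub>L U = id_blinfun"

text \<open>Only meaningful if \<open>U\<close> is invertible in \<open>\<L>(X)\<close>.\<close>

definition op_inverse :: "('a::complex_banach \<Rightarrow>\<^sub>L 'a) \<Rightarrow> 'a \<Rightarrow>\<^sub>L 'a" where
  "op_inverse U = (THE S. is_op_inverse U S)"

definition op_spectrum :: "('a::complex_banach \<Rightarrow>\<^sub>L 'a) \<Rightarrow> complex set" where
  "op_spectrum T = {z. \<not> (\<exists>S. is_op_inverse (scalar_op z - T) S)}"

definition resolvent :: "complex \<Rightarrow> ('a::complex_banach \<Rightarrow>\<^sub>L 'a) \<Rightarrow> 'a \<Rightarrow>\<^sub>L 'a" where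
  "resolvent z T = op_inverse (scalar_op z - T)"

definition sector :: "real \<Rightarrow> complex set" where
  "sector \<beta> = (if \<beta> = 0 then complex_of_real ` {0<..} else {z. z \<noteq> 0 \<and> \<bar>Arg z\<bar> < \<beta>})"

definition stolz :: "real \<Rightarrow> complex set" where
  "stolz \<sigma> = {z. cmod z < 1 \<and> cmod (1 - z) / (1 - cmod z) < \<sigma>} \<union> {1}"

text \<open>
  Each resolvent estimate below asserts explicitly that the resolvent exists at the points in question.
\<close>

definition ritt_stolz_type :: "real \<Rightarrow> ('a::complex_banach \<Rightarrow>\<^sub>L 'a) \<Rightarrow> bool" where
  "ritt_stolz_type \<sigma> T \<longleftrightarrow>
     T \<in> cbounded_ops \<and> op_spectrum T \<subseteq> closure (stolz \<sigma>) \<and>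
     (\<forall>\<delta>>\<sigma>. \<exists>C. \<forall>z. z \<notin> stolz \<delta> \<longrightarrow>
        z \<notin> op_spectrum T \<and> norm (scalar_op (1 - z) o\<^sub>L resolvent z T) \<le> C)"

definition ritt_of_angle :: "real \<Rightarrow> ('a::complex_banach \<Rightarrow>\<^sub>L 'a) \<Rightarrow> bool" where
  "ritt_of_angle \<omega> T \<longleftrightarrow>
     T \<in> cbounded_ops \<and> op_spectrum T \<subseteq> ball 0 1 \<union> {1} \<and>
     (\<forall>\<omega>'. \<omega> < \<omega>' \<and> \<omega>' < pi \<longrightarrow>
        (\<exists>C\<ge>1. \<forall>z. z \<notin> (\<lambda>w. 1 - w) ` closure (sector \<omega>') \<longrightarrow>
           z \<notin> op_spectrum T \<and> norm (resolvent z T) \<le> C / cmod (z - 1)))"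

definition sectorial :: "real \<Rightarrow> ('a::complex_banach \<Rightarrow>\<^sub>L 'a) \<Rightarrow> bool" where
  "sectorial \<alpha> A \<longleftrightarrow>
     A \<in> cbounded_ops \<and> op_spectrum A \<subseteq> closure (sector \<alpha>) \<and>
     (\<forall>\<omega>. \<alpha> < \<omega> \<and> \<omega> < pi \<longrightarrow>
        (\<exists>C>0. \<forall>z. z \<notin> closure (sector \<omega>) \<longrightarrow>
           z \<notin> op_spectrum A \<and> norm (scalar_op z o\<^sub>L resolvent z A) \<le> C))"

text \<open>For a Ritt operator \<open>T\<close>, the point \<open>-1\<close> is not in the spectrum, so \<open>I + T\<close> is invertible.\<close>

definition cayley :: "('a::complex_banach \<Rightarrow>\<^sub>L 'a) \<Rightarrow> 'a \<Rightarrow>\<^sub>L 'a" where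
  "cayley T = (id_blinfun - T) o\<^sub>L op_inverse (id_blinfun + T)"

text \<open>
  \<open>g(T)\<close> for the power series \<open>g\<close> with coefficients \<open>c\<close>; the limit is taken in operator norm.
\<close>

definition power_series_op :: "(nat \<Rightarrow> real) \<Rightarrow> ('a::complex_banach \<Rightarrow>\<^sub>L 'a) \<Rightarrow> 'a \<Rightarrow>\<^sub>L 'a" where
  "power_series_op c T = (\<Sum>n. c n *\<^sub>R op_power T n)"

end

theory Submission
  imports Defs "HOL-Complex_Analysis.Complex_Analysis"
begin

text \<open>
  Let \<open>p\<close> be a convex combination of powers and \<open>z\<close> a point separated from the values of \<open>p\<close> on a
  domain with vertex \<open>1\<close> that carries the spectrum of \<open>T\<close>. The resolvent of \<open>p(T)\<close> at \<open>z\<close> should be the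
  Cauchy integral of \<open>f = 1 / (z - p)\<close> against the resolvent of \<open>T\<close> along the boundary of that domain.
  The difficulty is the vertex: the resolvent of \<open>T\<close> grows like \<open>1 / |1 - \<lambda>|\<close> there, \<open>f\<close> does not vanish,
  and \<open>p\<close> may approach \<open>1\<close> arbitrarily slowly, so the absolute value of the integrand is not integrable
  with a bound uniform in \<open>p\<close> and \<open>z\<close>.

  The cancellation between the two sides of the contour repairs this (\<open>keyhole_integral_estimate\<close>).
  Replace \<open>f\<close> at both points at distance \<open>r\<close> from the vertex by its value at \<open>1 - r\<close>. The resolvent terms
  that then meet \<open>f (1 - r)\<close> form the derivative in \<open>r\<close> of an integral of the resolvent over an arc of
  radius \<open>r\<close>, which is bounded; integration by parts moves the derivative to \<open>f\<close>. Both the replacement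
  error and this derivative are dominated by \<open>|1 - z| p'(q) / (|1 - z| + 1 - p(q))\<^sup>2\<close> with
  \<open>q = 1 - \<kappa> r\<close> (up to constants), because the coefficients of \<open>p\<close> are nonnegative. This is an exact
  derivative of a function of \<open>r\<close> with values in the unit interval, so its integral is at most \<open>1/\<kappa>\<close>
  whatever \<open>p\<close> and \<open>z\<close> are (\<open>op_poly_resolvent\<close>). The same estimate with \<open>f = \<lambda>\<^sup>n\<close> shows that \<open>T\<close> is
  power bounded. Truncating \<open>g\<close>, with the missing mass put on the constant term, and passing to the limit
  yields the resolvent of \<open>g(T)\<close> with the same bound (\<open>power_series_resolvent\<close>).

  What is left is plane geometry. Closed Stolz domains are invariant under convex combinations of powers,
  since \<open>k |1 - \<lambda>| \<le> 1 - |\<lambda>|\<close> implies \<open>k |1 - \<lambda>\<^sup>n| \<le> 1 - |\<lambda>|\<^sup>n\<close>; the contour is then taken in the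
  variable \<open>\<mu> = 1 - \<lambda>\<close>. For the angle, the contour is taken in the variable \<open>\<mu>\<close> of the Cayley transform,
  where the domain is a sector: the corresponding lens of values \<open>\<lambda> = (1 - \<mu>) / (1 + \<mu>)\<close> is closed under
  multiplication, and \<open>1 - \<lambda>\<^sup>n\<close> stays in the sector, which is convex. To treat both cases at once the
  contour encloses the spectrum of an auxiliary operator \<open>B\<close>, and \<open>T = \<phi>(B)\<close>.

  For \<open>\<sigma> = 1\<close> the resolvent bounds confine the spectrum of \<open>g(T)\<close> only to \<open>[0, 1]\<close>, while the closed
  Stolz domain is \<open>{1}\<close>. As \<open>T\<close> has spectrum in \<open>{1}\<close>, the contour can be shrunk to the part of a Stolz
  domain near \<open>1\<close>, where \<open>g\<close> is close to \<open>1\<close>, hence away from any given \<open>z \<noteq> 1\<close>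
  (\<open>spectrum_stolz_type_one\<close>).
\<close>

section \<open>Operators on complex Banach spaces\<close>

lemma bounded_bilinear_scaleC: "bounded_bilinear (\<lambda>z (x::'a::complex_banach). z *\<^sub>C x)"
proof
  show "(r *\<^sub>R z) *\<^sub>C x = r *\<^sub>R (z *\<^sub>C x)" for r z and x :: 'a
    by (simp only: scaleR_conv_of_real[of r z] scaleR_scaleC[of r "z *\<^sub>C x"] scaleC_scaleC)
  show "z *\<^sub>C (r *\<^sub>R x) = r *\<^sub>R (z *\<^sub>C x)" for r z and x :: 'a
    by (simp add: scaleR_scaleC scaleC_scaleC mult.commute)
  show "\<exists>K. \<forall>z (x::'a). norm (z *\<^sub>C x) \<le> norm z * norm x * K"
    by (rule exI[of _ 1]) (simp add: norm_scaleC)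
qed (auto simp: scaleC_add_right scaleC_add_left)

lemmas continuous_on_scaleC [continuous_intros] =
  bounded_bilinear.continuous_on[OF bounded_bilinear_scaleC]
lemmas scaleC_diff_left = bounded_bilinear.diff_left[OF bounded_bilinear_scaleC]
lemmas scaleC_diff_right = bounded_bilinear.diff_right[OF bounded_bilinear_scaleC]
lemmas scaleC_zero_left [simp] = bounded_bilinear.zero_left[OF bounded_bilinear_scaleC]
lemmas scaleC_zero_right [simp] = bounded_bilinear.zero_right[OF bounded_bilinear_scaleC]
lemmas scaleC_minus_left = bounded_bilinear.minus_left[OF bounded_bilinear_scaleC]
lemmas scaleC_minus_right = bounded_bilinear.minus_right[OF bounded_bilinear_scaleC]
lemmas scaleC_sum_right = bounded_bilinear.sum_right[OF bounded_bilinear_scaleC]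

lemma scaleC_one [simp]: "1 *\<^sub>C (x::'a::complex_banach) = x"
  using scaleR_scaleC[of 1 x] by simp

lemma scaleC_of_real: "of_real r *\<^sub>C (x::'a::complex_banach) = r *\<^sub>R x"
  by (simp add: scaleR_scaleC)

lemma scaleC_scaleR: "z *\<^sub>C (r *\<^sub>R x) = r *\<^sub>R (z *\<^sub>C (x::'a::complex_banach))"
  by (simp add: scaleR_scaleC scaleC_scaleC mult.commute)

lemma apply_scalar_op [simp]: "(scalar_op z) x = z *\<^sub>C x"
  by (simp add: scalar_op.rep_eq)

lemma cbounded_ops_scaleC:
  fixes T :: "'a::complex_banach \<Rightarrow>\<^sub>L 'a"
  shows "T \<in> cbounded_ops \<Longrightarrow> T (z *\<^sub>C x) = z *\<^sub>C T x"
  by (simp add: cbounded_ops_def)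

lemma scalar_op_minus_in_cbounded_ops:
  "T \<in> cbounded_ops \<Longrightarrow> scalar_op z - T \<in> cbounded_ops"
  by (simp add: cbounded_ops_def blinfun.diff_left scaleC_diff_right scaleC_scaleC mult.commute)

lemma op_power_in_cbounded_ops: "T \<in> cbounded_ops \<Longrightarrow> op_power T n \<in> cbounded_ops"
  by (induction n) (auto simp: cbounded_ops_def)

lemma closed_cbounded_ops: "closed (cbounded_ops :: ('a::complex_banach \<Rightarrow>\<^sub>L 'a) set)"
proof -
  have "closed {T :: 'a \<Rightarrow>\<^sub>L 'a. T (z *\<^sub>C x) = z *\<^sub>C T x}" for z x
    by (intro closed_Collect_eq continuous_intros)
  then have "closed (\<Inter>z x. {T :: 'a \<Rightarrow>\<^sub>L 'a. T (z *\<^sub>C x) = z *\<^sub>C T x})"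
    by blast
  moreover have "cbounded_ops = (\<Inter>z x. {T :: 'a \<Rightarrow>\<^sub>L 'a. T (z *\<^sub>C x) = z *\<^sub>C T x})"
    by (auto simp: cbounded_ops_def)
  ultimately show ?thesis by simp
qed

lemma is_op_inverse_apply:
  fixes U S :: "'a::complex_banach \<Rightarrow>\<^sub>L 'a"
  assumes "is_op_inverse U S"
  shows "U (S x) = x" "S (U x) = x"
  using assms by (metis blinfun_apply_blinfun_compose id_blinfun.rep_eq id_apply is_op_inverse_def)+

lemma is_op_inverse_unique:
  assumes "is_op_inverse U S" "is_op_inverse U S'"
  shows "S = S'"
  by (rule blinfun_eqI) (metis assms is_op_inverse_apply)

lemma op_inverse_eq: "is_op_inverse U S \<Longrightarrow> op_inverse U = S"
  unfolding op_inverse_def by (rule the_equality) (auto intro: is_op_inverse_unique)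

lemma is_op_inverseI:
  fixes U S :: "'a::complex_banach \<Rightarrow>\<^sub>L 'a"
  assumes "S \<in> cbounded_ops" "\<And>x. U (S x) = x"
    "\<And>x. S (U x) = x"
  shows "is_op_inverse U S"
  using assms by (auto simp: is_op_inverse_def intro!: blinfun_eqI)

lemma resolvent_is_op_inverse:
  "z \<notin> op_spectrum T \<Longrightarrow> is_op_inverse (scalar_op z - T) (resolvent z T)"
  by (auto simp: op_spectrum_def resolvent_def op_inverse_eq)

lemma is_op_inverse_resolvent:
  assumes "is_op_inverse (scalar_op z - T) S"
  shows "z \<notin> op_spectrum T" "resolvent z T = S"
  using assms by (auto simp: op_spectrum_def resolvent_def op_inverse_eq)

lemma resolvent_identity:
  fixes B :: "'a::complex_banach \<Rightarrow>\<^sub>L 'a"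
  assumes S: "is_op_inverse (scalar_op \<mu> - B) S" and S': "is_op_inverse (scalar_op \<nu> - B) S'"
  shows "S' x - S x = (\<mu> - \<nu>) *\<^sub>C S' (S x)"
proof -
  define y where "y = S x"
  have "x = (\<mu> - \<nu>) *\<^sub>C y + (\<nu> *\<^sub>C y - B y)"
    using is_op_inverse_apply(1)[OF S, of x] by (simp add: y_def scaleC_diff_left blinfun.diff_left)
  then have "S' x = (\<mu> - \<nu>) *\<^sub>C S' y + y"
    using is_op_inverse_apply(2)[OF S', of y] cbounded_ops_scaleC[of S'] S'
    by (metis is_op_inverse_def apply_scalar_op blinfun.add_right blinfun.diff_left)
  then show ?thesis by (simp add: y_def)
qed

lemma norm_resolvent_diff_le:
  assumes "is_op_inverse (scalar_op \<mu> - B) S" "is_op_inverse (scalar_op \<nu> - B) S'"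
  shows "norm (S' - S) \<le> cmod (\<mu> - \<nu>) * norm S' * norm S"
proof (rule norm_blinfun_bound)
  fix x
  have "norm ((S' - S) x) = cmod (\<mu> - \<nu>) * norm (S' (S x))"
    by (simp add: blinfun.diff_left resolvent_identity[OF assms] norm_scaleC)
  also have "\<dots> \<le> cmod (\<mu> - \<nu>) * (norm S' * (norm S * norm x))"
    by (intro mult_left_mono order_trans[OF norm_blinfun] norm_blinfun) auto
  finally show "norm ((S' - S) x) \<le> cmod (\<mu> - \<nu>) * norm S' * norm S * norm x"
    by (simp add: mult_ac)
qed auto

lemma norm_scalar_op_compose: "norm (scalar_op a o\<^sub>L S) = cmod a * norm S"
proof (rule antisym)
  show "norm (scalar_op a o\<^sub>L S) \<le> cmod a * norm S"
    by (rule norm_blinfun_bound)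
       (auto simp: norm_scaleC mult.assoc intro!: mult_left_mono norm_blinfun)
  show "cmod a * norm S \<le> norm (scalar_op a o\<^sub>L S)"
  proof (cases "a = 0")
    case False
    have "norm S \<le> norm (scalar_op a o\<^sub>L S) / cmod a"
    proof (rule norm_blinfun_bound)
      show "norm (S x) \<le> norm (scalar_op a o\<^sub>L S) / cmod a * norm x" for x
        using norm_blinfun[of "scalar_op a o\<^sub>L S" x] False by (simp add: norm_scaleC field_simps)
    qed simp
    then show ?thesis using False by (simp add: field_simps)
  qed simp
qed

text \<open>
  The inverse of a linear bijection is linear, so linearity of \<open>Q\<close> need not be assumed: this is how an
  operator is obtained from a vector-valued contour integral.
\<close>

lemma is_op_inverse_of_function:
  fixes U :: "'a::complex_banach \<Rightarrow>\<^sub>L 'a"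
  assumes U: "U \<in> cbounded_ops" and K: "0 \<le> K"
    and UQ: "\<And>x. U (Q x) = x" and QU: "\<And>x. Q (U x) = x"
    and Q: "\<And>x. norm (Q x) \<le> K * norm x"
  obtains S where "is_op_inverse U S" "norm S \<le> K"
proof
  have lin: "bounded_linear Q"
  proof (rule bounded_linear_intro)
    show "Q (x + y) = Q x + Q y" for x y
      using QU[of "Q x + Q y"] by (simp add: blinfun.add_right UQ)
    show "Q (r *\<^sub>R x) = r *\<^sub>R Q x" for r x
      using QU[of "r *\<^sub>R Q x"] by (simp add: blinfun.scaleR_right UQ)
    show "norm (Q x) \<le> norm x * K" for x
      using Q[of x] by (simp add: mult.commute)
  qed
  have [simp]: "blinfun_apply (Blinfun Q) = Q"
    by (rule bounded_linear_Blinfun_apply[OF lin])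
  have "Q (z *\<^sub>C x) = z *\<^sub>C Q x" for z x
    using QU[of "z *\<^sub>C Q x"] by (simp add: cbounded_ops_scaleC[OF U] UQ)
  then have "Blinfun Q \<in> cbounded_ops" by (simp add: cbounded_ops_def)
  then show "is_op_inverse U (Blinfun Q)" by (auto intro!: is_op_inverseI simp: UQ QU)
  show "norm (Blinfun Q) \<le> K" by (rule norm_blinfun_bound) (auto simp: K Q)
qed

text \<open>
  The inverses form a Cauchy sequence by \<open>S\<^sub>m - S\<^sub>n = S\<^sub>m (A\<^sub>n - A\<^sub>m) S\<^sub>n\<close>.
\<close>

lemma is_op_inverse_limit:
  fixes A :: "nat \<Rightarrow> 'a::complex_banach \<Rightarrow>\<^sub>L 'a"
  assumes A: "A \<longlonglongrightarrow> A0" and S: "\<And>n. is_op_inverse (A n) (S n)" and K: "\<And>n. norm (S n) \<le> K"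
  obtains S0 where "is_op_inverse A0 S0" "norm S0 \<le> K"
proof -
  have K0: "0 \<le> K" using K[of 0] norm_ge_zero order_trans by blast
  have diff: "norm (S m - S n) \<le> K * K * norm (A m - A n)" for m n
  proof (rule norm_blinfun_bound)
    fix x
    have "(S m - S n) x
        = (S m) ((A n - A m) ((S n) x))"
      by (simp add: blinfun.diff_left blinfun.diff_right is_op_inverse_apply[OF S])
    also have "norm \<dots> \<le> K * norm ((A n - A m) ((S n) x))"
      using norm_blinfun[of "S m"] K[of m] by (meson mult_right_mono norm_ge_zero order_trans)
    also have "\<dots> \<le> K * (norm (A n - A m) * norm ((S n) x))"
      by (intro mult_left_mono norm_blinfun K0)
    also have "\<dots> \<le> K * (norm (A n - A m) * (K * norm x))"
      using order_trans[OF norm_blinfun[of "S n" x] mult_right_mono[OF K[of n] norm_ge_zero]] K0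
      by (intro mult_left_mono) auto
    finally show "norm ((S m - S n) x) \<le> K * K * norm (A m - A n) * norm x"
      by (simp add: norm_minus_commute mult_ac)
  qed (use K0 in auto)
  have "Cauchy S"
  proof (rule metric_CauchyI)
    fix e :: real assume e: "0 < e"
    have "Cauchy A" using A by (rule LIMSEQ_imp_Cauchy)
    then obtain M where M: "\<And>m n. m \<ge> M \<Longrightarrow> n \<ge> M \<Longrightarrow> dist (A m) (A n) < e / (K * K + 1)"
      using e by (metis metric_CauchyD add_nonneg_pos divide_pos_pos zero_le_square zero_less_one)
    show "\<exists>M. \<forall>m\<ge>M. \<forall>n\<ge>M. dist (S m) (S n) < e"
    proof (intro exI allI impI)
      fix m n assume "m \<ge> M" "n \<ge> M"
      then have "norm (A m - A n) < e / (K * K + 1)" using M by (simp add: dist_norm)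
      then have "(K * K + 1) * norm (A m - A n) < e"
        by (simp add: pos_less_divide_eq add_nonneg_pos mult.commute)
      moreover have "K * K * norm (A m - A n) \<le> (K * K + 1) * norm (A m - A n)"
        by (intro mult_right_mono) auto
      ultimately show "dist (S m) (S n) < e" using diff[of m n] by (simp add: dist_norm)
    qed
  qed
  then obtain S0 where S0: "S \<longlonglongrightarrow> S0" by (auto simp: Cauchy_convergent_iff convergent_def)
  have "S0 \<in> cbounded_ops"
    using closed_sequentially[OF closed_cbounded_ops _ S0] S by (auto simp: is_op_inverse_def)
  moreover have "A0 o\<^sub>L S0 = id_blinfun"
  proof (rule LIMSEQ_unique)
    show "(\<lambda>n. A n o\<^sub>L S n) \<longlonglongrightarrow> (A0 o\<^sub>L S0)" by (intro tendsto_intros A S0)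
    show "(\<lambda>n. A n o\<^sub>L S n) \<longlonglongrightarrow> id_blinfun" using S by (simp add: is_op_inverse_def)
  qed
  moreover have "S0 o\<^sub>L A0 = id_blinfun"
  proof (rule LIMSEQ_unique)
    show "(\<lambda>n. S n o\<^sub>L A n) \<longlonglongrightarrow> (S0 o\<^sub>L A0)" by (intro tendsto_intros A S0)
    show "(\<lambda>n. S n o\<^sub>L A n) \<longlonglongrightarrow> id_blinfun" using S by (simp add: is_op_inverse_def)
  qed
  moreover have "norm S0 \<le> K"
    by (rule LIMSEQ_le_const2[OF tendsto_norm[OF S0]]) (use K in auto)
  ultimately show thesis using that by (auto simp: is_op_inverse_def)
qed

section \<open>Translating a contour\<close>

lemma integral_scaleC_left:
  "f integrable_on S \<Longrightarrow> integral S (\<lambda>t. f t *\<^sub>C (x::'a::complex_banach)) = integral S f *\<^sub>C x"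
  using integral_linear[of f S "\<lambda>z. z *\<^sub>C x"]
  by (simp add: bounded_bilinear.bounded_linear_left[OF bounded_bilinear_scaleC] o_def)

text \<open>
  Cauchy's theorem for translates of a curve. Differentiation in \<open>s\<close> and in \<open>t\<close> both produce
  \<open>w' t *\<^sub>C H' (w t + s)\<close>, so the derivative in \<open>s\<close> of the curve integral is the integral of an
  exact derivative in \<open>t\<close>.
\<close>

lemma curve_integral_translate_derivative:
  fixes H H' :: "complex \<Rightarrow> 'a::complex_banach" and w :: "real \<Rightarrow> complex"
  assumes H: "\<And>v. v \<in> W \<Longrightarrow> (H has_derivative (\<lambda>h. h *\<^sub>C H' v)) (at v within W)"
    and H': "continuous_on W H'"
    and w: "\<And>t. t \<in> {a..b} \<Longrightarrow> (w has_vector_derivative w' t) (at t within {a..b})"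
    and w': "continuous_on {a..b} w'" and ab: "a \<le> b"
    and mem: "\<And>s t. s \<in> U \<Longrightarrow> t \<in> {a..b} \<Longrightarrow> w t + of_real s \<in> W"
    and U: "convex U" "s0 \<in> U"
  shows "((\<lambda>s. integral {a..b} (\<lambda>t. w' t *\<^sub>C H (w t + of_real s))) has_vector_derivative
          (H (w b + of_real s0) - H (w a + of_real s0))) (at s0 within U)"
proof -
  have Hc: "continuous_on W H"
    using H has_derivative_continuous continuous_on_eq_continuous_within by blast
  have wc: "continuous_on {a..b} w"
    using w has_vector_derivative_continuous continuous_on_eq_continuous_within by blast
  have pair: "continuous_on (U \<times> {a..b}) (\<lambda>p. w (snd p) + of_real (fst p))"
    by (intro continuous_intros continuous_on_compose2[OF wc]) auto
  have "((\<lambda>s. integral (cbox a b) (\<lambda>t. w' t *\<^sub>C H (w t + of_real s))) has_vector_derivative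
          integral (cbox a b) (\<lambda>t. w' t *\<^sub>C H' (w t + of_real s0))) (at s0 within U)"
  proof (rule leibniz_rule_vector_derivative[where U = U])
    fix s t assume s: "s \<in> U" and t: "t \<in> cbox a b"
    have t': "t \<in> {a..b}" using t by simp
    have "((\<lambda>s. H (w t + of_real s)) has_vector_derivative 1 *\<^sub>C H' (w t + of_real s)) (at s within U)"
    proof -
      have 1: "((\<lambda>s. w t + complex_of_real s) has_derivative (\<lambda>h. of_real h)) (at s within U)"
        by (auto intro!: derivative_eq_intros)
      have "(H has_derivative (\<lambda>h. h *\<^sub>C H' (w t + of_real s)))
          (at (w t + of_real s) within (\<lambda>s. w t + of_real s) ` U)"
        by (rule has_derivative_subset[OF H]) (use mem s t' in auto)
      from diff_chain_within[OF 1 this] show ?thesis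
        by (simp add: has_vector_derivative_def o_def scaleC_of_real)
    qed
    then have *: "((\<lambda>s. H (w t + of_real s)) has_vector_derivative H' (w t + of_real s)) (at s within U)"
      by simp
    show "((\<lambda>s. w' t *\<^sub>C H (w t + of_real s)) has_vector_derivative w' t *\<^sub>C H' (w t + of_real s)) (at s within U)"
      by (rule bounded_linear.has_vector_derivative[OF bounded_linear_scaleC *])
  next
    fix s assume s: "s \<in> U"
    show "(\<lambda>t. w' t *\<^sub>C H (w t + of_real s)) integrable_on cbox a b"
      unfolding cbox_interval
      by (intro integrable_continuous_real continuous_intros w' wc continuous_on_compose2[OF Hc])
         (use mem s in auto)
  next
    show "continuous_on (U \<times> cbox a b) (\<lambda>(s, t). w' t *\<^sub>C H' (w t + of_real s))"
      unfolding case_prod_unfold cbox_interval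
      by (intro continuous_on_scaleC continuous_on_compose2[OF H' pair] continuous_on_compose2[OF w'])
         (use mem in \<open>auto intro!: continuous_intros\<close>)
  qed (use U in auto)
  moreover have "((\<lambda>t. w' t *\<^sub>C H' (w t + of_real s0)) has_integral
      (H (w b + of_real s0) - H (w a + of_real s0))) {a..b}"
  proof (rule fundamental_theorem_of_calculus[OF ab])
    fix t assume t: "t \<in> {a..b}"
    have 1: "((\<lambda>t. w t + of_real s0) has_derivative (\<lambda>h. h *\<^sub>R w' t)) (at t within {a..b})"
      using w[OF t] unfolding has_vector_derivative_def by (auto intro!: derivative_eq_intros)
    have "(H has_derivative (\<lambda>h. h *\<^sub>C H' (w t + of_real s0)))
        (at (w t + of_real s0) within (\<lambda>t. w t + of_real s0) ` {a..b})"
      by (rule has_derivative_subset[OF H]) (use mem U t in auto)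
    from diff_chain_within[OF 1 this]
    show "((\<lambda>t. H (w t + of_real s0)) has_vector_derivative w' t *\<^sub>C H' (w t + of_real s0)) (at t within {a..b})"
      by (simp add: has_vector_derivative_def o_def scaleR_conv_of_real flip: scaleC_scaleC)
         (simp add: scaleC_of_real)
  qed
  ultimately show ?thesis by (simp add: integral_unique)
qed

section \<open>The keyhole contour in logarithmic coordinates\<close>

definition curve_integral :: "(real \<Rightarrow> complex) \<Rightarrow> (real \<Rightarrow> complex) \<Rightarrow> real \<Rightarrow> real \<Rightarrow>
    (complex \<Rightarrow> 'a::complex_banach) \<Rightarrow> 'a" where
  "curve_integral w w' a b F = integral {a..b} (\<lambda>t. w' t *\<^sub>C F (w t))"

definition C1_curve :: "(real \<Rightarrow> complex) \<Rightarrow> (real \<Rightarrow> complex) \<Rightarrow> real \<Rightarrow> real \<Rightarrow> bool" where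
  "C1_curve w w' a b \<longleftrightarrow> a \<le> b \<and> continuous_on {a..b} w' \<and>
     (\<forall>t\<in>{a..b}. (w has_vector_derivative w' t) (at t within {a..b}))"

lemma C1_curve_continuous: "C1_curve w w' a b \<Longrightarrow> continuous_on {a..b} w"
  unfolding C1_curve_def
  using has_vector_derivative_continuous continuous_on_eq_continuous_within by blast

lemma curve_integrable:
  fixes F :: "complex \<Rightarrow> 'a::complex_banach"
  assumes "C1_curve w w' a b" "continuous_on (w ` {a..b}) F"
  shows "(\<lambda>t. w' t *\<^sub>C F (w t)) integrable_on {a..b}"
  using assms C1_curve_continuous[OF assms(1)] unfolding C1_curve_def
  by (intro integrable_continuous_real continuous_intros continuous_on_compose2[OF assms(2)]) auto

lemma curve_integral_bound:
  fixes F :: "complex \<Rightarrow> 'a::complex_banach"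
  assumes w: "C1_curve w w' a b" and F: "continuous_on (w ` {a..b}) F"
    and K: "\<And>t. t \<in> {a..b} \<Longrightarrow> norm (F (w t)) \<le> K" and L: "\<And>t. t \<in> {a..b} \<Longrightarrow> norm (w' t) \<le> L"
  shows "norm (curve_integral w w' a b F) \<le> L * K * (b - a)"
  unfolding curve_integral_def
proof (rule integral_bound)
  show "a \<le> b" using w by (simp add: C1_curve_def)
  show "continuous_on {a..b} (\<lambda>t. w' t *\<^sub>C F (w t))"
    using w C1_curve_continuous[OF w] unfolding C1_curve_def
    by (intro continuous_intros continuous_on_compose2[OF F]) auto
  show "\<And>t. t \<in> {a..b} \<Longrightarrow> norm (w' t *\<^sub>C F (w t)) \<le> L * K"
    using K L by (simp add: norm_scaleC) (meson mult_mono norm_ge_zero order_trans)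
qed

lemma curve_integral_add:
  fixes F G :: "complex \<Rightarrow> 'a::complex_banach"
  assumes "C1_curve w w' a b" "continuous_on (w ` {a..b}) F" "continuous_on (w ` {a..b}) G"
  shows "curve_integral w w' a b (\<lambda>v. F v + G v) = curve_integral w w' a b F + curve_integral w w' a b G"
  unfolding curve_integral_def
  by (simp add: scaleC_add_right integral_add curve_integrable assms)

lemma curve_integral_linear:
  fixes F :: "complex \<Rightarrow> 'a::complex_banach" and A :: "'a \<Rightarrow> 'b::complex_banach"
  assumes "C1_curve w w' a b" "continuous_on (w ` {a..b}) F" "bounded_linear A"
    and A: "\<And>z x. A (z *\<^sub>C x) = z *\<^sub>C A x"
  shows "curve_integral w w' a b (\<lambda>v. A (F v)) = A (curve_integral w w' a b F)"
  unfolding curve_integral_def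
  using integral_linear[OF curve_integrable[OF assms(1,2)] assms(3)] by (simp add: o_def A)

lemma curve_integral_const:
  fixes x :: "'a::complex_banach"
  assumes "C1_curve w w' a b"
  shows "curve_integral w w' a b (\<lambda>v. x) = (w b - w a) *\<^sub>C x"
proof -
  have "(w' has_integral (w b - w a)) {a..b}"
    by (rule fundamental_theorem_of_calculus) (use assms in \<open>auto simp: C1_curve_def\<close>)
  then show ?thesis
    unfolding curve_integral_def by (simp add: integral_scaleC_left has_integral_integrable integral_unique)
qed

lemma curve_integral_scaleC_left:
  assumes "C1_curve w w' a b" "continuous_on (w ` {a..b}) F"
  shows "curve_integral w w' a b (\<lambda>v. F v *\<^sub>C x) = curve_integral w w' a b F *\<^sub>C x"
  unfolding curve_integral_def scaleC_scaleC[symmetric] using curve_integrable[OF assms]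
  by (simp add: integral_scaleC_left scaleC_scaleC scaleC_complex_def)

abbreviation log_polar :: "real \<Rightarrow> real \<Rightarrow> complex" where
  "log_polar u \<theta> \<equiv> of_real u + \<i> * of_real \<theta>"

lemma log_polar_shift: "log_polar u \<theta> + of_real s = log_polar (u + s) \<theta>"
  by simp

lemma exp_log_polar: "exp (log_polar u \<theta>) = of_real (exp u) * cis \<theta>"
  by (simp add: exp_add exp_of_real cis_conv_exp)

lemma norm_exp_log_polar: "cmod (exp (log_polar u \<theta>)) = exp u"
  by (simp add: norm_exp_eq_Re)

lemma exp_log_polar_periodic: "exp (log_polar u (2 * pi - \<theta>)) = exp (log_polar u (- \<theta>))"
  unfolding exp_log_polar by (simp add: complex_eq_iff)

text \<open>
  The contour surrounds a domain \<open>{r e\<^sup>i\<^sup>\<theta> : |\<theta>| \<le> \<beta>, log r \<le> \<eta> \<theta>}\<close> with vertex \<open>0\<close>. It is described in the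
  coordinate \<open>w = log \<mu>\<close>: rays and arcs become straight segments, dilation becomes translation, and
  the measure \<open>d\<mu> / \<mu>\<close>, for which the resolvent estimate is scale invariant, becomes \<open>dw\<close>. The outer
  boundary curve \<open>\<eta>\<close> meets both rays at the same height \<open>u0\<close> and does not fall below \<open>u0\<close> on the
  axis, so that the positive half-line up to the radius of the ray ends belongs to the domain.
\<close>

locale keyhole_contour =
  fixes \<beta> u0 L1 :: real and \<eta> \<eta>' :: "real \<Rightarrow> real"
  assumes \<beta>: "0 < \<beta>" "\<beta> < pi"
    and \<eta>: "\<And>t. t \<in> {-\<beta>..\<beta>} \<Longrightarrow> (\<eta> has_real_derivative \<eta>' t) (at t within {-\<beta>..\<beta>})"
    and \<eta>'_continuous: "continuous_on {-\<beta>..\<beta>} \<eta>'"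
    and \<eta>'_bound: "\<And>t. t \<in> {-\<beta>..\<beta>} \<Longrightarrow> \<bar>\<eta>' t\<bar> \<le> L1"
    and \<eta>_ends: "\<eta> \<beta> = u0" "\<eta> (-\<beta>) = u0"
    and \<eta>_center: "u0 \<le> \<eta> 0"
begin

definition outer :: "real \<Rightarrow> complex" where "outer t = log_polar (\<eta> t) t"
definition outer' :: "real \<Rightarrow> complex" where "outer' t = of_real (\<eta>' t) + \<i>"

text \<open>
  Near the vertex the domain is closed off by an arc of radius \<open>exp l\<close> outside the sector, passing
  through the negative half-line. The angle runs up to \<open>2\<pi> - \<beta>\<close>, whereas the lower ray is parametrised with
  angle \<open>-\<beta>\<close>; the two descriptions differ by the period of the exponential.
\<close>

definition keyhole :: "real \<Rightarrow> complex set" where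
  "keyhole l = outer ` {-\<beta>..\<beta>} \<union> (\<lambda>t. log_polar t \<beta>) ` {l..u0} \<union>
     log_polar l ` {\<beta>..2 * pi - \<beta>} \<union> (\<lambda>t. log_polar t (-\<beta>)) ` {l..u0}"

definition keyhole_integral :: "real \<Rightarrow> (complex \<Rightarrow> 'a::complex_banach) \<Rightarrow> 'a" where
  "keyhole_integral l F =
     curve_integral outer outer' (-\<beta>) \<beta> F - curve_integral (\<lambda>t. log_polar t \<beta>) (\<lambda>_. 1) l u0 F
     + curve_integral (log_polar l) (\<lambda>_. \<i>) \<beta> (2 * pi - \<beta>) F
     + curve_integral (\<lambda>t. log_polar t (-\<beta>)) (\<lambda>_. 1) l u0 F"

definition inner_region :: "complex set" where
  "inner_region = {exp (log_polar u \<theta>) | u \<theta>. \<bar>\<theta>\<bar> \<le> \<beta> \<and> u \<le> \<eta> \<theta>}"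

lemma axis_in_inner_region: "t \<le> u0 \<Longrightarrow> of_real (exp t) \<in> inner_region"
proof -
  assume "t \<le> u0"
  then have "exp (log_polar t 0) \<in> inner_region"
    unfolding inner_region_def using \<eta>_center \<beta> by (intro CollectI exI[of _ t] exI[of _ 0]) auto
  then show ?thesis by (simp add: exp_of_real)
qed

lemma ray_in_inner_region: "t \<le> u0 \<Longrightarrow> \<theta> \<in> {\<beta>, -\<beta>} \<Longrightarrow> exp (log_polar t \<theta>) \<in> inner_region"
  unfolding inner_region_def using \<eta>_ends \<beta> by (intro CollectI exI[of _ t] exI[of _ \<theta>]) auto

lemma C1_outer: "C1_curve outer outer' (-\<beta>) \<beta>"
  unfolding C1_curve_def outer_def[abs_def] outer'_def[abs_def]
proof (intro conjI ballI)
  show "((\<lambda>t. log_polar (\<eta> t) t) has_vector_derivative of_real (\<eta>' t) + \<i>) (at t within {-\<beta>..\<beta>})"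
    if "t \<in> {-\<beta>..\<beta>}" for t
    using \<eta>[OF that] by (auto intro!: derivative_eq_intros simp: has_real_derivative_iff_has_vector_derivative)
qed (use \<beta> \<eta>'_continuous in \<open>auto intro!: continuous_intros\<close>)

lemma C1_ray: "l \<le> u0 \<Longrightarrow> C1_curve (\<lambda>t. log_polar t \<theta>) (\<lambda>_. 1) l u0"
  unfolding C1_curve_def by (auto intro!: derivative_eq_intros)

lemma C1_arc: "C1_curve (log_polar l) (\<lambda>_. \<i>) \<beta> (2 * pi - \<beta>)"
  unfolding C1_curve_def using \<beta> by (auto intro!: derivative_eq_intros)

lemmas C1_keyhole = C1_outer C1_ray C1_arc

lemma L1_nonneg: "0 \<le> L1"
  using \<eta>'_bound[of 0] \<beta> by auto

lemma norm_outer': "t \<in> {-\<beta>..\<beta>} \<Longrightarrow> cmod (outer' t) \<le> L1 + 1"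
  unfolding outer'_def using \<eta>'_bound[of t] norm_triangle_ineq[of "of_real (\<eta>' t)" \<i>] by simp

lemma outer_in_keyhole: "t \<in> {-\<beta>..\<beta>} \<Longrightarrow> outer t \<in> keyhole l"
  by (auto simp: keyhole_def)
lemma upper_ray_in_keyhole: "t \<in> {l..u0} \<Longrightarrow> log_polar t \<beta> \<in> keyhole l"
  by (auto simp: keyhole_def)
lemma lower_ray_in_keyhole: "t \<in> {l..u0} \<Longrightarrow> log_polar t (-\<beta>) \<in> keyhole l"
  unfolding keyhole_def by blast
lemma arc_in_keyhole: "t \<in> {\<beta>..2*pi-\<beta>} \<Longrightarrow> log_polar l t \<in> keyhole l"
  unfolding keyhole_def by blast

lemmas in_keyhole = outer_in_keyhole upper_ray_in_keyhole lower_ray_in_keyhole arc_in_keyhole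

lemma keyhole_continuous:
  assumes "continuous_on (keyhole l) F"
  shows "continuous_on (outer ` {-\<beta>..\<beta>}) F" "continuous_on ((\<lambda>t. log_polar t \<beta>) ` {l..u0}) F"
    "continuous_on ((\<lambda>t. log_polar t (-\<beta>)) ` {l..u0}) F"
    "continuous_on (log_polar l ` {\<beta>..2*pi-\<beta>}) F"
  by (rule continuous_on_subset[OF assms], use in_keyhole in auto)+

definition keyhole_length :: "real \<Rightarrow> real" where
  "keyhole_length l = 2 * \<beta> * (L1 + 1) + 2 * (u0 - l) + (2 * pi - 2 * \<beta>)"

lemma keyhole_integral_bound:
  fixes F :: "complex \<Rightarrow> 'a::complex_banach"
  assumes l: "l \<le> u0" and F: "continuous_on (keyhole l) F"
    and K: "\<And>w. w \<in> keyhole l \<Longrightarrow> norm (F w) \<le> K"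
  shows "norm (keyhole_integral l F) \<le> K * keyhole_length l"
proof -
  note Fc = keyhole_continuous[OF F]
  have 1: "norm (curve_integral outer outer' (-\<beta>) \<beta> F) \<le> (L1 + 1) * K * (\<beta> - - \<beta>)"
    by (rule curve_integral_bound[OF C1_outer Fc(1)]) (use K in_keyhole norm_outer' in auto)
  have 2: "norm (curve_integral (\<lambda>t. log_polar t \<beta>) (\<lambda>_. 1) l u0 F) \<le> 1 * K * (u0 - l)"
    by (rule curve_integral_bound[OF C1_ray[OF l] Fc(2)]) (use K in_keyhole in auto)
  have 3: "norm (curve_integral (\<lambda>t. log_polar t (-\<beta>)) (\<lambda>_. 1) l u0 F) \<le> 1 * K * (u0 - l)"
    by (rule curve_integral_bound[OF C1_ray[OF l] Fc(3)]) (use K in_keyhole in blast, simp)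
  have 4: "norm (curve_integral (log_polar l) (\<lambda>_. \<i>) \<beta> (2*pi-\<beta>) F) \<le> 1 * K * (2*pi-\<beta> - \<beta>)"
    by (rule curve_integral_bound[OF C1_arc Fc(4)]) (use K in_keyhole in auto)
  have tri: "norm (a - b + c + d) \<le> norm a + norm b + norm c + norm d" for a b c d :: 'a
    by norm
  show ?thesis
    unfolding keyhole_integral_def
    by (rule order_trans[OF tri]) (use 1 2 3 4 in \<open>simp add: keyhole_length_def algebra_simps\<close>)
qed

lemma keyhole_integral_cong:
  assumes "\<And>w. w \<in> keyhole l \<Longrightarrow> F w = G w"
  shows "keyhole_integral l F = keyhole_integral l G"
  unfolding keyhole_integral_def curve_integral_def
  by (intro arg_cong2[where f = "(+)"] arg_cong2[where f = "(-)"] integral_cong)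
     (use assms in_keyhole in \<open>auto simp del: of_real_minus\<close>)

lemma keyhole_integral_add:
  fixes F G :: "complex \<Rightarrow> 'a::complex_banach"
  assumes l: "l \<le> u0" and F: "continuous_on (keyhole l) F" and G: "continuous_on (keyhole l) G"
  shows "keyhole_integral l (\<lambda>v. F v + G v) = keyhole_integral l F + keyhole_integral l G"
  unfolding keyhole_integral_def
  by (simp del: of_real_minus add: curve_integral_add C1_keyhole l keyhole_continuous[OF F] keyhole_continuous[OF G])

lemma keyhole_integral_linear:
  fixes F :: "complex \<Rightarrow> 'a::complex_banach" and A :: "'a \<Rightarrow> 'b::complex_banach"
  assumes l: "l \<le> u0" and F: "continuous_on (keyhole l) F"
    and A: "bounded_linear A" "\<And>z x. A (z *\<^sub>C x) = z *\<^sub>C A x"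
  shows "keyhole_integral l (\<lambda>v. A (F v)) = A (keyhole_integral l F)"
  unfolding keyhole_integral_def
  by (simp del: of_real_minus add: curve_integral_linear[OF _ _ A] C1_keyhole l keyhole_continuous[OF F]
      linear_add[OF bounded_linear.linear[OF A(1)]] linear_diff[OF bounded_linear.linear[OF A(1)]])

lemma keyhole_integral_diff:
  fixes F G :: "complex \<Rightarrow> 'a::complex_banach"
  assumes l: "l \<le> u0" and F: "continuous_on (keyhole l) F" and G: "continuous_on (keyhole l) G"
  shows "keyhole_integral l (\<lambda>v. F v - G v) = keyhole_integral l F - keyhole_integral l G"
proof -
  have "keyhole_integral l (\<lambda>v. - G v) = - keyhole_integral l G"
    by (rule keyhole_integral_linear[OF l G]) (auto simp: bounded_linear_minus bounded_linear_ident scaleC_minus_right)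
  then show ?thesis
    using keyhole_integral_add[OF l F, of "\<lambda>v. - G v"] G by (simp add: continuous_on_minus)
qed

lemma keyhole_integral_scaleC_left:
  assumes l: "l \<le> u0" and F: "continuous_on (keyhole l) F"
  shows "keyhole_integral l (\<lambda>v. F v *\<^sub>C x) = keyhole_integral l F *\<^sub>C x"
  unfolding keyhole_integral_def
  by (simp del: of_real_minus add: curve_integral_scaleC_left C1_keyhole l keyhole_continuous[OF F] scaleC_add_left scaleC_diff_left)

lemma keyhole_integral_const:
  fixes x :: "'a::complex_banach"
  assumes l: "l \<le> u0"
  shows "keyhole_integral l (\<lambda>v. x) = (2 * of_real pi * \<i>) *\<^sub>C x"
proof -
  have "keyhole_integral l (\<lambda>v. x) =
     ((outer \<beta> - outer (-\<beta>)) - (log_polar u0 \<beta> - log_polar l \<beta>)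
      + (log_polar l (2 * pi - \<beta>) - log_polar l \<beta>)
      + (log_polar u0 (-\<beta>) - log_polar l (-\<beta>))) *\<^sub>C x"
    unfolding keyhole_integral_def curve_integral_const[OF C1_outer] curve_integral_const[OF C1_arc]
      curve_integral_const[OF C1_ray[OF l]] by (simp only: scaleC_diff_left scaleC_add_left)
  also have "(outer \<beta> - outer (-\<beta>)) - (log_polar u0 \<beta> - log_polar l \<beta>)
      + (log_polar l (2 * pi - \<beta>) - log_polar l \<beta>)
      + (log_polar u0 (-\<beta>) - log_polar l (-\<beta>)) = 2 * of_real pi * \<i>"
    by (simp add: outer_def \<eta>_ends algebra_simps)
  finally show ?thesis .
qed

text \<open>
  The boundary terms of the four translated pieces telescope, except at the two ends of the small arc
  and the lower ray, which differ by the period \<open>2\<pi>i\<close>; there \<open>H\<close> takes equal values.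
\<close>

lemma keyhole_integral_translate:
  fixes H H' :: "complex \<Rightarrow> 'a::complex_banach"
  assumes H: "\<And>v. v \<in> W \<Longrightarrow> (H has_derivative (\<lambda>h. h *\<^sub>C H' v)) (at v within W)"
    and H': "continuous_on W H'" and l: "l \<le> u0"
    and mem: "\<And>s w. s \<in> U \<Longrightarrow> w \<in> keyhole l \<Longrightarrow> w + of_real s \<in> W"
    and per: "\<And>u. H (log_polar u (2 * pi - \<beta>)) = H (log_polar u (-\<beta>))"
    and U: "convex U" "s1 \<in> U" "s2 \<in> U"
  shows "keyhole_integral l (\<lambda>w. H (w + of_real s1)) = keyhole_integral l (\<lambda>w. H (w + of_real s2))"
proof -
  have d: "((\<lambda>s. curve_integral w w' a b (\<lambda>v. H (v + of_real s))) has_vector_derivative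
        (H (w b + of_real s) - H (w a + of_real s))) (at s within U)"
    if "C1_curve w w' a b" "\<And>t. t \<in> {a..b} \<Longrightarrow> w t \<in> keyhole l" "s \<in> U" for w w' a b s
    unfolding curve_integral_def
    by (rule curve_integral_translate_derivative[OF H H'])
       (use that mem U in \<open>auto simp: C1_curve_def\<close>)
  have "((\<lambda>s. keyhole_integral l (\<lambda>w. H (w + of_real s))) has_vector_derivative 0) (at s within U)"
    if s: "s \<in> U" for s
  proof -
    have "((\<lambda>s. keyhole_integral l (\<lambda>w. H (w + of_real s))) has_vector_derivative
       (H (outer \<beta> + of_real s) - H (outer (-\<beta>) + of_real s))
       - (H (log_polar u0 \<beta> + of_real s) - H (log_polar l \<beta> + of_real s))
       + (H (log_polar l (2 * pi - \<beta>) + of_real s) - H (log_polar l \<beta> + of_real s))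
       + (H (log_polar u0 (-\<beta>) + of_real s) - H (log_polar l (-\<beta>) + of_real s))) (at s within U)"
      unfolding keyhole_integral_def
      by (intro has_vector_derivative_add has_vector_derivative_diff d C1_keyhole l in_keyhole s)
    moreover have "H (log_polar l (2 * pi - \<beta>) + of_real s) = H (log_polar l (-\<beta>) + of_real s)"
      unfolding log_polar_shift by (rule per)
    ultimately show ?thesis by (simp add: outer_def \<eta>_ends)
  qed
  then have "((\<lambda>s. keyhole_integral l (\<lambda>w. H (w + of_real s))) has_derivative (\<lambda>h. 0)) (at s within U)"
    if "s \<in> U" for s
    using that by (simp add: has_vector_derivative_def)
  from has_derivative_zero_constant[OF U(1) this] U(2,3) show ?thesis by metis
qed

lemma keyhole_Re_bounded:
  obtains M where "\<And>w. w \<in> keyhole l \<Longrightarrow> \<bar>Re w\<bar> \<le> M"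
proof -
  have "compact (keyhole l)"
    unfolding keyhole_def
    by (intro compact_Un compact_continuous_image continuous_intros C1_curve_continuous[OF C1_outer]) auto
  then have "bounded (keyhole l)" by (rule compact_imp_bounded)
  then obtain M where "\<And>w. w \<in> keyhole l \<Longrightarrow> cmod w \<le> M" by (auto simp: bounded_iff)
  then have "\<And>w. w \<in> keyhole l \<Longrightarrow> \<bar>Re w\<bar> \<le> M" using abs_Re_le_cmod order_trans by blast
  then show thesis by (rule that)
qed

text \<open>
  Negative translations contract the contour towards the vertex, inside the domain or inside the disc
  that the small arc bounds.
\<close>

lemma exp_keyhole_shift_in:
  assumes "w \<in> keyhole l" "s \<le> 0" "inner_region \<subseteq> U" "cball 0 (exp l) \<subseteq> U"
  shows "exp (w + of_real s) \<in> U"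
proof -
  have in1: "exp (log_polar (u + s) \<theta>) \<in> U" if "\<bar>\<theta>\<bar> \<le> \<beta>" "u \<le> \<eta> \<theta>" for u \<theta>
  proof -
    have "u + s \<le> \<eta> \<theta>" using that assms(2) by simp
    then have "exp (log_polar (u + s) \<theta>) \<in> inner_region" using that(1) unfolding inner_region_def by blast
    then show ?thesis using assms(3) by blast
  qed
  have in2: "exp (log_polar (l + s) \<theta>) \<in> U" for \<theta>
  proof -
    have "cmod (exp (log_polar (l + s) \<theta>)) \<le> exp l" unfolding norm_exp_log_polar using assms(2) by simp
    then show ?thesis using assms(4) by (auto simp: dist_norm)
  qed
  from assms(1) consider t where "t \<in> {-\<beta>..\<beta>}" "w = log_polar (\<eta> t) t"
    | t where "t \<in> {l..u0}" "w = log_polar t \<beta>" | t where "w = log_polar l t"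
    | t where "t \<in> {l..u0}" "w = log_polar t (-\<beta>)"
    unfolding keyhole_def outer_def by blast
  then show ?thesis
  proof cases
    case 1 then show ?thesis unfolding 1(2) log_polar_shift by (intro in1) auto
  next
    case 2 then show ?thesis unfolding 2(2) log_polar_shift using \<beta> \<eta>_ends by (intro in1) auto
  next
    case 3 then show ?thesis unfolding 3 log_polar_shift by (intro in2)
  next
    case 4 then show ?thesis unfolding 4(2) log_polar_shift using \<beta> \<eta>_ends by (intro in1) auto
  qed
qed

lemmas exp_keyhole_in = exp_keyhole_shift_in[where s = 0, simplified]

text \<open>
  Cauchy's theorem by contraction: translating the contour to \<open>-\<infinity>\<close> keeps the integral and makes the
  integrand tend to \<open>0\<close> because of the factor \<open>exp w\<close>.
\<close>

lemma keyhole_integral_holomorphic: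
  assumes f: "f holomorphic_on U" and U: "open U" "0 \<in> U" "inner_region \<subseteq> U" "cball 0 (exp l) \<subseteq> U"
    and l: "l \<le> u0"
  shows "keyhole_integral l (\<lambda>w. exp w * f (exp w)) = 0"
proof -
  define W where "W = {w. exp w \<in> U}"
  define H where "H = (\<lambda>w. exp w * f (exp w))"
  define H' where "H' = (\<lambda>w. exp w * f (exp w) + exp w * (exp w * deriv f (exp w)))"
  have fc: "continuous_on U f" using f by (rule holomorphic_on_imp_continuous_on)
  have dfc: "continuous_on U (deriv f)"
    using f U(1) by (intro holomorphic_on_imp_continuous_on holomorphic_deriv)
  have Hd: "(H has_derivative (\<lambda>h. h *\<^sub>C H' w)) (at w within W)" if "w \<in> W" for w
  proof -
    have fd: "(f has_field_derivative deriv f (exp w)) (at (exp w))"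
      using f U(1) that by (simp add: W_def holomorphic_derivI)
    have "((\<lambda>w. f (exp w)) has_field_derivative deriv f (exp w) * exp w) (at w)"
      by (rule DERIV_chain2[OF fd DERIV_exp])
    then have "(H has_field_derivative H' w) (at w within W)"
      unfolding H_def H'_def by (auto intro!: derivative_eq_intros simp: has_field_derivative_at_within algebra_simps)
    then show ?thesis by (simp add: has_field_derivative_def scaleC_complex_def mult.commute[of _ "H' w"])
  qed
  have H'c: "continuous_on W H'"
    unfolding H'_def by (intro continuous_intros continuous_on_compose2[OF fc] continuous_on_compose2[OF dfc])
      (auto simp: W_def)
  have mem: "w + of_real s \<in> W" if "s \<in> {..0}" "w \<in> keyhole l" for s w
    using exp_keyhole_shift_in[OF that(2) _ U(3,4)] that by (simp add: W_def)
  have const: "keyhole_integral l (\<lambda>w. H (w + of_real s)) = keyhole_integral l (\<lambda>w. H (w + of_real 0))"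
    if "s \<le> 0" for s
    by (rule keyhole_integral_translate[OF Hd H'c l mem, where U = "{..0}"])
       (use that in \<open>auto simp: H_def simp del: of_real_minus of_real_diff simp: exp_log_polar_periodic\<close>)
  obtain M where M: "\<And>w. w \<in> keyhole l \<Longrightarrow> \<bar>Re w\<bar> \<le> M" using keyhole_Re_bounded by blast
  obtain d where d: "d > 0" "\<And>v. v \<in> U \<Longrightarrow> dist v 0 < d \<Longrightarrow> dist (f v) (f 0) < 1"
    using fc U(2) unfolding continuous_on_iff by (metis zero_less_one)
  have small: "norm (keyhole_integral l (\<lambda>w. H (w + of_real 0))) \<le> e" if e: "e > 0" for e
  proof -
    define q where "q = (cmod (f 0) + 1) * (keyhole_length l)"
    have len: "0 \<le> keyhole_length l"
      using \<beta> l L1_nonneg by (auto simp: keyhole_length_def)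
    have q: "0 \<le> q" using len by (simp add: q_def)
    define r where "r = min (d / 2) (e / (q + 1))"
    have r: "0 < r" using d e q by (simp add: r_def)
    define s where "s = min 0 (ln r - M)"
    have s: "s \<le> 0" "exp (s + M) \<le> r"
    proof -
      show "s \<le> 0" by (simp add: s_def)
      have "s + M \<le> ln r" by (simp add: s_def)
      then show "exp (s + M) \<le> r" using r by (metis exp_le_cancel_iff exp_ln)
    qed
    have "norm (keyhole_integral l (\<lambda>w. H (w + of_real s))) \<le> (r * (cmod (f 0) + 1)) * keyhole_length l"
    proof (rule keyhole_integral_bound[OF l])
      show "continuous_on (keyhole l) (\<lambda>w. H (w + of_real s))"
        unfolding H_def by (intro continuous_intros continuous_on_compose2[OF fc])
          (use exp_keyhole_shift_in[OF _ s(1) U(3,4)] in auto)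
      fix w assume w: "w \<in> keyhole l"
      have 1: "cmod (exp (w + of_real s)) \<le> r"
      proof -
        have "cmod (exp (w + of_real s)) = exp (Re w + s)" by (simp add: norm_exp_eq_Re)
        also have "\<dots> \<le> exp (s + M)" using M[OF w] by simp
        finally show ?thesis using s(2) by (rule order_trans)
      qed
      have "cmod (f (exp (w + of_real s))) \<le> cmod (f 0) + 1"
      proof -
        have "dist (f (exp (w + of_real s))) (f 0) < 1"
          by (rule d(2)) (use 1 r d exp_keyhole_shift_in[OF w s(1) U(3,4)] in \<open>auto simp: r_def\<close>)
        then show ?thesis using norm_triangle_sub[of "f (exp (w + of_real s))" "f 0"] by (simp add: dist_norm)
      qed
      then show "norm (H (w + of_real s)) \<le> r * (cmod (f 0) + 1)"
        unfolding H_def norm_mult using 1 r by (intro mult_mono) auto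
    qed
    also have "\<dots> = r * q" by (simp add: q_def)
    also have "\<dots> \<le> e / (q + 1) * (q + 1)" using q r by (intro mult_mono) (auto simp: r_def)
    also have "\<dots> = e" using q by simp
    finally show ?thesis using const[OF s(1)] by simp
  qed
  have "norm (keyhole_integral l (\<lambda>w. H (w + of_real 0))) \<le> 0"
    by (rule field_le_epsilon) (use small in simp)
  then show ?thesis by (simp add: H_def)
qed

end

section \<open>Resolvents along the contour\<close>

text \<open>
  \<open>good\<close> stands for a set of points at which \<open>\<mu> R(\<mu>)\<close> is bounded by \<open>C\<close>; it contains everything outside
  the domain enclosed by the contour, so that the contour can be inflated without leaving it.
\<close>

locale keyhole_resolvent = keyhole_contour +
  fixes B :: "'a::complex_banach \<Rightarrow>\<^sub>L 'a" and R :: "complex \<Rightarrow> 'a \<Rightarrow>\<^sub>L 'a" and C :: real and good :: "complex set"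
  assumes B: "B \<in> cbounded_ops"
    and R: "\<And>\<mu>. \<mu> \<in> good \<Longrightarrow> is_op_inverse (scalar_op \<mu> - B) (R \<mu>)"
    and R_bound: "\<And>\<mu>. \<mu> \<in> good \<Longrightarrow> cmod \<mu> * norm (R \<mu>) \<le> C"
    and good_nonzero: "0 \<notin> good"
    and good_sector: "\<And>u \<theta>. \<theta> \<in> {\<beta>..2*pi-\<beta>} \<Longrightarrow> exp (log_polar u \<theta>) \<in> good"
    and good_outside: "\<And>u \<theta>. \<bar>\<theta>\<bar> \<le> \<beta> \<Longrightarrow> \<eta> \<theta> \<le> u \<Longrightarrow> exp (log_polar u \<theta>) \<in> good"
begin

lemma C_nonneg: "0 \<le> C"
proof -
  have "exp (log_polar 0 \<beta>) \<in> good" using \<beta> by (intro good_sector) auto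
  from R_bound[OF this] show ?thesis
    by (meson mult_nonneg_nonneg norm_ge_zero order_trans)
qed

lemma R_scaleC: "\<mu> \<in> good \<Longrightarrow> (R \<mu>) (z *\<^sub>C x) = z *\<^sub>C (R \<mu>) x"
  using R by (simp add: is_op_inverse_def cbounded_ops_scaleC)

lemma R_right: "\<mu> \<in> good \<Longrightarrow> \<mu> *\<^sub>C (R \<mu>) x - B ((R \<mu>) x) = x"
  using is_op_inverse_apply(1)[OF R, of \<mu> x] by (simp add: blinfun.diff_left)

lemma norm_R: "\<mu> \<in> good \<Longrightarrow> norm (R \<mu>) \<le> C / cmod \<mu>"
  using R_bound[of \<mu>] good_nonzero by (cases "\<mu> = 0") (auto simp: field_simps)

lemma norm_resolvent_diff:
  assumes "\<mu> \<in> good" "\<nu> \<in> good"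
  shows "norm (R \<nu> - R \<mu>) \<le> cmod (\<mu> - \<nu>) * (C / cmod \<nu>) * (C / cmod \<mu>)"
proof -
  have "norm (R \<nu> - R \<mu>) \<le> cmod (\<mu> - \<nu>) * norm (R \<nu>) * norm (R \<mu>)"
    by (rule norm_resolvent_diff_le[OF R[OF assms(1)] R[OF assms(2)]])
  also have "\<dots> \<le> cmod (\<mu> - \<nu>) * (C / cmod \<nu>) * (C / cmod \<mu>)"
    by (intro mult_left_mono mult_mono norm_R assms) (auto intro!: mult_nonneg_nonneg divide_nonneg_nonneg C_nonneg)
  finally show ?thesis .
qed

lemma resolvent_tendsto:
  assumes "\<mu> \<in> good"
  shows "((\<lambda>\<nu>. norm (R \<nu> - R \<mu>)) \<longlongrightarrow> 0) (at \<mu> within good)"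
proof (rule Lim_null_comparison)
  have \<mu>: "\<mu> \<noteq> 0" using assms good_nonzero by auto
  show "\<forall>\<^sub>F \<nu> in at \<mu> within good. norm (norm (R \<nu> - R \<mu>)) \<le> cmod (\<mu> - \<nu>) * (C / cmod \<nu>) * (C / cmod \<mu>)"
    using norm_resolvent_diff[OF assms] by (auto simp: eventually_at_filter)
  have "((\<lambda>\<nu>. cmod (\<mu> - \<nu>) * (C / cmod \<nu>) * (C / cmod \<mu>)) \<longlongrightarrow> cmod (\<mu> - \<mu>) * (C / cmod \<mu>) * (C / cmod \<mu>)) (at \<mu> within good)"
    by (intro tendsto_intros) (use \<mu> in auto)
  then show "((\<lambda>\<nu>. cmod (\<mu> - \<nu>) * (C / cmod \<nu>) * (C / cmod \<mu>)) \<longlongrightarrow> 0) (at \<mu> within good)"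
    by simp
qed

lemma resolvent_continuous: "continuous_on good R"
  unfolding continuous_on_def using resolvent_tendsto by (auto intro: LIM_zero_cancel tendsto_norm_zero_cancel)

lemma resolvent_derivative:
  assumes "\<mu> \<in> good"
  shows "((\<lambda>\<nu>. (R \<nu>) x) has_derivative
      (\<lambda>h. h *\<^sub>C (- (R \<mu>) ((R \<mu>) x)))) (at \<mu> within good)"
proof (rule has_derivativeI_sandwich[where e = 1])
  define y where "y = (R \<mu>) x"
  show "bounded_linear (\<lambda>h. h *\<^sub>C (- (R \<mu>) ((R \<mu>) x)))"
    by (rule bounded_bilinear.bounded_linear_left[OF bounded_bilinear_scaleC])
  show "((\<lambda>\<nu>. norm (R \<nu> - R \<mu>) * norm y) \<longlongrightarrow> 0) (at \<mu> within good)"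
    using tendsto_mult_left_zero[OF resolvent_tendsto[OF assms]] by simp
  fix \<nu> assume \<nu>: "\<nu> \<in> good" "\<nu> \<noteq> \<mu>"
  have "(R \<nu>) x - (R \<mu>) x - (\<nu> - \<mu>) *\<^sub>C (- (R \<mu>) ((R \<mu>) x))
      = (\<mu> - \<nu>) *\<^sub>C (R \<nu> - R \<mu>) y"
    unfolding resolvent_identity[OF R[OF assms] R[OF \<nu>(1)]]
    by (simp add: y_def blinfun.diff_left scaleC_diff_right scaleC_diff_left scaleC_minus_right)
  then have "norm ((R \<nu>) x - (R \<mu>) x - (\<nu> - \<mu>) *\<^sub>C (- (R \<mu>) ((R \<mu>) x)))
      = cmod (\<mu> - \<nu>) * norm ((R \<nu> - R \<mu>) y)"
    by (simp add: norm_scaleC)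
  also have "\<dots> \<le> cmod (\<mu> - \<nu>) * (norm (R \<nu> - R \<mu>) * norm y)"
    by (intro mult_left_mono norm_blinfun) auto
  finally show "norm ((R \<nu>) x - (R \<mu>) x - (\<nu> - \<mu>) *\<^sub>C (- (R \<mu>) ((R \<mu>) x))) / norm (\<nu> - \<mu>)
      \<le> norm (R \<nu> - R \<mu>) * norm y"
    using \<nu>(2) by (simp add: field_simps norm_minus_commute)
qed auto

text \<open>
  The integrand \<open>\<mu> R(\<mu>) x\<close> in the coordinate \<open>w = log \<mu>\<close>. The factor \<open>\<mu>\<close> turns \<open>d\<mu>\<close> into \<open>dw\<close>.
\<close>

definition V :: "'a \<Rightarrow> complex \<Rightarrow> 'a" where
  "V x w = exp w *\<^sub>C (R (exp w)) x"

abbreviation cauchy_integral :: "real \<Rightarrow> (complex \<Rightarrow> complex) \<Rightarrow> 'a \<Rightarrow> 'a" where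
  "cauchy_integral l f x \<equiv> keyhole_integral l (\<lambda>w. f (exp w) *\<^sub>C V x w)"

definition log_good :: "complex set" where "log_good = {w. exp w \<in> good}"

lemma V_bound: "w \<in> log_good \<Longrightarrow> norm (V x w) \<le> C * norm x"
proof -
  assume w: "w \<in> log_good"
  have "norm (V x w) \<le> cmod (exp w) * (norm (R (exp w)) * norm x)"
    unfolding V_def norm_scaleC by (intro mult_left_mono norm_blinfun) auto
  also have "\<dots> \<le> C * norm x"
    unfolding mult.assoc[symmetric] by (intro mult_right_mono R_bound) (use w in \<open>auto simp: log_good_def\<close>)
  finally show ?thesis .
qed

lemma V_derivative:
  assumes "w \<in> log_good"
  shows "(V x has_derivative
     (\<lambda>h. h *\<^sub>C (V x w - exp w *\<^sub>C exp w *\<^sub>C (R (exp w)) ((R (exp w)) x))))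
     (at w within log_good)"
proof -
  define y where "y = (R (exp w)) ((R (exp w)) x)"
  have e: "(exp has_derivative (\<lambda>h. h * exp w)) (at w within log_good)"
    using DERIV_subset[OF DERIV_exp[of w], of log_good] unfolding has_field_derivative_def
    by (rule has_derivative_eq_rhs) (auto simp: fun_eq_iff mult.commute)
  have r: "((\<lambda>\<nu>. (R \<nu>) x) has_derivative (\<lambda>h. h *\<^sub>C (- y))) (at (exp w) within exp ` log_good)"
    unfolding y_def by (rule has_derivative_subset[OF resolvent_derivative])
      (use assms in \<open>auto simp: log_good_def\<close>)
  have "((\<lambda>w. (R (exp w)) x) has_derivative (\<lambda>h. (h * exp w) *\<^sub>C (- y))) (at w within log_good)"
    using diff_chain_within[OF e r] by (simp add: o_def)
  from bounded_bilinear.FDERIV[OF bounded_bilinear_scaleC e this]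
  show ?thesis
    unfolding V_def[abs_def] y_def[symmetric]
    by (rule has_derivative_eq_rhs)
       (simp add: fun_eq_iff scaleC_diff_right scaleC_scaleC scaleC_minus_right mult_ac)
qed

lemma V_continuous: "continuous_on log_good (V x)"
  using V_derivative has_derivative_continuous continuous_on_eq_continuous_within by blast

lemma V_derivative_continuous:
  "continuous_on log_good
     (\<lambda>w. V x w - exp w *\<^sub>C exp w *\<^sub>C (R (exp w)) ((R (exp w)) x))"
  by (intro continuous_intros V_continuous continuous_on_compose2[OF resolvent_continuous])
     (auto simp: log_good_def)

lemma log_good_sector: "\<theta> \<in> {\<beta>..2*pi-\<beta>} \<Longrightarrow> log_polar u \<theta> \<in> log_good"
  unfolding log_good_def using good_sector by blast

lemma log_good_lower_ray: "log_polar u (-\<beta>) \<in> log_good"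
  using good_sector[of "2*pi-\<beta>" u] \<beta> exp_log_polar_periodic[of u \<beta>] by (simp add: log_good_def)

lemma keyhole_shift_log_good:
  assumes "w \<in> keyhole l" "0 \<le> s"
  shows "w + of_real s \<in> log_good"
proof -
  from assms(1) consider t where "t \<in> {-\<beta>..\<beta>}" "w = log_polar (\<eta> t) t"
    | t where "t \<in> {l..u0}" "w = log_polar t \<beta>" | t where "t \<in> {\<beta>..2*pi-\<beta>}" "w = log_polar l t"
    | t where "t \<in> {l..u0}" "w = log_polar t (-\<beta>)"
    unfolding keyhole_def outer_def by blast
  then show ?thesis
  proof cases
    case 1
    have "exp (log_polar (\<eta> t + s) t) \<in> good" by (rule good_outside) (use 1 assms in auto)
    then show ?thesis unfolding 1(2) log_polar_shift by (simp add: log_good_def)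
  next
    case 2 then show ?thesis unfolding 2(2) log_polar_shift using \<beta> by (intro log_good_sector) auto
  next
    case 3 then show ?thesis unfolding 3(2) log_polar_shift by (intro log_good_sector)
  next
    case 4 then show ?thesis unfolding 4(2) log_polar_shift by (intro log_good_lower_ray)
  qed
qed

lemmas keyhole_log_good = keyhole_shift_log_good[where s = 0, simplified]

lemma V_continuous_keyhole: "continuous_on (keyhole l) (V x)"
  using continuous_on_subset[OF V_continuous] keyhole_log_good by blast

lemma V_periodic: "V x (log_polar u (2 * pi - \<beta>)) = V x (log_polar u (-\<beta>))"
  unfolding V_def exp_log_polar_periodic ..

text \<open>
  Inflating the contour does not change the integral, and \<open>\<mu> R(\<mu>)\<close> tends to the identity at infinity.
\<close>

lemma keyhole_integral_resolvent:
  assumes l: "l \<le> u0"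
  shows "keyhole_integral l (V x) = (2 * of_real pi * \<i>) *\<^sub>C x"
proof -
  have const: "keyhole_integral l (\<lambda>w. V x (w + of_real s)) = keyhole_integral l (\<lambda>w. V x (w + of_real 0))"
    if "0 \<le> s" for s
    by (rule keyhole_integral_translate[OF V_derivative V_derivative_continuous l, where U = "{0..}"])
       (use that keyhole_shift_log_good V_periodic in auto)
  obtain M where M: "\<And>w. w \<in> keyhole l \<Longrightarrow> \<bar>Re w\<bar> \<le> M" using keyhole_Re_bounded by blast
  define q where "q = C * norm B * norm x * exp M * keyhole_length l"
  have bound: "norm (keyhole_integral l (V x) - (2 * of_real pi * \<i>) *\<^sub>C x) \<le> exp (- s) * q"
    if s: "0 \<le> s" for s
  proof -
    have c: "continuous_on (keyhole l) (\<lambda>w. V x (w + of_real s))"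
      by (intro continuous_on_compose2[OF V_continuous] continuous_intros)
         (use keyhole_shift_log_good s in auto)
    have "norm (keyhole_integral l (\<lambda>w. V x (w + of_real s) - x))
       \<le> exp (- s) * (C * norm B * norm x * exp M) * keyhole_length l"
    proof (rule keyhole_integral_bound[OF l])
      show "continuous_on (keyhole l) (\<lambda>w. V x (w + of_real s) - x)"
        by (intro continuous_intros c)
      fix w assume w: "w \<in> keyhole l"
      define \<mu> where "\<mu> = exp (w + of_real s)"
      have g: "\<mu> \<in> good" using keyhole_shift_log_good[OF w s] by (simp add: \<mu>_def log_good_def)
      have inv: "1 / cmod \<mu> \<le> exp (- s) * exp M"
      proof -
        have "cmod \<mu> = exp (Re w + s)" unfolding \<mu>_def norm_exp_eq_Re by simp
        then have "1 / cmod \<mu> = exp (- s) * exp (- Re w)"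
          by (simp add: exp_minus exp_add field_simps)
        also have "\<dots> \<le> exp (- s) * exp M"
          using M[OF w] by (intro mult_left_mono) auto
        finally show ?thesis .
      qed
      have "V x (w + of_real s) - x = B ((R \<mu>) x)"
        using R_right[OF g, of x] by (simp add: V_def \<mu>_def algebra_simps)
      also have "norm \<dots> \<le> norm B * (norm (R \<mu>) * norm x)"
        by (intro order_trans[OF norm_blinfun] mult_left_mono norm_blinfun) auto
      also have "\<dots> \<le> norm B * ((C / cmod \<mu>) * norm x)"
        by (intro mult_left_mono mult_right_mono norm_R g) auto
      also have "norm B * ((C / cmod \<mu>) * norm x) \<le> norm B * ((C * (exp (- s) * exp M)) * norm x)"
        using mult_left_mono[OF inv C_nonneg] by (intro mult_left_mono mult_right_mono) auto
      finally show "norm (V x (w + of_real s) - x) \<le> exp (- s) * (C * norm B * norm x * exp M)"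
        by (simp add: mult_ac)
    qed
    moreover have "keyhole_integral l (\<lambda>w. V x (w + of_real s) - x)
        = keyhole_integral l (V x) - (2 * of_real pi * \<i>) *\<^sub>C x"
      using keyhole_integral_diff[OF l c continuous_on_const] const[OF s] keyhole_integral_const[OF l, of x] by simp
    ultimately show ?thesis by (simp add: q_def mult_ac)
  qed
  have "((\<lambda>s. exp (- s) * q) \<longlongrightarrow> 0) at_top"
    using tendsto_mult_left_zero[OF filterlim_compose[OF exp_at_bot filterlim_uminus_at_bot_at_top]] by simp
  then have "norm (keyhole_integral l (V x) - (2 * of_real pi * \<i>) *\<^sub>C x) \<le> 0"
    by (rule tendsto_lowerbound) (use bound in \<open>auto intro: eventually_mono[OF eventually_ge_at_top[of 0]]\<close>)
  then show ?thesis by simp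
qed

definition arc_integral :: "'a \<Rightarrow> real \<Rightarrow> 'a" where
  "arc_integral x t = curve_integral (log_polar t) (\<lambda>_. \<i>) \<beta> (2*pi-\<beta>) (V x)"

text \<open>
  Arcs of different radius are translates of each other, so the derivative in the radius is the
  difference of the end values, which lie on the two rays.
\<close>

lemma arc_integral_derivative:
  "(arc_integral x has_vector_derivative (V x (log_polar t (-\<beta>)) - V x (log_polar t \<beta>))) (at t)"
proof -
  have eq: "log_polar 0 \<theta> + of_real t = log_polar t \<theta>" for t \<theta> by simp
  have "((\<lambda>t. integral {\<beta>..2*pi-\<beta>} (\<lambda>\<theta>. \<i> *\<^sub>C V x (log_polar 0 \<theta> + of_real t))) has_vector_derivative
      (V x (log_polar 0 (2*pi-\<beta>) + of_real t) - V x (log_polar 0 \<beta> + of_real t))) (at t within UNIV)"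
  proof (rule curve_integral_translate_derivative[OF V_derivative V_derivative_continuous, where w' = "\<lambda>_. \<i>"])
    show "log_polar 0 \<theta> + of_real t \<in> log_good" if "\<theta> \<in> {\<beta>..2*pi-\<beta>}" for t \<theta>
      unfolding eq using that by (rule log_good_sector)
  qed (use \<beta> in \<open>auto intro!: derivative_eq_intros\<close>)
  then show ?thesis
    unfolding eq V_periodic arc_integral_def[abs_def] curve_integral_def by simp
qed

lemma arc_integral_bound: "norm (arc_integral x t) \<le> 2 * pi * (C * norm x)"
proof -
  have "norm (arc_integral x t) \<le> 1 * (C * norm x) * (2*pi-\<beta>-\<beta>)"
    unfolding arc_integral_def
    by (rule curve_integral_bound[OF C1_arc continuous_on_subset[OF V_continuous]])
       (use log_good_sector V_bound in auto)
  also have "\<dots> \<le> 1 * (C * norm x) * (2 * pi)"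
    using \<beta> C_nonneg by (intro mult_left_mono) auto
  finally show ?thesis by (simp add: mult_ac)
qed

end

context keyhole_resolvent
begin

text \<open>
  The uniform bound. Pairing the two rays, \<open>f\<close> is replaced on both of them by its value at the point
  of the positive half-line with the same modulus. What remains is \<open>f (exp t)\<close> times the difference of
  the two ray values of \<open>V\<close>, which is the derivative of the bounded arc integral; integration by parts
  moves the derivative to \<open>f\<close>. Thus \<open>f\<close> enters only through its size and through the variation
  recorded by \<open>m\<close>; the radius of the small arc does not enter at all.
\<close>

lemma keyhole_integral_estimate:
  fixes f :: "complex \<Rightarrow> complex" and m m' :: "real \<Rightarrow> real"
  assumes l: "l \<le> u0" and U: "open U" "inner_region \<subseteq> U" "cball 0 (exp l) \<subseteq> U"
    and f: "f holomorphic_on U"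
    and K: "\<And>\<mu>. \<mu> \<in> inner_region \<union> cball 0 (exp l) \<Longrightarrow> cmod (f \<mu>) \<le> K"
    and m: "\<And>t. t \<in> {l..u0} \<Longrightarrow> (m has_real_derivative m' t) (at t within {l..u0})" and mK: "m u0 - m l \<le> K"
    and ray: "\<And>t \<theta>. t \<in> {l..u0} \<Longrightarrow> \<theta> \<in> {\<beta>, -\<beta>} \<Longrightarrow>
        cmod (f (exp (log_polar t \<theta>)) - f (of_real (exp t))) \<le> m' t"
    and axis: "\<And>t. t \<in> {l..u0} \<Longrightarrow> exp t * cmod (deriv f (of_real (exp t))) \<le> m' t"
  shows "norm (cauchy_integral l f x)
       \<le> K * C * (2 * \<beta> * (L1 + 1) + 8 * pi + 2) * norm x"
proof -
  define c where "c = C * norm x"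
  have c: "0 \<le> c" using C_nonneg by (simp add: c_def)
  have fc: "continuous_on U f" using f by (rule holomorphic_on_imp_continuous_on)
  have dfc: "continuous_on U (deriv f)"
    using f U(1) by (intro holomorphic_on_imp_continuous_on holomorphic_deriv)
  have axis_in: "of_real (exp t) \<in> inner_region" if "t \<in> {l..u0}" for t
    using that by (intro axis_in_inner_region) auto
  have ray_in: "exp (log_polar t \<theta>) \<in> inner_region" if "t \<in> {l..u0}" "\<theta> \<in> {\<beta>, -\<beta>}" for t \<theta>
    using that by (intro ray_in_inner_region) auto
  have K0: "0 \<le> K"
    using order_trans[OF norm_ge_zero K[OF UnI1[OF axis_in[of l]]]] l by simp
  have m'_nonneg: "0 \<le> m' t" if "t \<in> {l..u0}" for t
    using order_trans[OF mult_nonneg_nonneg axis[OF that]] by simp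
  define F where "F = (\<lambda>w. f (exp w) *\<^sub>C V x w)"
  have Fk: "continuous_on (keyhole l) F"
    unfolding F_def by (intro continuous_intros V_continuous_keyhole continuous_on_compose2[OF fc])
      (use exp_keyhole_in[OF _ U(2,3)] in auto)
  have Vr: "continuous_on {l..u0} (\<lambda>t. V x (log_polar t \<theta>))" if "\<theta> \<in> {\<beta>, -\<beta>}" for \<theta>
    by (rule continuous_on_compose2[OF V_continuous])
       (use that log_good_sector[of \<beta>] log_good_lower_ray \<beta> in \<open>auto intro!: continuous_intros\<close>)
  define g where "g = (\<lambda>t. f (of_real (exp t)))"
  have gc: "continuous_on {l..u0} g"
    unfolding g_def by (intro continuous_on_compose2[OF fc] continuous_intros) (use axis_in U in auto)
  define g' where "g' = (\<lambda>t. of_real (exp t) * deriv f (of_real (exp t)))"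
  have g'c: "continuous_on {l..u0} g'"
    unfolding g'_def by (intro continuous_intros continuous_on_compose2[OF dfc]) (use axis_in U in auto)
  have g_der: "(g has_vector_derivative g' t) (at t)" if t: "t \<in> {l..u0}" for t
  proof -
    have "(f has_field_derivative deriv f (of_real (exp t))) (at (of_real (exp t)))"
      using U axis_in[OF t] by (intro holomorphic_derivI[OF f U(1)]) auto
    moreover have "((\<lambda>t. complex_of_real (exp t)) has_vector_derivative of_real (exp t)) (at t)"
      by (rule has_vector_derivative_of_real[OF DERIV_exp])
    ultimately have "((f \<circ> (\<lambda>t. of_real (exp t))) has_vector_derivative
        of_real (exp t) * deriv f (of_real (exp t))) (at t)"
      by (intro field_vector_diff_chain_at)
    then show ?thesis by (simp add: g_def g'_def o_def)
  qed
  define A where "A = arc_integral x"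
  have Ab: "norm (A t) \<le> 2 * pi * c" for t
    unfolding A_def c_def by (rule arc_integral_bound)
  have Ad: "(A has_vector_derivative (V x (log_polar t (-\<beta>)) - V x (log_polar t \<beta>))) (at t)" for t
    unfolding A_def by (rule arc_integral_derivative)
  have Ac: "continuous_on {l..u0} A"
    using has_vector_derivative_continuous[OF Ad] continuous_at_imp_continuous_on by blast
  have m_int: "(m' has_integral (m u0 - m l)) {l..u0}"
    using m by (intro fundamental_theorem_of_calculus[OF l]) (simp add: has_real_derivative_iff_has_vector_derivative)
  have m_bound: "norm (integral {l..u0} h) \<le> K * q"
    if "continuous_on {l..u0} h" "\<And>t. t \<in> {l..u0} \<Longrightarrow> norm (h t) \<le> m' t * q" "0 \<le> q" for h :: "real \<Rightarrow> 'a" and q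
  proof -
    have "norm (integral {l..u0} h) \<le> integral {l..u0} (\<lambda>t. m' t * q)"
      by (intro integral_norm_bound_integral integrable_continuous_real that
          has_integral_integrable[OF has_integral_mult_left[OF m_int]])
    also have "\<dots> = (m u0 - m l) * q" using has_integral_mult_left[OF m_int] by (rule integral_unique)
    also have "\<dots> \<le> K * q" using mK that(3) by (rule mult_right_mono)
    finally show ?thesis .
  qed
  have P1: "norm (curve_integral outer outer' (-\<beta>) \<beta> F) \<le> (L1 + 1) * (K * c) * (\<beta> - - \<beta>)"
  proof (rule curve_integral_bound[OF C1_outer keyhole_continuous(1)[OF Fk] _ norm_outer'])
    fix t assume t: "t \<in> {-\<beta>..\<beta>}"
    have "exp (outer t) \<in> inner_region" unfolding outer_def inner_region_def using t
      by (intro CollectI exI[of _ "\<eta> t"] exI[of _ t]) auto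
    then show "norm (F (outer t)) \<le> K * c"
      unfolding F_def norm_scaleC c_def
      using keyhole_log_good[OF outer_in_keyhole[OF t]] K K0 by (intro mult_mono V_bound) auto
  qed
  have P3: "norm (curve_integral (log_polar l) (\<lambda>_. \<i>) \<beta> (2*pi-\<beta>) F) \<le> 1 * (K * c) * (2*pi-\<beta> - \<beta>)"
  proof (rule curve_integral_bound[OF C1_arc keyhole_continuous(4)[OF Fk]])
    fix t assume t: "t \<in> {\<beta>..2*pi-\<beta>}"
    have "exp (log_polar l t) \<in> cball 0 (exp l)" using norm_exp_log_polar[of l t] by (simp del: exp_add)
    then show "norm (F (log_polar l t)) \<le> K * c"
      unfolding F_def norm_scaleC c_def
      using log_good_sector[OF t] K K0 by (intro mult_mono V_bound) auto
  qed auto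
  define \<Delta> where "\<Delta> = (\<lambda>\<theta> t. (f (exp (log_polar t \<theta>)) - g t) *\<^sub>C V x (log_polar t \<theta>))"
  have \<Delta>c: "continuous_on {l..u0} (\<Delta> \<theta>)" if "\<theta> \<in> {\<beta>, -\<beta>}" for \<theta>
    unfolding \<Delta>_def
    by (intro continuous_intros Vr that gc continuous_on_compose2[OF fc]) (use ray_in[OF _ that] U in auto)
  have P\<Delta>: "norm (integral {l..u0} (\<Delta> \<theta>)) \<le> K * c" if \<theta>: "\<theta> \<in> {\<beta>, -\<beta>}" for \<theta>
  proof (rule m_bound[OF \<Delta>c[OF \<theta>] _ c])
    fix t assume t: "t \<in> {l..u0}"
    have "log_polar t \<theta> \<in> log_good"
      using \<theta> \<beta> log_good_sector[of \<beta> t] log_good_lower_ray[of t] by auto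
    then show "norm (\<Delta> \<theta> t) \<le> m' t * c"
      unfolding \<Delta>_def norm_scaleC c_def g_def using ray[OF t \<theta>] m'_nonneg[OF t]
      by (intro mult_mono V_bound) auto
  qed
  have parts: "((\<lambda>t. g t *\<^sub>C (V x (log_polar t (-\<beta>)) - V x (log_polar t \<beta>)) + g' t *\<^sub>C A t) has_integral
      (g u0 *\<^sub>C A u0 - g l *\<^sub>C A l)) {l..u0}"
    by (rule fundamental_theorem_of_calculus[OF l])
       (rule bounded_bilinear.has_vector_derivative[OF bounded_bilinear_scaleC
         has_vector_derivative_at_within[OF g_der] has_vector_derivative_at_within[OF Ad]])
  have g'A: "(\<lambda>t. g' t *\<^sub>C A t) integrable_on {l..u0}"
    by (intro integrable_continuous_real continuous_intros g'c Ac)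
  have jump_c: "continuous_on {l..u0} (\<lambda>t. g t *\<^sub>C (V x (log_polar t (-\<beta>)) - V x (log_polar t \<beta>)))"
    by (intro continuous_intros gc Vr) auto
  have Pg': "norm (integral {l..u0} (\<lambda>t. g' t *\<^sub>C A t)) \<le> K * (2 * pi * c)"
  proof (rule m_bound)
    fix t assume t: "t \<in> {l..u0}"
    have "cmod (g' t) \<le> m' t" using axis[OF t] by (simp add: g'_def norm_mult)
    then show "norm (g' t *\<^sub>C A t) \<le> m' t * (2 * pi * c)"
      unfolding norm_scaleC using m'_nonneg[OF t] by (intro mult_mono Ab) auto
  qed (use c in \<open>auto intro!: continuous_intros g'c Ac\<close>)
  have jump: "integral {l..u0} (\<lambda>t. g t *\<^sub>C (V x (log_polar t (-\<beta>)) - V x (log_polar t \<beta>)))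
      = g u0 *\<^sub>C A u0 - g l *\<^sub>C A l - integral {l..u0} (\<lambda>t. g' t *\<^sub>C A t)"
    using integral_unique[OF parts] integral_add[OF integrable_continuous_real[OF jump_c] g'A] by (simp add: algebra_simps)
  have gK: "cmod (g t) \<le> K" if "t \<in> {l..u0}" for t
    unfolding g_def using K axis_in[OF that] by auto
  have gA: "norm (g t *\<^sub>C A t) \<le> K * (2 * pi * c)" if "t \<in> {l..u0}" for t
    unfolding norm_scaleC by (intro mult_mono gK Ab that K0) auto
  have P_jump: "norm (integral {l..u0} (\<lambda>t. g t *\<^sub>C (V x (log_polar t (-\<beta>)) - V x (log_polar t \<beta>))))
      \<le> 3 * (K * (2 * pi * c))"
  proof -
    have tri: "norm (a - b - d) \<le> norm a + norm b + norm d" for a b d :: 'a by norm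
    show ?thesis unfolding jump
      by (rule order_trans[OF tri]) (use gA[of u0] gA[of l] Pg' l in auto)
  qed
  have rays: "curve_integral (\<lambda>t. log_polar t (-\<beta>)) (\<lambda>_. 1) l u0 F - curve_integral (\<lambda>t. log_polar t \<beta>) (\<lambda>_. 1) l u0 F
      = integral {l..u0} (\<Delta> (-\<beta>)) - integral {l..u0} (\<Delta> \<beta>)
        + integral {l..u0} (\<lambda>t. g t *\<^sub>C (V x (log_polar t (-\<beta>)) - V x (log_polar t \<beta>)))"
  proof -
    have int: "\<Delta> \<theta> integrable_on {l..u0}" "(\<lambda>t. g t *\<^sub>C V x (log_polar t \<theta>)) integrable_on {l..u0}"
      if "\<theta> \<in> {\<beta>, -\<beta>}" for \<theta>
      by (intro integrable_continuous_real continuous_intros \<Delta>c gc Vr that)+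
    have ray_eq: "curve_integral (\<lambda>t. log_polar t \<theta>) (\<lambda>_. 1) l u0 F
        = integral {l..u0} (\<Delta> \<theta>) + integral {l..u0} (\<lambda>t. g t *\<^sub>C V x (log_polar t \<theta>))"
      if "\<theta> \<in> {\<beta>, -\<beta>}" for \<theta>
    proof -
      have "curve_integral (\<lambda>t. log_polar t \<theta>) (\<lambda>_. 1) l u0 F
          = integral {l..u0} (\<lambda>t. \<Delta> \<theta> t + g t *\<^sub>C V x (log_polar t \<theta>))"
        unfolding curve_integral_def F_def \<Delta>_def by (simp add: scaleC_diff_left)
      then show ?thesis by (simp only: integral_add[OF int[OF that]])
    qed
    have "integral {l..u0} (\<lambda>t. g t *\<^sub>C (V x (log_polar t (-\<beta>)) - V x (log_polar t \<beta>)))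
      = integral {l..u0} (\<lambda>t. g t *\<^sub>C V x (log_polar t (-\<beta>))) - integral {l..u0} (\<lambda>t. g t *\<^sub>C V x (log_polar t \<beta>))"
      using integral_diff[OF int(2)[of "-\<beta>"] int(2)[of \<beta>]] by (simp add: scaleC_diff_right)
    then show ?thesis using ray_eq[of \<beta>] ray_eq[of "-\<beta>"] by simp
  qed
  have tri: "norm (a + b + (d - e + h)) \<le> norm a + norm b + norm d + norm e + norm h" for a b d e h :: 'a
    by norm
  have "keyhole_integral l F = curve_integral outer outer' (-\<beta>) \<beta> F
      + curve_integral (log_polar l) (\<lambda>_. \<i>) \<beta> (2*pi-\<beta>) F
      + (integral {l..u0} (\<Delta> (-\<beta>)) - integral {l..u0} (\<Delta> \<beta>)
        + integral {l..u0} (\<lambda>t. g t *\<^sub>C (V x (log_polar t (-\<beta>)) - V x (log_polar t \<beta>))))"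
    unfolding keyhole_integral_def rays[symmetric] by simp
  also have "norm \<dots> \<le> (L1 + 1) * (K * c) * (\<beta> - - \<beta>) + 1 * (K * c) * (2*pi-\<beta> - \<beta>)
      + K * c + K * c + 3 * (K * (2 * pi * c))"
    by (rule order_trans[OF tri]) (intro add_mono P1 P3 P\<Delta> P_jump; simp)
  also have "\<dots> = K * c * (2 * \<beta> * (L1 + 1) + 8 * pi + 2) - 2 * \<beta> * (K * c)"
    by (simp add: algebra_simps)
  also have "\<dots> \<le> K * c * (2 * \<beta> * (L1 + 1) + 8 * pi + 2)"
    using \<beta> K0 c by simp
  finally show ?thesis by (simp add: F_def c_def mult_ac)
qed

end

section \<open>Convex combinations of powers\<close>

definition op_poly :: "(nat \<Rightarrow> real) \<Rightarrow> nat \<Rightarrow> ('a::complex_banach \<Rightarrow>\<^sub>L 'a) \<Rightarrow> 'a \<Rightarrow>\<^sub>L 'a" where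
  "op_poly d N T = (\<Sum>n\<le>N. d n *\<^sub>R op_power T n)"

definition cpoly :: "(nat \<Rightarrow> real) \<Rightarrow> nat \<Rightarrow> complex \<Rightarrow> complex" where
  "cpoly d N z = (\<Sum>n\<le>N. of_real (d n) * z ^ n)"

definition rpoly :: "(nat \<Rightarrow> real) \<Rightarrow> nat \<Rightarrow> real \<Rightarrow> real" where
  "rpoly d N r = (\<Sum>n\<le>N. d n * r ^ n)"

definition rpoly_deriv :: "(nat \<Rightarrow> real) \<Rightarrow> nat \<Rightarrow> real \<Rightarrow> real" where
  "rpoly_deriv d N r = (\<Sum>n\<le>N. d n * (real n * r ^ (n - 1)))"

definition cpoly_deriv :: "(nat \<Rightarrow> real) \<Rightarrow> nat \<Rightarrow> complex \<Rightarrow> complex" where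
  "cpoly_deriv d N z = (\<Sum>n\<le>N. of_real (d n) * (of_nat n * z ^ (n - 1)))"

definition convex_weights :: "(nat \<Rightarrow> real) \<Rightarrow> nat \<Rightarrow> bool" where
  "convex_weights d N \<longleftrightarrow> (\<forall>n. 0 \<le> d n) \<and> (\<Sum>n\<le>N. d n) = 1"

lemma op_poly_apply:
  fixes T :: "'a::complex_banach \<Rightarrow>\<^sub>L 'a"
  shows
  "(op_poly d N T) x = (\<Sum>n\<le>N. d n *\<^sub>R (op_power T n) x)"
  by (simp add: op_poly_def blinfun.sum_left blinfun.scaleR_left)

lemma op_poly_in_cbounded_ops: "T \<in> cbounded_ops \<Longrightarrow> op_poly d N T \<in> cbounded_ops"
  using op_power_in_cbounded_ops[of T]
  by (simp add: cbounded_ops_def op_poly_apply scaleC_sum_right scaleC_scaleR)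

lemma cpoly_has_derivative: "(cpoly d N has_field_derivative cpoly_deriv d N z) (at z)"
  unfolding cpoly_def[abs_def] cpoly_deriv_def by (auto intro!: derivative_eq_intros sum.cong)

lemma rpoly_has_derivative: "(rpoly d N has_real_derivative rpoly_deriv d N r) (at r)"
  unfolding rpoly_def[abs_def] rpoly_deriv_def by (auto intro!: derivative_eq_intros sum.cong)

lemma holomorphic_on_cpoly: "cpoly d N holomorphic_on S"
  using cpoly_has_derivative by (meson field_differentiable_at_within field_differentiable_def holomorphic_on_def)

lemma cpoly_one: "convex_weights d N \<Longrightarrow> cpoly d N 1 = 1"
  by (simp add: cpoly_def convex_weights_def flip: of_real_sum)

lemma norm_power_diff_le:
  fixes a b :: complex
  assumes "cmod a \<le> q" "cmod b \<le> q"
  shows "cmod (a ^ n - b ^ n) \<le> cmod (a - b) * (real n * q ^ (n - 1))"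
proof (induction n)
  case (Suc n)
  have q: "0 \<le> q" using assms(1) norm_ge_zero order_trans by blast
  have "a ^ Suc n - b ^ Suc n = a * (a ^ n - b ^ n) + (a - b) * b ^ n"
    by (simp add: algebra_simps)
  also have "cmod \<dots> \<le> cmod a * cmod (a ^ n - b ^ n) + cmod (a - b) * cmod b ^ n"
    using norm_triangle_ineq by (metis norm_mult norm_power)
  also have "\<dots> \<le> q * (cmod (a - b) * (real n * q ^ (n - 1))) + cmod (a - b) * q ^ n"
    using assms q Suc by (intro add_mono mult_mono power_mono) auto
  also have "\<dots> = cmod (a - b) * (real (Suc n) * q ^ n)"
    by (cases n) (simp_all add: algebra_simps)
  finally show ?case by simp
qed simp

lemma norm_cpoly_diff_le:
  assumes d: "convex_weights d N" and "cmod a \<le> q" "cmod b \<le> q"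
  shows "cmod (cpoly d N a - cpoly d N b) \<le> cmod (a - b) * rpoly_deriv d N q"
proof -
  have "cmod (cpoly d N a - cpoly d N b) = cmod (\<Sum>n\<le>N. of_real (d n) * (a ^ n - b ^ n))"
    by (simp add: cpoly_def sum_subtractf algebra_simps)
  also have "\<dots> \<le> (\<Sum>n\<le>N. d n * (cmod (a - b) * (real n * q ^ (n - 1))))"
    using d norm_power_diff_le[OF assms(2,3)]
    by (intro sum_norm_le) (auto simp: norm_mult convex_weights_def intro!: mult_left_mono)
  also have "\<dots> = cmod (a - b) * rpoly_deriv d N q"
    by (simp add: rpoly_deriv_def sum_distrib_left mult_ac)
  finally show ?thesis .
qed

lemma norm_cpoly_deriv_le:
  assumes d: "convex_weights d N" and "cmod a \<le> q"
  shows "cmod (cpoly_deriv d N a) \<le> rpoly_deriv d N q"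
  unfolding cpoly_deriv_def rpoly_deriv_def
  using assms by (intro sum_norm_le)
    (auto simp: norm_mult norm_power convex_weights_def intro!: mult_left_mono power_mono)

lemma norm_cpoly_le:
  assumes d: "convex_weights d N" and "cmod a \<le> q"
  shows "cmod (cpoly d N a) \<le> rpoly d N q"
  unfolding cpoly_def rpoly_def
  using assms by (intro sum_norm_le)
    (auto simp: norm_mult norm_power convex_weights_def intro!: mult_left_mono power_mono)

lemma rpoly_le_one:
  assumes d: "convex_weights d N" and "0 \<le> q" "q \<le> 1"
  shows "rpoly d N q \<le> 1"
proof -
  have "rpoly d N q \<le> (\<Sum>n\<le>N. d n * 1)"
    unfolding rpoly_def using assms by (intro sum_mono mult_left_mono power_le_one) (auto simp: convex_weights_def)
  then show ?thesis using d by (simp add: convex_weights_def)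
qed

lemma one_minus_cpoly:
  "convex_weights d N \<Longrightarrow> 1 - cpoly d N z = (\<Sum>n\<le>N. of_real (d n) * (1 - z ^ n))"
  by (simp add: cpoly_def convex_weights_def algebra_simps sum_subtractf flip: of_real_sum)

section \<open>The functional calculus\<close>

text \<open>
  \<open>T = \<phi>(B)\<close> enters through the single identity \<open>T_resolvent\<close>: after multiplication by a holomorphic
  \<open>f\<close> and integration the term with \<open>\<psi>\<close> vanishes by Cauchy's theorem, so \<open>T\<close> acts on contour integrals
  as multiplication by \<open>\<phi>\<close>. The constant \<open>\<kappa>\<close> measures how fast \<open>\<phi>\<close> moves into the disc along the rays
  and the axis, \<open>L\<close> is a Lipschitz constant at the vertex.
\<close>

locale keyhole_calculus = keyhole_resolvent +
  fixes T :: "'a::complex_banach \<Rightarrow>\<^sub>L 'a" and Y :: "'a \<Rightarrow> 'a"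
    and \<phi> \<psi> :: "complex \<Rightarrow> complex" and U0 :: "complex set" and \<kappa> L :: real
  assumes T: "T \<in> cbounded_ops"
    and U0: "open U0" "0 \<in> U0" "inner_region \<subseteq> U0"
    and \<phi>: "\<phi> holomorphic_on U0" and \<psi>: "\<psi> holomorphic_on U0" and \<phi>_0: "\<phi> 0 = 1"
    and T_resolvent: "\<And>\<mu> x. \<mu> \<in> good \<Longrightarrow> \<mu> \<in> U0 \<Longrightarrow>
        T ((R \<mu>) x) = \<phi> \<mu> *\<^sub>C (R \<mu>) x + \<psi> \<mu> *\<^sub>C Y x"
    and T_commute: "\<And>\<mu> x. \<mu> \<in> good \<Longrightarrow>
        (R \<mu>) (T x) = T ((R \<mu>) x)"
    and \<kappa>: "0 < \<kappa>" and L: "0 \<le> L"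
    and \<phi>_inner_region: "\<And>\<mu>. \<mu> \<in> inner_region \<Longrightarrow> cmod (\<phi> \<mu>) \<le> 1"
    and \<phi>_ray: "\<And>t \<theta>. t \<le> u0 \<Longrightarrow> \<theta> \<in> {\<beta>, 0, -\<beta>} \<Longrightarrow> cmod (\<phi> (exp (log_polar t \<theta>))) \<le> 1 - \<kappa> * exp t"
    and \<phi>_diff: "\<And>t \<theta>. t \<le> u0 \<Longrightarrow> \<theta> \<in> {\<beta>, -\<beta>} \<Longrightarrow>
        cmod (\<phi> (exp (log_polar t \<theta>)) - \<phi> (of_real (exp t))) \<le> L * exp t"
    and \<phi>_deriv: "\<And>t. t \<le> u0 \<Longrightarrow> cmod (deriv \<phi> (of_real (exp t))) \<le> L"
begin

definition admissible :: "complex set \<Rightarrow> real \<Rightarrow> bool" where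
  "admissible U l \<longleftrightarrow> open U \<and> 0 \<in> U \<and> inner_region \<subseteq> U \<and> U \<subseteq> U0 \<and> cball 0 (exp l) \<subseteq> U \<and> l \<le> u0"

text \<open>
  The estimate needs a bound of \<open>f\<close> also on the small arc, which lies outside the domain. Continuity at
  the vertex provides it once the arc is small; how small may depend on \<open>f\<close>, since the radius does not enter the
  final constant.
\<close>

lemma admissible_radius:
  assumes "open U" "0 \<in> U" "inner_region \<subseteq> U" "U \<subseteq> U0" "f holomorphic_on U"
  obtains l where "admissible U l" "\<And>\<mu>. \<mu> \<in> cball 0 (exp l) \<Longrightarrow> cmod (f \<mu>) \<le> cmod (f 0) + 1"
proof -
  obtain e where e: "e > 0" "cball 0 e \<subseteq> U" using assms(1,2) open_contains_cball by blast
  have "continuous_on U f" using assms by (intro holomorphic_on_imp_continuous_on)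
  then obtain d where d: "d > 0" "\<And>v. v \<in> U \<Longrightarrow> dist v 0 < d \<Longrightarrow> dist (f v) (f 0) < 1"
    using assms(2) unfolding continuous_on_iff by (metis zero_less_one)
  define r where "r = min e (d / 2)"
  have r: "0 < r" "r \<le> e" "r < d" using e d by (auto simp: r_def)
  define l where "l = min u0 (ln r)"
  have l: "exp l \<le> r" using r(1) by (metis exp_le_cancel_iff exp_ln l_def min.cobounded2)
  show thesis
  proof
    show "admissible U l"
      unfolding admissible_def using assms e r l by (auto simp: l_def)
    fix \<mu> assume \<mu>: "\<mu> \<in> cball (0::complex) (exp l)"
    have "dist (f \<mu>) (f 0) < 1" by (rule d(2)) (use \<mu> l r e in \<open>auto simp: dist_norm\<close>)
    then show "cmod (f \<mu>) \<le> cmod (f 0) + 1"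
      using norm_triangle_sub[of "f \<mu>" "f 0"] by (simp add: dist_norm)
  qed
qed

lemma T_V:
  assumes "w \<in> log_good" "exp w \<in> U0"
  shows "T (V x w) = \<phi> (exp w) *\<^sub>C V x w + (exp w * \<psi> (exp w)) *\<^sub>C Y x"
  using assms T_resolvent[of "exp w" x]
  by (simp add: V_def log_good_def cbounded_ops_scaleC[OF T] scaleC_add_right scaleC_scaleC mult.commute)

lemma continuous_on_keyhole:
  assumes "admissible U l" "f holomorphic_on U"
  shows "continuous_on (keyhole l) (\<lambda>w. f (exp w))"
  using assms exp_keyhole_in[of _ l U] unfolding admissible_def
  by (intro continuous_on_compose2[OF holomorphic_on_imp_continuous_on[OF assms(2)]] continuous_intros) auto

lemma keyhole_integral_T:
  assumes U: "admissible U l" and f: "f holomorphic_on U"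
  shows "T (cauchy_integral l f x)
       = cauchy_integral l (\<lambda>\<mu>. \<phi> \<mu> * f \<mu>) x"
proof -
  have l: "l \<le> u0" and UU: "open U" "0 \<in> U" "inner_region \<subseteq> U" "U \<subseteq> U0" "cball 0 (exp l) \<subseteq> U"
    using U by (auto simp: admissible_def)
  have \<phi>U: "\<phi> holomorphic_on U" and \<psi>U: "\<psi> holomorphic_on U"
    using \<phi> \<psi> UU holomorphic_on_subset by blast+
  note cf = continuous_on_keyhole[OF U f] and c\<phi> = continuous_on_keyhole[OF U \<phi>U]
    and c\<psi> = continuous_on_keyhole[OF U \<psi>U]
  have c: "continuous_on (keyhole l) (\<lambda>w. exp w * (f (exp w) * \<psi> (exp w)))"
    by (intro continuous_intros cf c\<psi>)
  have "T (cauchy_integral l f x)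
     = keyhole_integral l (\<lambda>w. T (f (exp w) *\<^sub>C V x w))"
    by (rule keyhole_integral_linear[OF l, symmetric])
       (auto intro!: continuous_intros cf V_continuous_keyhole blinfun.bounded_linear_right
         simp: cbounded_ops_scaleC[OF T])
  also have "\<dots> = keyhole_integral l (\<lambda>w. (\<phi> (exp w) * f (exp w)) *\<^sub>C V x w
      + (exp w * (f (exp w) * \<psi> (exp w))) *\<^sub>C Y x)"
  proof -
    have eq: "T (f (exp w) *\<^sub>C V x w) = (\<phi> (exp w) * f (exp w)) *\<^sub>C V x w
      + (exp w * (f (exp w) * \<psi> (exp w))) *\<^sub>C Y x" if "w \<in> keyhole l" for w
      using T_V[of w x] keyhole_log_good[OF that] exp_keyhole_in[OF that UU(3,5)] UU(4)
      by (auto simp: cbounded_ops_scaleC[OF T] scaleC_add_right scaleC_scaleC mult_ac)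
    show ?thesis by (rule keyhole_integral_cong[OF eq])
  qed
  also have "\<dots> = cauchy_integral l (\<lambda>\<mu>. \<phi> \<mu> * f \<mu>) x
      + keyhole_integral l (\<lambda>w. exp w * (f (exp w) * \<psi> (exp w))) *\<^sub>C Y x"
    unfolding keyhole_integral_scaleC_left[OF l c, symmetric]
    by (rule keyhole_integral_add[OF l]) (intro continuous_intros cf c\<phi> c V_continuous_keyhole)+
  also have "keyhole_integral l (\<lambda>w. exp w * (f (exp w) * \<psi> (exp w))) = 0"
    using keyhole_integral_holomorphic[of "\<lambda>\<mu>. f \<mu> * \<psi> \<mu>" U l] f \<psi>U UU l by (simp add: holomorphic_on_mult)
  finally show ?thesis by simp
qed

lemma keyhole_integral_power:
  assumes U: "admissible U l" and f: "f holomorphic_on U"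
  shows "(op_power T n) (cauchy_integral l f x)
       = cauchy_integral l (\<lambda>\<mu>. \<phi> \<mu> ^ n * f \<mu>) x"
proof (induction n)
  case (Suc n)
  have "\<phi> holomorphic_on U" using U \<phi> holomorphic_on_subset unfolding admissible_def by blast
  then have "(\<lambda>\<mu>. \<phi> \<mu> ^ n * f \<mu>) holomorphic_on U" by (intro holomorphic_intros f)
  from keyhole_integral_T[OF U this] Suc show ?case by (simp add: mult.assoc)
qed simp

lemma keyhole_integral_op_poly:
  assumes U: "admissible U l" and f: "f holomorphic_on U"
  shows "(op_poly d N T) (cauchy_integral l f x)
       = cauchy_integral l (\<lambda>\<mu>. cpoly d N (\<phi> \<mu>) * f \<mu>) x"
proof -
  have l: "l \<le> u0" using U by (simp add: admissible_def)
  have \<phi>U: "\<phi> holomorphic_on U" using U \<phi> holomorphic_on_subset unfolding admissible_def by blast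
  note c = continuous_on_keyhole[OF U f] continuous_on_keyhole[OF U \<phi>U]
  have "(\<Sum>n\<in>A. d n *\<^sub>R cauchy_integral l (\<lambda>\<mu>. \<phi> \<mu> ^ n * f \<mu>) x)
     = cauchy_integral l (\<lambda>\<mu>. (\<Sum>n\<in>A. of_real (d n) * \<phi> \<mu> ^ n) * f \<mu>) x"
    if "finite A" for A
    using that
  proof (induction A)
    case empty
    then show ?case using keyhole_integral_const[OF l, of 0] by simp
  next
    case (insert n A)
    have "d n *\<^sub>R cauchy_integral l (\<lambda>\<mu>. \<phi> \<mu> ^ n * f \<mu>) x
        = keyhole_integral l (\<lambda>w. d n *\<^sub>R ((\<phi> (exp w) ^ n * f (exp w)) *\<^sub>C V x w))"
      by (rule keyhole_integral_linear[OF l, symmetric])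
         (auto intro!: continuous_intros c V_continuous_keyhole bounded_linear_scaleR_right simp: scaleC_scaleR)
    also have "\<dots> = cauchy_integral l (\<lambda>\<mu>. of_real (d n) * \<phi> \<mu> ^ n * f \<mu>) x"
      by (simp add: scaleR_scaleC scaleC_scaleC mult.assoc)
    finally have 1: "d n *\<^sub>R cauchy_integral l (\<lambda>\<mu>. \<phi> \<mu> ^ n * f \<mu>) x = \<dots>" .
    have 2: "keyhole_integral l (\<lambda>w. (of_real (d n) * \<phi> (exp w) ^ n * f (exp w)) *\<^sub>C V x w
         + ((\<Sum>n\<in>A. of_real (d n) * \<phi> (exp w) ^ n) * f (exp w)) *\<^sub>C V x w)
       = cauchy_integral l (\<lambda>\<mu>. of_real (d n) * \<phi> \<mu> ^ n * f \<mu>) x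
       + cauchy_integral l (\<lambda>\<mu>. (\<Sum>n\<in>A. of_real (d n) * \<phi> \<mu> ^ n) * f \<mu>) x"
      by (rule keyhole_integral_add[OF l]) (intro continuous_intros c V_continuous_keyhole)+
    show ?case using insert 1 2 by (simp add: scaleC_add_left distrib_right)
  qed
  then show ?thesis
    by (simp add: op_poly_apply keyhole_integral_power[OF U f] cpoly_def)
qed

lemma keyhole_integral_commute:
  fixes A :: "'a \<Rightarrow>\<^sub>L 'a"
  assumes U: "admissible U l" and f: "f holomorphic_on U" and A: "A \<in> cbounded_ops"
    and comm: "\<And>\<mu> x. \<mu> \<in> good \<Longrightarrow> (R \<mu>) (A x) = A ((R \<mu>) x)"
  shows "cauchy_integral l f (A x)
     = A (cauchy_integral l f x)"
proof -
  have l: "l \<le> u0" using U by (simp add: admissible_def)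
  have "cauchy_integral l f (A x)
     = keyhole_integral l (\<lambda>w. A (f (exp w) *\<^sub>C V x w))"
    by (rule keyhole_integral_cong)
       (use keyhole_log_good in \<open>auto simp: V_def log_good_def comm cbounded_ops_scaleC[OF A]\<close>)
  also have "\<dots> = A (cauchy_integral l f x)"
    by (rule keyhole_integral_linear[OF l])
       (auto intro!: continuous_intros continuous_on_keyhole[OF U f] V_continuous_keyhole blinfun.bounded_linear_right
         simp: cbounded_ops_scaleC[OF A])
  finally show ?thesis .
qed

lemma op_power_commute:
  "\<mu> \<in> good \<Longrightarrow> (R \<mu>) ((op_power T n) x) = (op_power T n) ((R \<mu>) x)"
  by (induction n arbitrary: x) (simp_all add: T_commute)

definition \<Lambda> :: real where "\<Lambda> = C * (2 * \<beta> * (L1 + 1) + 8 * pi + 2)"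

lemma \<Lambda>_nonneg: "0 \<le> \<Lambda>"
  using C_nonneg \<beta> L1_nonneg by (auto simp: \<Lambda>_def intro!: mult_nonneg_nonneg add_nonneg_nonneg)

lemma \<phi>_axis: "t \<le> u0 \<Longrightarrow> cmod (\<phi> (of_real (exp t))) \<le> 1 - \<kappa> * exp t"
  using \<phi>_ray[of t 0] by (simp add: exp_of_real)

lemma \<phi>_chain:
  assumes "t \<le> u0"
  shows "(\<phi> has_field_derivative deriv \<phi> (of_real (exp t))) (at (of_real (exp t)))"
  using U0 axis_in_inner_region[OF assms] by (intro holomorphic_derivI[OF \<phi> U0(1)]) auto

text \<open>
  The estimate for \<open>f = \<phi>\<^sup>n\<close>. On rays and axis the increments of \<open>f\<close> are at most
  \<open>L e\<^sup>t n (1 - \<kappa> e\<^sup>t)\<^sup>n\<^sup>-\<^sup>1\<close>, the derivative of \<open>- (L / \<kappa>) (1 - \<kappa> e\<^sup>t)\<^sup>n\<close>.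
\<close>

lemma power_bounded:
  "norm (op_power T n) \<le> (2 + L / \<kappa>) * \<Lambda> / (2 * pi)"
proof (rule norm_blinfun_bound)
  show "0 \<le> (2 + L / \<kappa>) * \<Lambda> / (2 * pi)" using L \<kappa> \<Lambda>_nonneg by auto
  fix x
  define f where "f = (\<lambda>\<mu>. \<phi> \<mu> ^ n)"
  have f: "f holomorphic_on U0" unfolding f_def by (intro holomorphic_intros \<phi>)
  obtain l where l: "admissible U0 l" and near: "\<And>\<mu>. \<mu> \<in> cball 0 (exp l) \<Longrightarrow> cmod (f \<mu>) \<le> cmod (f 0) + 1"
    using admissible_radius[OF U0 _ f] by blast
  have lu: "l \<le> u0" using l by (simp add: admissible_def)
  define m where "m = (\<lambda>t. - (L / \<kappa>) * (1 - \<kappa> * exp t) ^ n)"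
  define m' where "m' = (\<lambda>t. L * exp t * (real n * (1 - \<kappa> * exp t) ^ (n - 1)))"
  have q: "0 \<le> 1 - \<kappa> * exp t" if "t \<le> u0" for t using \<phi>_axis[OF that] norm_ge_zero order_trans by blast
  have "norm (cauchy_integral l f x)
      \<le> (2 + L / \<kappa>) * C * (2 * \<beta> * (L1 + 1) + 8 * pi + 2) * norm x"
  proof (rule keyhole_integral_estimate[OF lu U0(1,3) _ f, where m = m and m' = m'])
    show "cball 0 (exp l) \<subseteq> U0" using l by (simp add: admissible_def)
    show "cmod (f \<mu>) \<le> 2 + L / \<kappa>" if "\<mu> \<in> inner_region \<union> cball 0 (exp l)" for \<mu>
    proof -
      have "cmod (f \<mu>) \<le> 2"
        using that \<phi>_inner_region[of \<mu>] near[of \<mu>] by (auto simp: f_def norm_power \<phi>_0 intro: order_trans[OF power_le_one])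
      then show ?thesis using L \<kappa> by (smt (verit) divide_nonneg_pos)
    qed
    show "(m has_real_derivative m' t) (at t within {l..u0})" for t
      unfolding m_def m'_def using \<kappa> by (auto intro!: derivative_eq_intros simp: field_simps)
    have "m u0 \<le> 0" using q[of u0] L \<kappa> by (simp add: m_def)
    moreover have "- (L / \<kappa>) \<le> m l"
      unfolding m_def using q[OF lu] L \<kappa> mult_left_mono[OF power_le_one[OF q[OF lu]], of "L / \<kappa>" n] by simp
    ultimately show "m u0 - m l \<le> 2 + L / \<kappa>" by simp
    show "cmod (f (exp (log_polar t \<theta>)) - f (of_real (exp t))) \<le> m' t"
      if "t \<in> {l..u0}" "\<theta> \<in> {\<beta>, -\<beta>}" for t \<theta>
    proof -
      have "cmod (f (exp (log_polar t \<theta>)) - f (of_real (exp t)))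
         \<le> cmod (\<phi> (exp (log_polar t \<theta>)) - \<phi> (of_real (exp t))) * (real n * (1 - \<kappa> * exp t) ^ (n - 1))"
        unfolding f_def using \<phi>_ray[of t \<theta>] \<phi>_axis[of t] that by (intro norm_power_diff_le) auto
      also have "\<dots> \<le> L * exp t * (real n * (1 - \<kappa> * exp t) ^ (n - 1))"
        using \<phi>_diff[of t \<theta>] that q[of t] by (intro mult_right_mono) auto
      finally show ?thesis by (simp add: m'_def)
    qed
    show "exp t * cmod (deriv f (of_real (exp t))) \<le> m' t" if "t \<in> {l..u0}" for t
    proof -
      have t: "t \<le> u0" using that by simp
      have "(f has_field_derivative of_nat n * (\<phi> (of_real (exp t)) ^ (n - 1) * deriv \<phi> (of_real (exp t)))) (at (of_real (exp t)))"
        unfolding f_def by (auto intro!: derivative_eq_intros \<phi>_chain[OF t])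
      then have "cmod (deriv f (of_real (exp t))) = real n * (cmod (\<phi> (of_real (exp t))) ^ (n - 1) * cmod (deriv \<phi> (of_real (exp t))))"
        by (simp add: DERIV_imp_deriv norm_mult norm_power)
      also have "\<dots> \<le> real n * ((1 - \<kappa> * exp t) ^ (n - 1) * L)"
        using \<phi>_axis[OF t] \<phi>_deriv[OF t] q[OF t] by (intro mult_left_mono mult_mono power_mono) auto
      finally have "exp t * cmod (deriv f (of_real (exp t))) \<le> exp t * (real n * ((1 - \<kappa> * exp t) ^ (n - 1) * L))"
        by (intro mult_left_mono) auto
      then show ?thesis by (simp add: m'_def mult_ac)
    qed
  qed
  moreover have "cauchy_integral l f x = (2 * of_real pi * \<i>) *\<^sub>C (op_power T n) x"
    using keyhole_integral_power[OF l, of "\<lambda>_. 1" n x] keyhole_integral_resolvent[OF lu, of x]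
    by (simp add: f_def cbounded_ops_scaleC[OF op_power_in_cbounded_ops[OF T]])
  ultimately have "2 * pi * norm ((op_power T n) x) \<le> (2 + L / \<kappa>) * \<Lambda> * norm x"
    by (simp add: norm_scaleC norm_mult \<Lambda>_def mult_ac)
  then show "norm ((op_power T n) x) \<le> (2 + L / \<kappa>) * \<Lambda> / (2 * pi) * norm x"
    by (simp add: field_simps)
qed

definition resolvent_const :: "real \<Rightarrow> real" where
  "resolvent_const c = (1 / c + 2 + L / (\<kappa> * (c / (c + 2))\<^sup>2)) * \<Lambda> / (2 * pi)"

text \<open>
  The resolvent bound for convex combinations of powers, uniform in the weights. On the rays the
  quotient \<open>f = (1 - z) / (z - p \<circ> \<phi>)\<close> is controlled, up to a constant factor, by the exact derivative of
  \<open>- a / (a + 1 - p (1 - \<kappa> exp t))\<close> with \<open>a = |1 - z|\<close>, whose total variation is at most one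
  whatever \<open>p\<close> is.
\<close>

lemma op_poly_resolvent:
  assumes d: "convex_weights d N" and c: "0 < c" and z: "z \<noteq> 1"
    and sep: "\<And>\<mu>. \<mu> \<in> inner_region \<Longrightarrow> c * cmod (1 - z) \<le> cmod (z - cpoly d N (\<phi> \<mu>))"
  obtains S where "is_op_inverse (scalar_op z - op_poly d N T) S" "norm S \<le> resolvent_const c / cmod (1 - z)"
proof -
  define a where "a = cmod (1 - z)"
  have a: "0 < a" using z by (simp add: a_def)
  define P where "P = (\<lambda>\<mu>. cpoly d N (\<phi> \<mu>))"
  have P: "P holomorphic_on U0"
    unfolding P_def using holomorphic_on_compose_gen[OF \<phi> holomorphic_on_cpoly[of d N UNIV]] by (simp add: o_def)
  define U where "U = {\<mu> \<in> U0. P \<mu> \<noteq> z}"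
  have U: "open U" "0 \<in> U" "inner_region \<subseteq> U" "U \<subseteq> U0"
  proof -
    have "U = U0 \<inter> P -` (- {z})" by (auto simp: U_def)
    then show "open U"
      using continuous_open_preimage[OF holomorphic_on_imp_continuous_on[OF P] U0(1), of "- {z}"] by auto
    show "0 \<in> U" using U0 \<phi>_0 cpoly_one[OF d] z by (auto simp: U_def P_def)
    show "inner_region \<subseteq> U"
    proof
      fix \<mu> assume \<mu>: "\<mu> \<in> inner_region"
      have "0 < c * a" using a c by simp
      then have "P \<mu> \<noteq> z" using sep[OF \<mu>] by (auto simp: a_def P_def)
      then show "\<mu> \<in> U" using \<mu> U0 by (auto simp: U_def)
    qed
  qed (auto simp: U_def)
  define f where "f = (\<lambda>\<mu>. (1 - z) / (z - P \<mu>))"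
  have f: "f holomorphic_on U"
    unfolding f_def by (intro holomorphic_intros holomorphic_on_subset[OF P U(4)]) (auto simp: U_def)
  have f0: "cmod (f 0) = 1"
    using \<phi>_0 cpoly_one[OF d] z by (simp add: f_def P_def norm_divide norm_minus_commute)
  obtain l where l: "admissible U l" and near: "\<And>\<mu>. \<mu> \<in> cball 0 (exp l) \<Longrightarrow> cmod (f \<mu>) \<le> cmod (f 0) + 1"
    using admissible_radius[OF U f] by blast
  have lu: "l \<le> u0" using l by (simp add: admissible_def)
  define c' where "c' = c / (c + 2)"
  have c': "0 < c'" using c by (simp add: c'_def)
  define q where "q = (\<lambda>t. 1 - \<kappa> * exp t)"
  have q: "0 \<le> q t" "q t \<le> 1" if "t \<le> u0" for t
    using order_trans[OF norm_ge_zero \<phi>_axis[OF that]] \<kappa> by (auto simp: q_def)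
  define D where "D = (\<lambda>t. a + (1 - rpoly d N (q t)))"
  have D: "a \<le> D t" if "t \<le> u0" for t
    using rpoly_le_one[OF d q[OF that]] by (simp add: D_def)
  \<comment> \<open>The separation from \<open>1 - z\<close> also gives separation from \<open>1 - p\<close>, since
    \<open>|1 - p| \<le> |1 - z| + |z - p|\<close>; the constant \<open>c / (c + 2)\<close> covers the sum of both.\<close>
  have lower: "c' * D t \<le> cmod (z - P \<mu>)" if \<mu>: "\<mu> \<in> inner_region" and \<phi>q: "cmod (\<phi> \<mu>) \<le> q t" for \<mu> t
  proof -
    have 1: "c * a \<le> cmod (z - P \<mu>)" using sep[OF \<mu>] by (simp add: a_def P_def)
    have "1 - rpoly d N (q t) \<le> 1 - cmod (P \<mu>)" using norm_cpoly_le[OF d \<phi>q] by (simp add: P_def)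
    also have "\<dots> \<le> cmod (1 - P \<mu>)" using norm_triangle_ineq2[of 1 "P \<mu>"] by simp
    also have "\<dots> \<le> a + cmod (z - P \<mu>)" using norm_triangle_ineq[of "1 - z" "z - P \<mu>"] by (simp add: a_def)
    finally have "c * D t \<le> 2 * (c * a) + c * cmod (z - P \<mu>)"
      using c mult_left_mono[of "D t" "2 * a + cmod (z - P \<mu>)" c] by (simp add: D_def algebra_simps)
    also have "\<dots> \<le> (c + 2) * cmod (z - P \<mu>)" using 1 by (simp add: algebra_simps)
    finally show ?thesis using c by (simp add: c'_def field_simps)
  qed
  define K0 where "K0 = L / (\<kappa> * c'\<^sup>2)"
  have K0: "0 \<le> K0" using L \<kappa> by (simp add: K0_def)
  define m where "m = (\<lambda>t. - (K0 * a / D t))"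
  define m' where "m' = (\<lambda>t. K0 * a * (\<kappa> * exp t * rpoly_deriv d N (q t)) / (D t)\<^sup>2)"
  have m'_eq: "m' t = a * (L * exp t * rpoly_deriv d N (q t)) / (c' * D t)\<^sup>2" for t
    using \<kappa> c' by (simp add: m'_def K0_def power_mult_distrib field_simps)
  have rd: "0 \<le> rpoly_deriv d N (q t)" if "t \<le> u0" for t
    using d q[OF that] by (auto simp: rpoly_deriv_def convex_weights_def intro!: sum_nonneg)
  have denom: "(c' * D t)\<^sup>2 \<le> cmod (z - P \<mu>) * cmod (z - P \<nu>)"
    if "\<mu> \<in> inner_region" "cmod (\<phi> \<mu>) \<le> q t" "\<nu> \<in> inner_region" "cmod (\<phi> \<nu>) \<le> q t" "t \<le> u0" for \<mu> \<nu> t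
  proof -
    have "0 \<le> c' * D t" using c' D[OF that(5)] a by simp
    then show ?thesis unfolding power2_eq_square using lower that by (intro mult_mono) auto
  qed
  have cD: "0 < (c' * D t)\<^sup>2" if "t \<le> u0" for t
    using c' D[OF that] a by (intro zero_less_power mult_pos_pos) auto
  have est: "norm (cauchy_integral l f x)
      \<le> (1 / c + 2 + K0) * C * (2 * \<beta> * (L1 + 1) + 8 * pi + 2) * norm x" for x
  proof (rule keyhole_integral_estimate[OF lu U(1,3) _ f, where m = m and m' = m'])
    show "cball 0 (exp l) \<subseteq> U" using l by (simp add: admissible_def)
    show "cmod (f \<mu>) \<le> 1 / c + 2 + K0" if "\<mu> \<in> inner_region \<union> cball 0 (exp l)" for \<mu>
    proof (cases "\<mu> \<in> inner_region")
      case True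
      have pos: "0 < c * a" using c a by simp
      have "cmod (f \<mu>) \<le> a / (c * a)"
        unfolding f_def norm_divide a_def[symmetric]
      proof (rule divide_left_mono)
        show "c * a \<le> cmod (z - P \<mu>)" using sep[OF True] by (simp add: P_def a_def)
        then show "0 < cmod (z - P \<mu>) * (c * a)" using pos c a by (intro mult_pos_pos) linarith+
      qed (use a in simp)
      also have "\<dots> = 1 / c" using a by simp
      finally show ?thesis using K0 by simp
    next
      case False
      then show ?thesis using that near[of \<mu>] f0 K0 c by (auto intro: add_nonneg_nonneg order_trans)
    qed
    show "(m has_real_derivative m' t) (at t within {l..u0})" if "t \<in> {l..u0}" for t
    proof -
      have Dt: "D t \<noteq> 0" using D[of t] a that by auto
      have "(q has_real_derivative - (\<kappa> * exp t)) (at t within {l..u0})"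
        unfolding q_def by (auto intro!: derivative_eq_intros)
      from DERIV_chain2[OF rpoly_has_derivative this]
      have "(D has_real_derivative \<kappa> * exp t * rpoly_deriv d N (q t)) (at t within {l..u0})"
        unfolding D_def by (auto intro!: derivative_eq_intros)
      then show ?thesis
        unfolding m_def m'_def using Dt by (auto intro!: derivative_eq_intros simp: power2_eq_square)
    qed
    have "m u0 \<le> 0" using K0 a D[of u0] by (simp add: m_def)
    moreover have "- K0 \<le> m l"
    proof -
      have "a / D l \<le> 1" using D[OF lu] a by simp
      then show ?thesis using mult_left_mono[of "a / D l" 1 K0] K0 by (simp add: m_def)
    qed
    ultimately show "m u0 - m l \<le> 1 / c + 2 + K0" using c by (simp add: add_nonneg_nonneg add_increasing)
    show "cmod (f (exp (log_polar t \<theta>)) - f (of_real (exp t))) \<le> m' t"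
      if tt: "t \<in> {l..u0}" and \<theta>: "\<theta> \<in> {\<beta>, -\<beta>}" for t \<theta>
    proof -
      have t: "t \<le> u0" using tt by simp
      define \<mu> where "\<mu> = exp (log_polar t \<theta>)"
      define \<nu> where "\<nu> = complex_of_real (exp t)"
      have \<mu>: "\<mu> \<in> inner_region" "cmod (\<phi> \<mu>) \<le> q t"
        unfolding \<mu>_def q_def using ray_in_inner_region[OF t \<theta>] \<phi>_ray[OF t, of \<theta>] \<theta> by auto
      have \<nu>: "\<nu> \<in> inner_region" "cmod (\<phi> \<nu>) \<le> q t"
        unfolding \<nu>_def q_def using axis_in_inner_region[OF t] \<phi>_axis[OF t] by auto
      have nz: "z - P \<mu> \<noteq> 0" "z - P \<nu> \<noteq> 0" using \<mu> \<nu> U by (auto simp: U_def)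
      have "f \<mu> - f \<nu> = (1 - z) * (P \<mu> - P \<nu>) / ((z - P \<mu>) * (z - P \<nu>))"
        unfolding f_def using nz by (simp add: field_simps)
      then have "cmod (f \<mu> - f \<nu>) = a * cmod (P \<mu> - P \<nu>) / (cmod (z - P \<mu>) * cmod (z - P \<nu>))"
        by (simp add: norm_mult norm_divide a_def)
      also have "\<dots> \<le> a * (L * exp t * rpoly_deriv d N (q t)) / (c' * D t)\<^sup>2"
      proof (intro frac_le mult_left_mono)
        have "cmod (P \<mu> - P \<nu>) \<le> cmod (\<phi> \<mu> - \<phi> \<nu>) * rpoly_deriv d N (q t)"
          unfolding P_def by (rule norm_cpoly_diff_le[OF d \<mu>(2) \<nu>(2)])
        also have "\<dots> \<le> L * exp t * rpoly_deriv d N (q t)"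
          using \<phi>_diff[OF t \<theta>] rd[OF t] by (intro mult_right_mono) (auto simp: \<mu>_def \<nu>_def)
        finally show "cmod (P \<mu> - P \<nu>) \<le> L * exp t * rpoly_deriv d N (q t)" .
      qed (use a cD[OF t] denom[OF \<mu> \<nu> t] L rd[OF t] in auto)
      finally show ?thesis by (simp add: m'_eq \<mu>_def \<nu>_def)
    qed
    show "exp t * cmod (deriv f (of_real (exp t))) \<le> m' t" if tt: "t \<in> {l..u0}" for t
    proof -
      have t: "t \<le> u0" using tt by simp
      define \<nu> where "\<nu> = complex_of_real (exp t)"
      have \<nu>: "\<nu> \<in> inner_region" "cmod (\<phi> \<nu>) \<le> q t"
        unfolding \<nu>_def q_def using axis_in_inner_region[OF t] \<phi>_axis[OF t] by auto
      have nz: "z - P \<nu> \<noteq> 0" using \<nu> U by (auto simp: U_def)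
      define \<delta> where "\<delta> = cpoly_deriv d N (\<phi> \<nu>) * deriv \<phi> \<nu>"
      have "(P has_field_derivative \<delta>) (at \<nu>)"
        unfolding P_def \<nu>_def \<delta>_def by (rule DERIV_chain2[OF cpoly_has_derivative \<phi>_chain[OF t]])
      then have "(f has_field_derivative (1 - z) * \<delta> / ((z - P \<nu>) * (z - P \<nu>))) (at \<nu>)"
        unfolding f_def using nz by (auto intro!: derivative_eq_intros)
      then have "cmod (deriv f \<nu>) = a * cmod \<delta> / (cmod (z - P \<nu>) * cmod (z - P \<nu>))"
        by (simp add: DERIV_imp_deriv norm_mult norm_divide a_def)
      also have "\<dots> \<le> a * (rpoly_deriv d N (q t) * L) / (c' * D t)\<^sup>2"
      proof (intro frac_le mult_left_mono)
        show "cmod \<delta> \<le> rpoly_deriv d N (q t) * L"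
          unfolding \<delta>_def norm_mult \<nu>_def[symmetric]
          using norm_cpoly_deriv_le[OF d \<nu>(2)] \<phi>_deriv[OF t] rd[OF t] by (intro mult_mono) (auto simp: \<nu>_def)
      qed (use a cD[OF t] denom[OF \<nu> \<nu> t] L rd[OF t] in auto)
      finally have "exp t * cmod (deriv f \<nu>) \<le> exp t * (a * (rpoly_deriv d N (q t) * L) / (c' * D t)\<^sup>2)"
        by (intro mult_left_mono) auto
      then show ?thesis by (simp add: m'_eq \<nu>_def mult_ac)
    qed
  qed
  define s where "s = 2 * of_real pi * \<i> * (1 - z)"
  have s: "s \<noteq> 0" "cmod s = 2 * pi * a" using z by (auto simp: s_def norm_mult a_def)
  define Q where "Q = (\<lambda>x. inverse s *\<^sub>C cauchy_integral l f x)"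
  have opP: "op_poly d N T \<in> cbounded_ops" by (rule op_poly_in_cbounded_ops[OF T])
  have Uop: "scalar_op z - op_poly d N T \<in> cbounded_ops" by (rule scalar_op_minus_in_cbounded_ops[OF opP])
  have cf: "continuous_on (keyhole l) (\<lambda>w. f (exp w))" by (rule continuous_on_keyhole[OF l f])
  have cP: "continuous_on (keyhole l) (\<lambda>w. P (exp w))"
    by (rule continuous_on_keyhole[OF l holomorphic_on_subset[OF P U(4)]])
  have UI: "(scalar_op z - op_poly d N T) (cauchy_integral l f x) = s *\<^sub>C x" for x
  proof -
    have zI: "z *\<^sub>C cauchy_integral l f x = keyhole_integral l (\<lambda>w. z *\<^sub>C f (exp w) *\<^sub>C V x w)"
      by (rule keyhole_integral_linear[OF lu, symmetric])
         (auto intro!: continuous_intros cf V_continuous_keyhole bounded_linear_scaleC simp: scaleC_scaleC mult.commute)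
    have "(scalar_op z - op_poly d N T) (cauchy_integral l f x)
      = keyhole_integral l (\<lambda>w. z *\<^sub>C f (exp w) *\<^sub>C V x w) - cauchy_integral l (\<lambda>\<mu>. P \<mu> * f \<mu>) x"
      unfolding blinfun.diff_left apply_scalar_op zI keyhole_integral_op_poly[OF l f] P_def ..
    also have "\<dots> = keyhole_integral l (\<lambda>w. z *\<^sub>C f (exp w) *\<^sub>C V x w - (P (exp w) * f (exp w)) *\<^sub>C V x w)"
      by (rule keyhole_integral_diff[OF lu, symmetric]) (intro continuous_intros cf cP V_continuous_keyhole)+
    also have "\<dots> = keyhole_integral l (\<lambda>w. (1 - z) *\<^sub>C V x w)"
    proof (rule keyhole_integral_cong)
      fix w assume w: "w \<in> keyhole l"
      have "exp w \<in> U" using exp_keyhole_in[OF w U(3)] l by (simp add: admissible_def)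
      then have "z - P (exp w) \<noteq> 0" by (auto simp: U_def)
      then have *: "1 - z = z * f (exp w) - P (exp w) * f (exp w)"
        unfolding left_diff_distrib[symmetric] by (simp add: f_def)
      show "z *\<^sub>C f (exp w) *\<^sub>C V x w - (P (exp w) * f (exp w)) *\<^sub>C V x w = (1 - z) *\<^sub>C V x w"
        unfolding * by (simp add: scaleC_scaleC scaleC_diff_left)
    qed
    also have "\<dots> = (1 - z) *\<^sub>C keyhole_integral l (V x)"
      by (rule keyhole_integral_linear[OF lu V_continuous_keyhole bounded_linear_scaleC])
         (simp add: scaleC_scaleC mult.commute)
    finally show ?thesis by (simp add: keyhole_integral_resolvent[OF lu] scaleC_scaleC s_def mult_ac)
  qed
  have UQ: "(scalar_op z - op_poly d N T) (Q x) = x" for x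
    unfolding Q_def cbounded_ops_scaleC[OF Uop] UI using s by (simp add: scaleC_scaleC)
  have comm: "(R \<mu>) ((scalar_op z - op_poly d N T) x)
      = (scalar_op z - op_poly d N T) ((R \<mu>) x)" if "\<mu> \<in> good" for \<mu> x
    using that by (simp add: blinfun.diff_left blinfun.diff_right R_scaleC op_poly_apply blinfun.sum_right
        blinfun.scaleR_right op_power_commute)
  have QU: "Q ((scalar_op z - op_poly d N T) x) = x" for x
  proof -
    have "keyhole_integral l (\<lambda>w. f (exp w) *\<^sub>C V ((scalar_op z - op_poly d N T) x) w) = s *\<^sub>C x"
      using keyhole_integral_commute[OF l f Uop, of x] comm UI by simp
    then show ?thesis unfolding Q_def using s by (simp add: scaleC_scaleC)
  qed
  have res: "resolvent_const c = (1 / c + 2 + K0) * \<Lambda> / (2 * pi)"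
    by (simp add: resolvent_const_def K0_def c'_def)
  have Qb: "norm (Q x) \<le> resolvent_const c / a * norm x" for x
  proof -
    have "norm (Q x) = norm (cauchy_integral l f x) / (2 * pi * a)"
      unfolding Q_def norm_scaleC norm_inverse s(2) by (simp only: divide_inverse mult.commute)
    also have "\<dots> \<le> (1 / c + 2 + K0) * \<Lambda> * norm x / (2 * pi * a)"
      using est[of x] a by (intro divide_right_mono) (auto simp: \<Lambda>_def mult_ac)
    finally show ?thesis by (simp add: res field_simps)
  qed
  have "0 \<le> resolvent_const c / a"
    using K0 \<Lambda>_nonneg c a by (simp add: res add_nonneg_nonneg)
  from is_op_inverse_of_function[OF Uop this UQ QU Qb] obtain S
    where "is_op_inverse (scalar_op z - op_poly d N T) S" "norm S \<le> resolvent_const c / a" .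
  then show thesis unfolding a_def by (rule that)
qed

end

section \<open>Approximating the power series\<close>

text \<open>
  The mass of the tail is moved to the constant term, so the truncations are again convex combinations
  and the uniform estimates apply to them.
\<close>

definition trunc_weights :: "(nat \<Rightarrow> real) \<Rightarrow> nat \<Rightarrow> nat \<Rightarrow> real" where
  "trunc_weights c N n = (if n = 0 then 1 - (\<Sum>k=1..N. c k) else c n)"

lemma sum_le_one:
  assumes "\<And>n. 0 \<le> c n" "c sums (1::real)"
  shows "(\<Sum>n\<le>N. c n) \<le> 1"
  using sum_le_suminf[of c "{..N}"] assms by (simp add: sums_iff)

lemma sum_atMost_split: "(\<Sum>n\<le>N. g n) = g 0 + (\<Sum>n=1..N. g (n::nat))" for g :: "nat \<Rightarrow> 'b::comm_monoid_add"
  by (simp add: atMost_atLeast0 sum.atLeast_Suc_atMost)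

lemma convex_trunc_weights:
  assumes "\<And>n. 0 \<le> c n" "c sums 1"
  shows "convex_weights (trunc_weights c N) N"
proof -
  have "(\<Sum>k=1..N. c k) \<le> 1"
    using sum_le_one[OF assms, of N] assms(1)[of 0] sum_atMost_split[of c N] by simp
  moreover have "(\<Sum>n\<le>N. trunc_weights c N n) = 1"
    unfolding sum_atMost_split by (simp add: trunc_weights_def)
  ultimately show ?thesis using assms(1) by (simp add: convex_weights_def trunc_weights_def)
qed

lemma op_poly_trunc_tendsto:
  fixes T :: "'a::complex_banach \<Rightarrow>\<^sub>L 'a"
  assumes c: "\<And>n. 0 \<le> c n" "c sums 1" and M: "\<And>n. norm (op_power T n) \<le> M"
  shows "(\<lambda>N. op_poly (trunc_weights c N) N T) \<longlonglongrightarrow> power_series_op c T"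
proof -
  have "summable (\<lambda>n. c n *\<^sub>R op_power T n)"
  proof (rule summable_comparison_test')
    show "summable (\<lambda>n. c n * M)" using c by (intro summable_mult2) (simp add: sums_iff)
    show "norm (c n *\<^sub>R op_power T n) \<le> c n * M" for n using c(1)[of n] M by (auto intro: mult_left_mono)
  qed
  then have 1: "(\<lambda>N. \<Sum>n\<le>N. c n *\<^sub>R op_power T n) \<longlonglongrightarrow> power_series_op c T"
    unfolding power_series_op_def by (rule summable_LIMSEQ')
  have "(\<lambda>N. \<Sum>n\<le>N. c n) \<longlonglongrightarrow> 1" using c(2) by (simp add: sums_def_le)
  from tendsto_add[OF 1 tendsto_scaleR[OF tendsto_diff[OF tendsto_const[of 1] this] tendsto_const[of id_blinfun]]]
  have 2: "(\<lambda>N. (\<Sum>n\<le>N. c n *\<^sub>R op_power T n) + (1 - (\<Sum>n\<le>N. c n)) *\<^sub>R id_blinfun)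
      \<longlonglongrightarrow> power_series_op c T" by simp
  have "op_poly (trunc_weights c N) N T
      = (\<Sum>n\<le>N. c n *\<^sub>R op_power T n) + (1 - (\<Sum>n\<le>N. c n)) *\<^sub>R id_blinfun" for N
    unfolding op_poly_def sum_atMost_split by (simp add: trunc_weights_def algebra_simps)
  with 2 show ?thesis by simp
qed

context keyhole_calculus
begin

lemma power_series_in_cbounded_ops:
  assumes "\<And>n. 0 \<le> a n" "a sums 1"
  shows "power_series_op a T \<in> cbounded_ops"
  by (rule closed_sequentially[OF closed_cbounded_ops _ op_poly_trunc_tendsto[OF assms power_bounded]])
     (rule op_poly_in_cbounded_ops[OF T])

lemma power_series_resolvent:
  assumes a: "\<And>n. 0 \<le> a n" "a sums 1" and c: "0 < c" and z: "z \<noteq> 1"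
    and sep: "\<And>N \<mu>. \<mu> \<in> inner_region \<Longrightarrow>
        c * cmod (1 - z) \<le> cmod (z - cpoly (trunc_weights a N) N (\<phi> \<mu>))"
  shows "z \<notin> op_spectrum (power_series_op a T)"
    "norm (resolvent z (power_series_op a T)) \<le> resolvent_const c / cmod (1 - z)"
proof -
  define p where "p = (\<lambda>N. op_poly (trunc_weights a N) N T)"
  have "\<exists>S. is_op_inverse (scalar_op z - p N) S \<and> norm S \<le> resolvent_const c / cmod (1 - z)" for N
    using op_poly_resolvent[OF convex_trunc_weights[OF a] c z sep, of N] unfolding p_def by metis
  then obtain S where S: "\<And>N. is_op_inverse (scalar_op z - p N) (S N)"
      "\<And>N. norm (S N) \<le> resolvent_const c / cmod (1 - z)"
    by metis
  have "p \<longlonglongrightarrow> power_series_op a T"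
    unfolding p_def by (rule op_poly_trunc_tendsto[OF a power_bounded])
  then have "(\<lambda>N. scalar_op z - p N) \<longlonglongrightarrow> scalar_op z - power_series_op a T"
    by (intro tendsto_intros)
  from is_op_inverse_limit[OF this S] obtain S0
    where S0: "is_op_inverse (scalar_op z - power_series_op a T) S0" "norm S0 \<le> resolvent_const c / cmod (1 - z)" .
  show "z \<notin> op_spectrum (power_series_op a T)"
    "norm (resolvent z (power_series_op a T)) \<le> resolvent_const c / cmod (1 - z)"
    using is_op_inverse_resolvent[OF S0(1)] S0(2) by auto
qed

end

section \<open>Stolz domains\<close>

lemma cos_ge_in_sector: "\<bar>\<theta>\<bar> \<le> \<beta> \<Longrightarrow> \<beta> \<le> pi \<Longrightarrow> cos \<beta> \<le> cos \<theta>"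
  using cos_monotone_0_pi_le[of "\<bar>\<theta>\<bar>" \<beta>] by simp

lemma cos_le_off_sector:
  assumes "\<theta> \<in> {\<beta>..2*pi-\<beta>}" "0 \<le> \<beta>"
  shows "cos \<theta> \<le> cos \<beta>"
proof (cases "\<theta> \<le> pi")
  case True then show ?thesis using cos_monotone_0_pi_le[of \<beta> \<theta>] assms by simp
next
  case False
  then have "cos (2 * pi - \<theta>) \<le> cos \<beta>" using assms by (intro cos_monotone_0_pi_le) auto
  then show ?thesis by (simp add: cos_diff)
qed

lemma norm_one_minus_polar: "(cmod (1 - of_real r * cis \<theta>))\<^sup>2 = 1 - 2 * r * cos \<theta> + r\<^sup>2"
proof -
  have "(cmod (1 - of_real r * cis \<theta>))\<^sup>2 = (1 - r * cos \<theta>)\<^sup>2 + (r * sin \<theta>)\<^sup>2"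
    by (simp add: cmod_power2)
  also have "\<dots> = 1 - 2 * r * cos \<theta> + r\<^sup>2 * ((cos \<theta>)\<^sup>2 + (sin \<theta>)\<^sup>2)"
    by (simp only: power2_eq_square ring_distribs) (simp add: algebra_simps)
  finally show ?thesis by simp
qed

lemma stolz_iff: "z \<in> stolz \<delta> \<longleftrightarrow> z = 1 \<or> cmod z < 1 \<and> cmod (1 - z) < \<delta> * (1 - cmod z)"
  by (auto simp: stolz_def field_simps)

text \<open>In polar coordinates around \<open>1\<close> the boundary of a Stolz domain is a limacon.\<close>

lemma stolz_polarD:
  assumes r: "0 < r" and k: "0 < k" and mem: "1 - of_real r * cis \<theta> \<in> stolz (1 / k)"
  shows "r * (1 - k\<^sup>2) < 2 * (cos \<theta> - k)"
proof -
  define \<zeta> where "\<zeta> = 1 - of_real r * cis \<theta>"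
  have "\<zeta> \<noteq> 1" using r by (simp add: \<zeta>_def)
  moreover have "cmod (1 - \<zeta>) = r" using r by (simp add: \<zeta>_def norm_mult)
  ultimately have "r < 1 / k * (1 - cmod \<zeta>)" using mem by (simp add: stolz_iff \<zeta>_def)
  then have "cmod \<zeta> < 1 - k * r" using k by (simp add: field_simps)
  then have "(cmod \<zeta>)\<^sup>2 < (1 - k * r)\<^sup>2" by (intro power_strict_mono) auto
  then have "r * (r * (1 - k\<^sup>2)) < r * (2 * (cos \<theta> - k))"
    unfolding \<zeta>_def norm_one_minus_polar by (simp add: power2_eq_square algebra_simps)
  then show ?thesis using r by simp
qed

lemma norm_one_minus_polar_le:
  assumes r: "0 \<le> r" and k: "0 < k" "k < 1" and le: "r * (1 - k\<^sup>2) \<le> 2 * (cos \<theta> - k)"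
  shows "cmod (1 - of_real r * cis \<theta>) \<le> 1 - k * r"
proof (rule power2_le_imp_le)
  have "r * (r * (1 - k\<^sup>2)) \<le> r * (2 * (cos \<theta> - k))" by (rule mult_left_mono[OF le r])
  then show "(cmod (1 - of_real r * cis \<theta>))\<^sup>2 \<le> (1 - k * r)\<^sup>2"
    unfolding norm_one_minus_polar by (simp add: power2_eq_square algebra_simps)
  have "r * (1 + k) * (1 - k) \<le> 2 * (1 - k)"
  proof -
    have "r * (1 + k) * (1 - k) = r * (1 - k\<^sup>2)" by (simp add: power2_eq_square algebra_simps)
    also note le
    also have "2 * (cos \<theta> - k) \<le> 2 * (1 - k)" by simp
    finally show ?thesis .
  qed
  then have "r * (1 + k) \<le> 2" by (rule mult_right_le_imp_le) (use k in simp)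
  moreover have "r * k \<le> r * 1" using k r by (intro mult_left_mono) auto
  ultimately have "2 * (k * r) \<le> 2" by (simp add: algebra_simps)
  then show "0 \<le> 1 - k * r" by simp
qed

lemma stolz_power:
  assumes "k * cmod (1 - \<zeta>) \<le> 1 - cmod \<zeta>" "0 < k"
  shows "k * cmod (1 - \<zeta> ^ n) \<le> 1 - cmod \<zeta> ^ n"
proof (induction n)
  case (Suc n)
  have "1 - \<zeta> ^ Suc n = (1 - \<zeta> ^ n) + \<zeta> ^ n * (1 - \<zeta>)" by (simp add: algebra_simps)
  then have "cmod (1 - \<zeta> ^ Suc n) \<le> cmod (1 - \<zeta> ^ n) + cmod \<zeta> ^ n * cmod (1 - \<zeta>)"
    by (metis norm_mult norm_power norm_triangle_ineq)
  then have "k * cmod (1 - \<zeta> ^ Suc n) \<le> k * cmod (1 - \<zeta> ^ n) + cmod \<zeta> ^ n * (k * cmod (1 - \<zeta>))"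
    using mult_left_mono[of _ _ k] assms(2) by (fastforce simp: algebra_simps)
  also have "\<dots> \<le> (1 - cmod \<zeta> ^ n) + cmod \<zeta> ^ n * (1 - cmod \<zeta>)"
    using assms Suc by (intro add_mono mult_left_mono) auto
  finally show ?case by (simp add: algebra_simps)
qed simp

text \<open>Probability generating functions map each closed Stolz domain into itself.\<close>

lemma stolz_cpoly:
  assumes d: "convex_weights d N" and \<zeta>: "k * cmod (1 - \<zeta>) \<le> 1 - cmod \<zeta>" and k: "0 < k"
  shows "k * cmod (1 - cpoly d N \<zeta>) \<le> 1 - cmod (cpoly d N \<zeta>)"
proof -
  have "k * cmod (1 - cpoly d N \<zeta>) \<le> k * (\<Sum>n\<le>N. d n * cmod (1 - \<zeta> ^ n))"
    unfolding one_minus_cpoly[OF d] using k d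
    by (intro mult_left_mono sum_norm_le) (auto simp: norm_mult convex_weights_def)
  also have "\<dots> = (\<Sum>n\<le>N. d n * (k * cmod (1 - \<zeta> ^ n)))"
    by (simp add: sum_distrib_left mult_ac)
  also have "\<dots> \<le> (\<Sum>n\<le>N. d n * (1 - cmod \<zeta> ^ n))"
    using d stolz_power[OF \<zeta> k] by (intro sum_mono mult_left_mono) (auto simp: convex_weights_def)
  also have "\<dots> = 1 - rpoly d N (cmod \<zeta>)"
    using d by (simp add: rpoly_def convex_weights_def right_diff_distrib sum_subtractf)
  also have "\<dots> \<le> 1 - cmod (cpoly d N \<zeta>)" using norm_cpoly_le[OF d order_refl] by simp
  finally show ?thesis .
qed

lemma not_in_stolzD: "z \<notin> stolz \<delta> \<Longrightarrow> 0 < \<delta> \<Longrightarrow> 1 - cmod z \<le> 1 / \<delta> * cmod (1 - z)"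
proof (cases "cmod z < 1")
  case False
  assume "0 < \<delta>"
  then have "0 \<le> 1 / \<delta> * cmod (1 - z)" by simp
  with False show ?thesis by linarith
qed (auto simp: stolz_iff field_simps)

text \<open>
  Two Stolz domains of different size are separated at a distance comparable with the distance to their
  common vertex.
\<close>

lemma stolz_separation:
  assumes z: "z \<notin> stolz \<delta>" and \<delta>: "0 < \<delta>" and k: "0 < k" "k \<le> 1" and p: "k * cmod (1 - p) \<le> 1 - cmod p"
  shows "(k - 1 / \<delta>) / 2 * cmod (1 - z) \<le> cmod (z - p)"
proof -
  have "cmod (1 - z) \<le> cmod (z - p) + cmod (1 - p)"
    using norm_triangle_ineq4[of "1 - p" "z - p"] by (simp add: add.commute)
  then have "k * cmod (1 - z) \<le> k * cmod (z - p) + k * cmod (1 - p)"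
    using k mult_left_mono[of "cmod (1 - z)" "cmod (z - p) + cmod (1 - p)" k] by (simp add: algebra_simps)
  also have "\<dots> \<le> 1 * cmod (z - p) + (1 - cmod p)"
    using k p by (intro add_mono mult_right_mono) auto
  also have "1 - cmod p \<le> (1 - cmod z) + cmod (z - p)"
    using norm_triangle_ineq2[of z p] by simp
  also have "1 - cmod z \<le> 1 / \<delta> * cmod (1 - z)" by (rule not_in_stolzD[OF z \<delta>])
  finally show ?thesis by (simp add: algebra_simps)
qed

lemma stolz_mono: "\<delta> \<le> \<delta>' \<Longrightarrow> stolz \<delta> \<subseteq> stolz \<delta>'"
proof
  fix z assume "\<delta> \<le> \<delta>'" "z \<in> stolz \<delta>"
  then show "z \<in> stolz \<delta>'"
    using mult_right_mono[of \<delta> \<delta>' "1 - cmod z"] by (auto simp: stolz_iff intro: order_less_le_trans)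
qed

text \<open>
  For \<open>\<sigma> > 1\<close> the point \<open>0\<close> satisfies the strict inequality, so every point with the weak one is
  a limit of points of the open domain on the segment to \<open>0\<close>. For \<open>\<sigma> = 1\<close> the conclusion fails: the
  inequality describes \<open>[0, 1]\<close>, but the Stolz domain consists of \<open>1\<close> alone.
\<close>

lemma closed_stolz_subset:
  assumes \<sigma>: "1 < \<sigma>" and z: "cmod (1 - z) \<le> \<sigma> * (1 - cmod z)"
  shows "z \<in> closure (stolz \<sigma>)"
proof -
  have z1: "cmod z \<le> 1"
  proof -
    have "0 \<le> \<sigma> * (1 - cmod z)" using z norm_ge_zero order_trans by blast
    then show ?thesis using \<sigma> by (simp add: zero_le_mult_iff)
  qed
  define s where "s = (\<lambda>n. 1 - inverse (real (Suc n)))"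
  have "of_real (s n) * z \<in> stolz \<sigma>" for n
  proof -
    have s: "0 \<le> s n" "s n < 1" by (auto simp: s_def field_simps)
    have n: "cmod (of_real (s n) * z) = s n * cmod z" using s by (simp add: norm_mult)
    have "1 - of_real (s n) * z = of_real (1 - s n) + of_real (s n) * (1 - z)" by (simp add: algebra_simps)
    then have "cmod (1 - of_real (s n) * z) \<le> (1 - s n) + s n * cmod (1 - z)"
      using norm_triangle_ineq[of "of_real (1 - s n)" "of_real (s n) * (1 - z)"] s
      by (simp add: norm_mult del: of_real_diff)
    also have "\<dots> < \<sigma> * (1 - s n) + s n * (\<sigma> * (1 - cmod z))"
      using s z \<sigma> mult_strict_right_mono[of 1 \<sigma> "1 - s n"] by (intro add_less_le_mono mult_left_mono) auto
    also have "\<dots> = \<sigma> * (1 - s n * cmod z)" by (simp add: algebra_simps)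
    finally have "cmod (1 - of_real (s n) * z) < \<sigma> * (1 - s n * cmod z)" .
    moreover have "s n * cmod z < 1"
      using s z1 mult_left_mono[of "cmod z" 1 "s n"] by auto
    ultimately show ?thesis by (simp add: stolz_iff n)
  qed
  moreover have "(\<lambda>n. of_real (s n) * z) \<longlonglongrightarrow> z"
  proof -
    have "s \<longlonglongrightarrow> 1 - 0" unfolding s_def by (intro tendsto_intros LIMSEQ_inverse_real_of_nat)
    then have "(\<lambda>n. complex_of_real (s n) * z) \<longlonglongrightarrow> of_real (1 - 0) * z" by (intro tendsto_intros)
    then show ?thesis by simp
  qed
  ultimately show ?thesis
    unfolding closure_sequential by (intro exI[of _ "\<lambda>n. of_real (s n) * z"] conjI allI)
qed

section \<open>Stolz type is inherited\<close>

text \<open>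
  The calculus for \<open>B = 1 - T\<close> on any domain inside a Stolz domain of opening \<open>1 / k\<close>. The outer curve is
  left open: a limacon is used for the resolvent bounds, a small circle for the limiting Stolz type.
\<close>

lemma keyhole_calculus_one_minus:
  fixes T :: "'a::complex_banach \<Rightarrow>\<^sub>L 'a"
  assumes contour: "keyhole_contour \<beta> u0 L1 \<eta> \<eta>'" and T: "T \<in> cbounded_ops"
    and res: "\<And>\<mu>. \<mu> \<in> good \<Longrightarrow> 1 - \<mu> \<notin> op_spectrum T"
    and C: "\<And>\<mu>. \<mu> \<in> good \<Longrightarrow> cmod \<mu> * norm (resolvent (1 - \<mu>) T) \<le> C"
    and "0 \<notin> good"
    and "\<And>u \<theta>. \<theta> \<in> {\<beta>..2*pi-\<beta>} \<Longrightarrow> exp (log_polar u \<theta>) \<in> good"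
    and "\<And>u \<theta>. \<bar>\<theta>\<bar> \<le> \<beta> \<Longrightarrow> \<eta> \<theta> \<le> u \<Longrightarrow> exp (log_polar u \<theta>) \<in> good"
    and k: "0 < k" "k < 1"
    and inner: "\<And>u \<theta>. \<bar>\<theta>\<bar> \<le> \<beta> \<Longrightarrow> u \<le> \<eta> \<theta> \<Longrightarrow> exp u * (1 - k\<^sup>2) \<le> 2 * (cos \<theta> - k)"
  shows "keyhole_calculus \<beta> u0 L1 \<eta> \<eta>' (id_blinfun - T) (\<lambda>\<mu>. - resolvent (1 - \<mu>) T) C good
      T id (\<lambda>\<mu>. 1 - \<mu>) (\<lambda>_. 1) UNIV k 2"
    and "\<And>\<mu>. \<mu> \<in> keyhole_contour.inner_region \<beta> \<eta> \<Longrightarrow> k * cmod \<mu> \<le> 1 - cmod (1 - \<mu>)"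
proof -
  interpret keyhole_contour \<beta> u0 L1 \<eta> \<eta>' by (rule contour)
  have inv: "is_op_inverse (scalar_op (1 - \<mu>) - T) (resolvent (1 - \<mu>) T)" if "\<mu> \<in> good" for \<mu>
    by (rule resolvent_is_op_inverse[OF res[OF that]])
  have lin: "resolvent (1 - \<mu>) T \<in> cbounded_ops" if "\<mu> \<in> good" for \<mu>
    using inv[OF that] by (simp add: is_op_inverse_def)
  have left: "(resolvent (1 - \<mu>) T) (T x) = (1 - \<mu>) *\<^sub>C (resolvent (1 - \<mu>) T) x - x"
    if "\<mu> \<in> good" for \<mu> x
    using is_op_inverse_apply(2)[OF inv[OF that], of x]
    by (simp add: blinfun.diff_left blinfun.diff_right cbounded_ops_scaleC[OF lin[OF that]] algebra_simps)
  have right: "T ((resolvent (1 - \<mu>) T) x) = (1 - \<mu>) *\<^sub>C (resolvent (1 - \<mu>) T) x - x"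
    if "\<mu> \<in> good" for \<mu> x
    using is_op_inverse_apply(1)[OF inv[OF that], of x] by (simp add: blinfun.diff_left algebra_simps)
  interpret keyhole_resolvent \<beta> u0 L1 \<eta> \<eta>' "id_blinfun - T" "\<lambda>\<mu>. - resolvent (1 - \<mu>) T" C good
  proof
    show "id_blinfun - T \<in> cbounded_ops"
      using T by (simp add: cbounded_ops_def blinfun.diff_left scaleC_diff_right)
    show "is_op_inverse (scalar_op \<mu> - (id_blinfun - T)) (- resolvent (1 - \<mu>) T)" if \<mu>: "\<mu> \<in> good" for \<mu>
    proof (rule is_op_inverseI)
      show "- resolvent (1 - \<mu>) T \<in> cbounded_ops"
        using lin[OF \<mu>] by (simp add: cbounded_ops_def blinfun.minus_left scaleC_minus_right)
    qed (simp_all add: blinfun.minus_left blinfun.minus_right blinfun.diff_left blinfun.diff_right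
        blinfun.add_right left[OF \<mu>] right[OF \<mu>] cbounded_ops_scaleC[OF lin[OF \<mu>]] scaleC_diff_left scaleC_minus_right)
  qed (use assms in auto)
  have inner': "cmod (1 - exp (log_polar u \<theta>)) \<le> 1 - k * exp u" if "\<bar>\<theta>\<bar> \<le> \<beta>" "u \<le> \<eta> \<theta>" for u \<theta>
    unfolding exp_log_polar using norm_one_minus_polar_le[OF _ k inner[OF that]] by simp
  show reg: "\<And>\<mu>. \<mu> \<in> inner_region \<Longrightarrow> k * cmod \<mu> \<le> 1 - cmod (1 - \<mu>)"
    unfolding inner_region_def using inner' by (force simp: norm_exp_log_polar simp del: exp_add)
  show "keyhole_calculus \<beta> u0 L1 \<eta> \<eta>' (id_blinfun - T) (\<lambda>\<mu>. - resolvent (1 - \<mu>) T) C good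
      T id (\<lambda>\<mu>. 1 - \<mu>) (\<lambda>_. 1) UNIV k 2"
  proof unfold_locales
    show "cmod (1 - \<mu>) \<le> 1" if "\<mu> \<in> inner_region" for \<mu>
      using reg[OF that] k by (smt (verit) mult_nonneg_nonneg norm_ge_zero)
    show "cmod (1 - exp (log_polar t \<theta>)) \<le> 1 - k * exp t" if "t \<le> u0" "\<theta> \<in> {\<beta>, 0, -\<beta>}" for t \<theta>
      using that \<beta> \<eta>_ends \<eta>_center by (intro inner') auto
    show "cmod (1 - exp (log_polar t \<theta>) - (1 - complex_of_real (exp t))) \<le> 2 * exp t" for t \<theta>
      using norm_triangle_ineq4[of "complex_of_real (exp t)" "exp (log_polar t \<theta>)"] norm_exp_log_polar[of t \<theta>]
      by simp
    show "cmod (deriv ((-) 1) (complex_of_real (exp t))) \<le> 2" for t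
      by (subst DERIV_imp_deriv[of _ "-1"]) (auto intro!: derivative_eq_intros)
  qed (use T k left right in \<open>auto intro!: holomorphic_intros simp: blinfun.minus_left blinfun.minus_right scaleC_minus_right\<close>)
qed

text \<open>
  The contour has to leave room on both sides. Its rays lie on the boundary directions of \<open>stolz \<delta>0\<close>,
  outside of which the resolvent of \<open>T\<close> is bounded; its outer curve bounds the larger \<open>stolz \<delta>1\<close>, which is
  invariant under convex combinations of powers and separated from the complement of \<open>stolz \<delta>\<close>. The rays
  meet the outer curve at positive distance from the vertex because \<open>\<delta>0 < \<delta>1\<close>.
\<close>

lemma stolz_power_series_resolvent:
  fixes T :: "'a::complex_banach \<Rightarrow>\<^sub>L 'a"
  assumes a: "\<And>n. 0 \<le> a n" "a sums 1" and \<sigma>: "1 \<le> \<sigma>" and T: "ritt_stolz_type \<sigma> T" and \<delta>: "\<sigma> < \<delta>"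
  shows "power_series_op a T \<in> cbounded_ops"
    and "\<exists>C. \<forall>z. z \<notin> stolz \<delta> \<longrightarrow> z \<notin> op_spectrum (power_series_op a T) \<and>
        norm (scalar_op (1 - z) o\<^sub>L resolvent z (power_series_op a T)) \<le> C"
proof -
  define \<delta>0 \<delta>1 where "\<delta>0 = (2 * \<sigma> + \<delta>) / 3" and "\<delta>1 = (\<sigma> + 2 * \<delta>) / 3"
  have \<delta>s: "\<sigma> < \<delta>0" "\<delta>0 < \<delta>1" "\<delta>1 < \<delta>" "1 < \<delta>0" using \<sigma> \<delta> by (auto simp: \<delta>0_def \<delta>1_def)
  define k0 k1 where "k0 = 1 / \<delta>0" and "k1 = 1 / \<delta>1"
  have k: "0 < k1" "k1 < k0" "k0 < 1" "1 / \<delta> < k1"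
    using \<delta>s by (auto simp: k0_def k1_def field_simps)
  \<comment> \<open>At its vertex a Stolz domain of opening \<open>\<delta>0\<close> has half-angle \<open>arccos (1 / \<delta>0)\<close>.\<close>
  define \<beta> where "\<beta> = arccos k0"
  have \<beta>: "0 < \<beta>" "\<beta> < pi" and cos\<beta>: "cos \<beta> = k0"
    using k arccos_lt_bounded[of k0] by (auto simp: \<beta>_def)
  have cos_ge: "k0 \<le> cos \<theta>" if "\<bar>\<theta>\<bar> \<le> \<beta>" for \<theta>
    using cos_ge_in_sector[OF that] \<beta> cos\<beta> by simp
  have cos_le: "cos \<theta> \<le> k0" if "\<theta> \<in> {\<beta>..2*pi-\<beta>}" for \<theta>
    using cos_le_off_sector[OF that] \<beta> cos\<beta> by simp
  define w where "w = 1 - k1\<^sup>2"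
  have w: "0 < w" using k by (simp add: w_def abs_square_less_1)
  define \<eta> \<eta>' where "\<eta> = (\<lambda>\<theta>. ln (2 * (cos \<theta> - k1) / w))" and "\<eta>' = (\<lambda>\<theta>. - sin \<theta> / (cos \<theta> - k1))"
  have exp\<eta>: "exp (\<eta> \<theta>) * w = 2 * (cos \<theta> - k1)" if "\<bar>\<theta>\<bar> \<le> \<beta>" for \<theta>
    using cos_ge[OF that] k w by (simp add: \<eta>_def)
  have contour: "keyhole_contour \<beta> (\<eta> \<beta>) (1 / (k0 - k1)) \<eta> \<eta>'"
  proof
    fix t assume "t \<in> {-\<beta>..\<beta>}"
    then have t: "k0 \<le> cos t" by (intro cos_ge) auto
    show "(\<eta> has_real_derivative \<eta>' t) (at t within {-\<beta>..\<beta>})"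
      unfolding \<eta>_def \<eta>'_def using t k w by (auto intro!: derivative_eq_intros simp: field_simps)
    have "\<bar>\<eta>' t\<bar> = \<bar>sin t\<bar> / (cos t - k1)" using t k by (simp add: \<eta>'_def abs_divide)
    also have "\<dots> \<le> 1 / (k0 - k1)" using t k by (intro frac_le) auto
    finally show "\<bar>\<eta>' t\<bar> \<le> 1 / (k0 - k1)" .
  next
    have "cos \<theta> - k1 \<noteq> 0" if "\<theta> \<in> {-\<beta>..\<beta>}" for \<theta>
    proof -
      have "\<bar>\<theta>\<bar> \<le> \<beta>" using that by auto
      then show ?thesis using cos_ge[of \<theta>] k by simp
    qed
    then show "continuous_on {-\<beta>..\<beta>} \<eta>'" unfolding \<eta>'_def
      by (intro continuous_intros) auto
    show "\<eta> (-\<beta>) = \<eta> \<beta>" by (simp add: \<eta>_def)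
    have "2 * (k0 - k1) / w \<le> 2 * (1 - k1) / w" using k w by (intro divide_right_mono) auto
    then show "\<eta> \<beta> \<le> \<eta> 0" using k w by (simp add: \<eta>_def cos\<beta>)
  qed (use \<beta> in auto)
  from T \<delta>s obtain C where C: "\<And>z. z \<notin> stolz \<delta>0 \<Longrightarrow> z \<notin> op_spectrum T"
      "\<And>z. z \<notin> stolz \<delta>0 \<Longrightarrow> cmod (1 - z) * norm (resolvent z T) \<le> C"
    unfolding ritt_stolz_type_def norm_scalar_op_compose by blast
  have T': "T \<in> cbounded_ops" using T by (simp add: ritt_stolz_type_def)
  define good where "good = {\<mu>. 1 - \<mu> \<notin> stolz \<delta>0}"
  note calc = keyhole_calculus_one_minus[OF contour T', of good C k1]
  have good: "0 \<notin> good" "\<mu> \<in> good \<Longrightarrow> 1 - \<mu> \<notin> op_spectrum T"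
    "\<mu> \<in> good \<Longrightarrow> cmod \<mu> * norm (resolvent (1 - \<mu>) T) \<le> C" for \<mu>
    using C(1)[of "1 - \<mu>"] C(2)[of "1 - \<mu>"] by (auto simp: good_def stolz_iff)
  have sector: "exp (log_polar u \<theta>) \<in> good" if "\<theta> \<in> {\<beta>..2*pi-\<beta>}" for u \<theta>
  proof (rule ccontr)
    assume "exp (log_polar u \<theta>) \<notin> good"
    then have "1 - of_real (exp u) * cis \<theta> \<in> stolz (1 / k0)" by (simp add: good_def exp_log_polar k0_def del: exp_add)
    from stolz_polarD[OF _ _ this] k have "exp u * (1 - k0\<^sup>2) < 2 * (cos \<theta> - k0)" by simp
    moreover have "0 \<le> exp u * (1 - k0\<^sup>2)" using k by (auto simp: power_le_one)
    ultimately show False using cos_le[OF that] by simp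
  qed
  have outside: "exp (log_polar u \<theta>) \<in> good" if "\<bar>\<theta>\<bar> \<le> \<beta>" "\<eta> \<theta> \<le> u" for u \<theta>
  proof (rule ccontr)
    assume "exp (log_polar u \<theta>) \<notin> good"
    then have "1 - of_real (exp u) * cis \<theta> \<in> stolz \<delta>0" by (simp add: good_def exp_log_polar del: exp_add)
    then have "1 - of_real (exp u) * cis \<theta> \<in> stolz (1 / k1)" using stolz_mono[of \<delta>0 \<delta>1] \<delta>s by (auto simp: k1_def)
    from stolz_polarD[OF _ _ this] k have "exp u * w < exp (\<eta> \<theta>) * w"
      unfolding exp\<eta>[OF that(1)] by (simp add: w_def)
    then show False using that(2) w by simp
  qed
  have inner: "exp u * (1 - k1\<^sup>2) \<le> 2 * (cos \<theta> - k1)" if "\<bar>\<theta>\<bar> \<le> \<beta>" "u \<le> \<eta> \<theta>" for u \<theta>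
  proof -
    have "exp u * w \<le> exp (\<eta> \<theta>) * w" using that(2) w by simp
    then show ?thesis unfolding exp\<eta>[OF that(1)] by (simp add: w_def)
  qed
  have k1: "k1 < 1" using k by simp
  interpret keyhole_calculus \<beta> "\<eta> \<beta>" "1 / (k0 - k1)" \<eta> \<eta>' "id_blinfun - T" "\<lambda>\<mu>. - resolvent (1 - \<mu>) T" C good
      T id "\<lambda>\<mu>. 1 - \<mu>" "\<lambda>_. 1" UNIV k1 2
    by (rule calc(1)[OF good(2,3,1) sector outside k(1) k1 inner])
  have region: "k1 * cmod \<mu> \<le> 1 - cmod (1 - \<mu>)" if "\<mu> \<in> inner_region" for \<mu>
    by (rule calc(2)[OF good(2,3,1) sector outside k(1) k1 inner that])
  show "power_series_op a T \<in> cbounded_ops" by (rule power_series_in_cbounded_ops[OF a])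
  define c where "c = (k1 - 1 / \<delta>) / 2"
  have c: "0 < c" using k by (simp add: c_def)
  show "\<exists>C. \<forall>z. z \<notin> stolz \<delta> \<longrightarrow> z \<notin> op_spectrum (power_series_op a T) \<and>
        norm (scalar_op (1 - z) o\<^sub>L resolvent z (power_series_op a T)) \<le> C"
  proof (intro exI allI impI)
    fix z assume z: "z \<notin> stolz \<delta>"
    have z1: "z \<noteq> 1" using z by (auto simp: stolz_iff)
    have sep: "c * cmod (1 - z) \<le> cmod (z - cpoly (trunc_weights a N) N (1 - \<mu>))" if "\<mu> \<in> inner_region" for N \<mu>
      unfolding c_def using region[OF that] \<delta> \<sigma> k
      by (intro stolz_separation[OF z] stolz_cpoly[OF convex_trunc_weights[OF a]]) auto
    from power_series_resolvent[OF a c z1 sep] z1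
    show "z \<notin> op_spectrum (power_series_op a T) \<and>
        norm (scalar_op (1 - z) o\<^sub>L resolvent z (power_series_op a T)) \<le> resolvent_const c"
      by (simp add: norm_scalar_op_compose pos_le_divide_eq mult.commute)
  qed
qed

section \<open>The spectrum in the limiting case of Stolz type one\<close>

text \<open>
  By the resolvent identity \<open>\<parallel>R(w)\<parallel> \<le> 2 \<parallel>R(z)\<parallel>\<close> for all regular \<open>w\<close> with \<open>|z - w| \<parallel>R(z)\<parallel> \<le> 1/2\<close>, which gives
  local bounds.
\<close>

lemma resolvent_bounded_on_compact:
  fixes T :: "'a::complex_banach \<Rightarrow>\<^sub>L 'a"
  assumes K: "compact K" and disj: "K \<inter> op_spectrum T = {}"
  obtains M where "\<And>z. z \<in> K \<Longrightarrow> norm (resolvent z T) \<le> M"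
proof -
  define n where "n = (\<lambda>z. norm (resolvent z T))"
  define D where "D = (\<lambda>z. ball z (1 / (2 * (n z + 1))))"
  have n0: "0 \<le> n z" for z by (simp add: n_def)
  have inv: "is_op_inverse (scalar_op z - T) (resolvent z T)" if "z \<in> K" for z
    using that disj by (intro resolvent_is_op_inverse) auto
  obtain Z where Z: "Z \<subseteq> K" "finite Z" "K \<subseteq> (\<Union>z\<in>Z. D z)"
  proof (rule compactE_image[OF K, of K D])
    have "0 < 1 / (2 * (n z + 1))" for z using n0[of z] by (simp add: add_nonneg_pos)
    then show "K \<subseteq> (\<Union>z\<in>K. D z)" by (auto simp: D_def)
  qed (auto simp: D_def)
  show thesis
  proof
    fix w assume w: "w \<in> K"
    then obtain z where z: "z \<in> Z" "w \<in> D z" using Z by auto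
    have "norm (resolvent w T - resolvent z T) \<le> cmod (z - w) * n w * n z"
      unfolding n_def by (rule norm_resolvent_diff_le[OF inv inv]) (use Z z w in auto)
    moreover have "cmod (z - w) * (2 * (n z + 1)) \<le> 1"
    proof -
      have "cmod (z - w) < 1 / (2 * (n z + 1))" using z by (simp add: D_def dist_norm)
      moreover have "0 < 2 * (n z + 1)" using n0[of z] by simp
      ultimately show ?thesis by (simp add: pos_less_divide_eq less_imp_le)
    qed
    then have "2 * (cmod (z - w) * n z) \<le> 1"
      using norm_ge_zero[of "z - w"] unfolding distrib_left by linarith
    then have "cmod (z - w) * n z * n w \<le> 1 / 2 * n w"
      using n0 by (intro mult_right_mono) auto
    ultimately have "norm (resolvent w T - resolvent z T) \<le> 1 / 2 * n w" by (simp add: mult_ac)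
    moreover have "n w \<le> n z + norm (resolvent w T - resolvent z T)"
      unfolding n_def by (rule norm_triangle_sub)
    ultimately have "n w \<le> 2 * n z" by simp
    also have "\<dots> \<le> (\<Sum>z\<in>Z. 2 * n z)"
      using Z z n0 by (intro member_le_sum) auto
    finally show "norm (resolvent w T) \<le> (\<Sum>z\<in>Z. 2 * n z)" by (simp add: n_def)
  qed
qed

lemma norm_one_minus_power_le:
  fixes \<zeta> :: complex
  assumes "cmod \<zeta> \<le> 1"
  shows "cmod (1 - \<zeta> ^ n) \<le> real n * cmod (1 - \<zeta>)" "cmod (1 - \<zeta> ^ n) \<le> 2"
proof -
  show "cmod (1 - \<zeta> ^ n) \<le> real n * cmod (1 - \<zeta>)"
    using norm_power_diff_le[of 1 1 \<zeta> n] assms by (simp add: mult.commute)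
  have "cmod (\<zeta> ^ n) \<le> 1" using assms by (simp add: norm_power power_le_one)
  then show "cmod (1 - \<zeta> ^ n) \<le> 2" using norm_triangle_ineq4[of 1 "\<zeta> ^ n"] by simp
qed

text \<open>
  Continuity at \<open>1\<close> of the generating function, uniformly over all truncations: only the powers up to some
  \<open>M\<close> matter, as the remaining weights have small total mass.
\<close>

lemma trunc_cpoly_near_one:
  assumes a: "\<And>n. 0 \<le> a n" "a sums 1" and h: "0 < h"
  obtains e where "0 < e"
    "\<And>N \<zeta>. cmod \<zeta> \<le> 1 \<Longrightarrow> cmod (1 - \<zeta>) \<le> e \<Longrightarrow> cmod (1 - cpoly (trunc_weights a N) N \<zeta>) \<le> h"
proof -
  have "(\<lambda>M. \<Sum>n\<le>M. a n) \<longlonglongrightarrow> 1" using a(2) by (simp add: sums_def_le)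
  then have "\<forall>\<^sub>F M in sequentially. 1 - h / 4 < (\<Sum>n\<le>M. a n)"
    by (rule order_tendstoD) (use h in simp)
  then obtain M where M: "1 - h / 4 < (\<Sum>n\<le>M. a n)"
    by (auto simp: eventually_sequentially)
  define e where "e = h / (2 * (real M + 1))"
  have e: "0 < e" "real M * e \<le> h / 2"
    using h by (auto simp: e_def field_simps add_pos_nonneg)
  show thesis
  proof (rule that[OF e(1)])
    fix N and \<zeta> :: complex assume \<zeta>: "cmod \<zeta> \<le> 1" "cmod (1 - \<zeta>) \<le> e"
    have summand: "trunc_weights a N n * cmod (1 - \<zeta> ^ n) \<le> a n * (h / 2) + (if M < n then a n * 2 else 0)" for n
    proof (cases "n = 0")
      case False
      have "cmod (1 - \<zeta> ^ n) \<le> h / 2 + (if M < n then 2 else 0)"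
      proof (cases "M < n")
        case True then show ?thesis using norm_one_minus_power_le(2)[OF \<zeta>(1), of n] h by simp
      next
        case n: False
        have "real n * cmod (1 - \<zeta>) \<le> real M * e" using n \<zeta> by (intro mult_mono) auto
        then show ?thesis using norm_one_minus_power_le(1)[OF \<zeta>(1), of n] e n by simp
      qed
      from mult_left_mono[OF this a(1)[of n]] show ?thesis
        using False by (auto simp: trunc_weights_def algebra_simps split: if_splits)
    qed (use a(1)[of 0] h in simp)
    have tail: "(\<Sum>n\<le>N. if M < n then a n * 2 else 0) \<le> h / 2"
    proof (cases "M \<le> N")
      case True
      have "(\<Sum>n\<le>N. if M < n then a n * 2 else 0) = (\<Sum>n\<in>{..N} - {..M}. a n * 2)"
        by (rule sum.mono_neutral_cong_right) auto
      also have "\<dots> = 2 * ((\<Sum>n\<le>N. a n) - (\<Sum>n\<le>M. a n))"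
        using True by (subst sum_diff) (auto simp flip: sum_distrib_right)
      also have "\<dots> \<le> 2 * (1 - (1 - h / 4))" using sum_le_one[OF a, of N] M by simp
      finally show ?thesis by simp
    next
      case False
      then have "(\<Sum>n\<le>N. if M < n then a n * 2 else 0) = 0" by (intro sum.neutral) auto
      then show ?thesis using h by simp
    qed
    have d: "convex_weights (trunc_weights a N) N" by (rule convex_trunc_weights[OF a])
    have "cmod (1 - cpoly (trunc_weights a N) N \<zeta>) \<le> (\<Sum>n\<le>N. trunc_weights a N n * cmod (1 - \<zeta> ^ n))"
      unfolding one_minus_cpoly[OF d] using d
      by (intro sum_norm_le) (auto simp: norm_mult convex_weights_def)
    also have "\<dots> \<le> (\<Sum>n\<le>N. a n * (h / 2) + (if M < n then a n * 2 else 0))"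
      by (intro sum_mono summand)
    also have "\<dots> = (\<Sum>n\<le>N. a n) * (h / 2) + (\<Sum>n\<le>N. if M < n then a n * 2 else 0)"
      by (simp add: sum.distrib sum_distrib_right)
    also have "\<dots> \<le> 1 * (h / 2) + h / 2"
      using sum_le_one[OF a, of N] h tail by (intro add_mono mult_right_mono) auto
    finally show "cmod (1 - cpoly (trunc_weights a N) N \<zeta>) \<le> h" by simp
  qed
qed

text \<open>
  Once the spectrum of \<open>T\<close> is in \<open>{1}\<close>, the outer curve can be a circle around \<open>1\<close> of any small radius: on
  the rest of the disc the resolvent is bounded by compactness. The opening \<open>3/2\<close> of the rays and the larger
  opening \<open>2\<close> are arbitrary; radius \<open>4/9\<close> is where a ray of the former leaves the latter.
\<close>

lemma spectrum_stolz_type_one: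
  fixes T :: "'a::complex_banach \<Rightarrow>\<^sub>L 'a"
  assumes a: "\<And>n. 0 \<le> a n" "a sums 1" and T: "ritt_stolz_type 1 T"
  shows "op_spectrum (power_series_op a T) \<subseteq> {1}"
proof
  fix z assume z: "z \<in> op_spectrum (power_series_op a T)"
  show "z \<in> {1}"
  proof (rule ccontr)
    assume "z \<notin> {1}"
    then have z1: "z \<noteq> 1" by simp
    obtain e where e: "0 < e" "\<And>N \<zeta>. cmod \<zeta> \<le> 1 \<Longrightarrow> cmod (1 - \<zeta>) \<le> e \<Longrightarrow>
        cmod (1 - cpoly (trunc_weights a N) N \<zeta>) \<le> cmod (1 - z) / 2"
      using trunc_cpoly_near_one[OF a, of "cmod (1 - z) / 2"] z1 by auto
    define r where "r = min e (4 / 9)"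
    have r: "0 < r" "r \<le> e" "r \<le> 4 / 9" using e by (auto simp: r_def)
    have "stolz 1 = {1}"
    proof -
      have "\<not> cmod (1 - w) < 1 * (1 - cmod w)" for w
        using norm_triangle_ineq2[of 1 w] by simp
      then show ?thesis by (auto simp: stolz_iff)
    qed
    then have spec: "op_spectrum T \<subseteq> {1}" using T by (simp add: ritt_stolz_type_def)
    have T': "T \<in> cbounded_ops" using T by (simp add: ritt_stolz_type_def)
    have "\<exists>C. \<forall>w. w \<notin> stolz (3 / 2) \<longrightarrow> w \<notin> op_spectrum T \<and> norm (scalar_op (1 - w) o\<^sub>L resolvent w T) \<le> C"
      using T unfolding ritt_stolz_type_def by simp
    then obtain C1 where C1: "\<And>w. w \<notin> stolz (3 / 2) \<Longrightarrow> cmod (1 - w) * norm (resolvent w T) \<le> C1"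
      unfolding norm_scalar_op_compose by blast
    define K where "K = cball 0 1 \<inter> {w. r \<le> cmod (1 - w)}"
    have "compact K"
      unfolding K_def by (intro compact_Int_closed closed_Collect_le continuous_intros compact_cball)
    moreover have "K \<inter> op_spectrum T = {}" using spec r by (auto simp: K_def)
    ultimately obtain M where M: "\<And>w. w \<in> K \<Longrightarrow> norm (resolvent w T) \<le> M"
      using resolvent_bounded_on_compact by blast
    define C where "C = max C1 (2 * M)"
    define good where "good = {\<mu>. r \<le> cmod \<mu> \<or> 1 - \<mu> \<notin> stolz (3 / 2)}"
    have good: "0 \<notin> good" "\<mu> \<in> good \<Longrightarrow> 1 - \<mu> \<notin> op_spectrum T" for \<mu>
      using r spec by (auto simp: good_def stolz_iff)
    have goodC: "cmod \<mu> * norm (resolvent (1 - \<mu>) T) \<le> C" if "\<mu> \<in> good" for \<mu>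
    proof (cases "1 - \<mu> \<in> stolz (3 / 2)")
      case False
      then show ?thesis using C1[of "1 - \<mu>"] by (simp add: C_def)
    next
      case True
      then have r\<mu>: "r \<le> cmod \<mu>" using that by (simp add: good_def)
      then have "\<mu> \<noteq> 0" using r by auto
      then have le: "cmod (1 - \<mu>) \<le> 1" using True by (auto simp: stolz_iff)
      then have "norm (resolvent (1 - \<mu>) T) \<le> M" using r\<mu> by (intro M) (simp add: K_def)
      moreover have "cmod \<mu> \<le> 2" using le norm_triangle_ineq4[of 1 "1 - \<mu>"] by simp
      ultimately have "cmod \<mu> * norm (resolvent (1 - \<mu>) T) \<le> 2 * M" by (intro mult_mono) auto
      then show ?thesis by (simp add: C_def)
    qed
    define \<beta> where "\<beta> = arccos (2 / 3)"
    have \<beta>: "0 < \<beta>" "\<beta> < pi" and cos\<beta>: "cos \<beta> = 2 / 3"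
      using arccos_lt_bounded[of "2/3"] by (auto simp: \<beta>_def)
    have contour: "keyhole_contour \<beta> (ln r) 0 (\<lambda>_. ln r) (\<lambda>_. 0)"
      by unfold_locales (use \<beta> in auto)
    have sector: "exp (log_polar u \<theta>) \<in> good" if "\<theta> \<in> {\<beta>..2*pi-\<beta>}" for u \<theta>
    proof -
      have "1 - of_real (exp u) * cis \<theta> \<notin> stolz (1 / (2 / 3))"
      proof
        assume "1 - of_real (exp u) * cis \<theta> \<in> stolz (1 / (2 / 3))"
        from stolz_polarD[OF _ _ this] have "exp u * (1 - (2 / 3)\<^sup>2) < 2 * (cos \<theta> - 2 / 3)" by simp
        moreover have "0 < exp u * (1 - (2 / 3)\<^sup>2)" by (simp add: power2_eq_square)
        ultimately show False using cos_le_off_sector[OF that] \<beta> cos\<beta> by simp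
      qed
      then show ?thesis by (simp add: good_def exp_log_polar del: exp_add)
    qed
    have outside: "exp (log_polar u \<theta>) \<in> good" if "\<bar>\<theta>\<bar> \<le> \<beta>" "ln r \<le> u" for u \<theta>
    proof -
      have "r \<le> exp u" using that(2) r by (metis exp_le_cancel_iff exp_ln)
      then show ?thesis by (simp add: good_def norm_exp_log_polar del: exp_add)
    qed
    have inner: "exp u * (1 - (1 / 2)\<^sup>2) \<le> 2 * (cos \<theta> - 1 / 2)" if "\<bar>\<theta>\<bar> \<le> \<beta>" "u \<le> ln r" for u \<theta>
    proof -
      have "exp u \<le> r" using that(2) r by (metis exp_le_cancel_iff exp_ln)
      then have "exp u \<le> 4 / 9" using r by simp
      then show ?thesis using cos_ge_in_sector[OF that(1)] \<beta> cos\<beta> by (simp add: power2_eq_square)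
    qed
    have half: "0 < (1 / 2 :: real)" "(1 / 2 :: real) < 1" by auto
    note calc = keyhole_calculus_one_minus[OF contour T' good(2) goodC good(1) sector outside half inner]
    interpret keyhole_calculus \<beta> "ln r" 0 "\<lambda>_. ln r" "\<lambda>_. 0" "id_blinfun - T" "\<lambda>\<mu>. - resolvent (1 - \<mu>) T" C good
        T id "\<lambda>\<mu>. 1 - \<mu>" "\<lambda>_. 1" UNIV "1 / 2" 2
      by (rule calc(1))
    have "1 / 2 * cmod (1 - z) \<le> cmod (z - cpoly (trunc_weights a N) N (1 - \<mu>))" if \<mu>: "\<mu> \<in> inner_region" for N \<mu>
    proof -
      from \<mu> obtain u \<theta> where "\<mu> = exp (log_polar u \<theta>)" "u \<le> ln r"
        unfolding inner_region_def by blast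
      then have "cmod \<mu> \<le> r" using r norm_exp_log_polar[of u \<theta>] by (metis exp_le_cancel_iff exp_ln)
      then have "cmod (1 - cpoly (trunc_weights a N) N (1 - \<mu>)) \<le> cmod (1 - z) / 2"
        using r \<phi>_inner_region[OF \<mu>] by (intro e) auto
      then show ?thesis
        using norm_triangle_ineq4[of "1 - cpoly (trunc_weights a N) N (1 - \<mu>)" "z - cpoly (trunc_weights a N) N (1 - \<mu>)"]
        by simp
    qed
    from power_series_resolvent(1)[OF a _ z1 this] z show False by simp
  qed
qed

lemma stolz_type_power_series:
  fixes T :: "'a::complex_banach \<Rightarrow>\<^sub>L 'a"
  assumes a: "\<And>n. 0 \<le> a n" "a sums 1" and \<sigma>: "1 \<le> \<sigma>" and T: "ritt_stolz_type \<sigma> T"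
  shows "ritt_stolz_type \<sigma> (power_series_op a T)"
  unfolding ritt_stolz_type_def
proof (intro conjI allI impI)
  show "power_series_op a T \<in> cbounded_ops"
    using stolz_power_series_resolvent(1)[OF a \<sigma> T, of "\<sigma> + 1"] by simp
  show "\<exists>C. \<forall>z. z \<notin> stolz \<delta> \<longrightarrow> z \<notin> op_spectrum (power_series_op a T) \<and>
        norm (scalar_op (1 - z) o\<^sub>L resolvent z (power_series_op a T)) \<le> C" if "\<sigma> < \<delta>" for \<delta>
    using stolz_power_series_resolvent(2)[OF a \<sigma> T that] .
  show "op_spectrum (power_series_op a T) \<subseteq> closure (stolz \<sigma>)"
  proof (cases "\<sigma> = 1")
    case True
    have "{1} \<subseteq> closure (stolz \<sigma>)" using closure_subset[of "stolz \<sigma>"] by (auto simp: stolz_iff)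
    then show ?thesis using spectrum_stolz_type_one[OF a] T True by blast
  next
    case False
    then have \<sigma>1: "1 < \<sigma>" using \<sigma> by simp
    show ?thesis
    proof
      fix z assume z: "z \<in> op_spectrum (power_series_op a T)"
      have in_stolz: "z \<in> stolz \<delta>" if "\<sigma> < \<delta>" for \<delta>
        using stolz_power_series_resolvent(2)[OF a \<sigma> T that] z by blast
      show "z \<in> closure (stolz \<sigma>)"
      proof (rule closed_stolz_subset[OF \<sigma>1])
        show "cmod (1 - z) \<le> \<sigma> * (1 - cmod z)"
        proof (rule field_le_epsilon)
          fix e :: real assume e: "0 < e"
          have "cmod (1 - z) \<le> (\<sigma> + e) * (1 - cmod z)"
            using in_stolz[of "\<sigma> + e"] e by (auto simp: stolz_iff)
          also have "\<dots> \<le> \<sigma> * (1 - cmod z) + e * 1"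
            using e unfolding distrib_right by (intro add_left_mono mult_left_mono) auto
          finally show "cmod (1 - z) \<le> \<sigma> * (1 - cmod z) + e" by simp
        qed
      qed
    qed
  qed
qed

section \<open>Sectors and lenses\<close>

lemma closure_sector_subset:
  assumes "0 < \<omega>" "\<omega> < pi" "w \<in> closure (sector \<omega>)"
  shows "cmod w * cos \<omega> \<le> Re w"
proof -
  have "sector \<omega> \<subseteq> {w. cmod w * cos \<omega> \<le> Re w}"
  proof
    fix v assume "v \<in> sector \<omega>"
    then have v: "\<bar>Arg v\<bar> < \<omega>" using assms by (auto simp: sector_def)
    have "cos \<omega> \<le> cos (Arg v)" using cos_ge_in_sector[of "Arg v" \<omega>] v assms by simp
    then have "cmod v * cos \<omega> \<le> cmod v * cos (Arg v)" by (intro mult_left_mono) auto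
    also have "\<dots> = Re v" using rcis_cmod_Arg[of v] by (metis Re_rcis)
    finally show "v \<in> {w. cmod w * cos \<omega> \<le> Re w}" by simp
  qed
  moreover have "closed {w. cmod w * cos \<omega> \<le> Re w}"
    by (intro closed_Collect_le continuous_intros)
  ultimately show ?thesis using closure_minimal assms(3) by blast
qed

lemma not_in_closure_sectorD:
  assumes "0 < \<omega>" "w \<notin> closure (sector \<omega>)"
  shows "w \<noteq> 0" "\<omega> \<le> \<bar>Arg w\<bar>"
proof -
  have "(0::complex) \<in> closure (sector \<omega>)"
    unfolding closure_approachable
  proof (intro allI impI)
    fix e :: real assume e: "0 < e"
    have "complex_of_real (e / 2) \<in> sector \<omega>"
      using e assms by (simp add: sector_def Arg_of_real del: of_real_divide)
    moreover have "dist (complex_of_real (e / 2)) 0 < e" using e by (simp add: norm_of_real del: of_real_divide)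
    ultimately show "\<exists>y\<in>sector \<omega>. dist y 0 < e" by blast
  qed
  then show "w \<noteq> 0" using assms by auto
  moreover have "w \<notin> sector \<omega>" using assms closure_subset by blast
  ultimately show "\<omega> \<le> \<bar>Arg w\<bar>" using assms by (auto simp: sector_def split: if_splits)
qed

text \<open>
  The distance to the sector is measured perpendicularly to its nearer edge. The minimum covers angles of
  \<open>a\<close> up to \<open>\<pi>\<close>, where the sine of the angle to that edge decreases again.
\<close>

lemma sector_separation:
  assumes \<beta>: "0 < \<beta>" "\<beta> < pi / 2" "\<beta> < \<omega>" and a: "\<omega> \<le> \<bar>Arg a\<bar>"
    and b: "cos \<beta> * \<bar>Im b\<bar> \<le> sin \<beta> * Re b"
  shows "min (sin (\<omega> - \<beta>)) (sin \<beta>) * cmod a \<le> cmod (a - b)"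
proof -
  have upper: "min (sin (\<omega> - \<beta>)) (sin \<beta>) * cmod a \<le> cmod (a - b)"
    if a: "\<omega> \<le> Arg a" and b: "cos \<beta> * \<bar>Im b\<bar> \<le> sin \<beta> * Re b" for a b
  proof -
    define \<alpha> where "\<alpha> = Arg a"
    have \<alpha>: "\<omega> \<le> \<alpha>" "\<alpha> \<le> pi" using a Arg_le_pi[of a] by (auto simp: \<alpha>_def)
    have "min (sin (\<omega> - \<beta>)) (sin \<beta>) \<le> sin (\<alpha> - \<beta>)"
    proof (cases "\<alpha> - \<beta> \<le> pi / 2")
      case True
      have "sin (\<omega> - \<beta>) \<le> sin (\<alpha> - \<beta>)"
        using True \<alpha> \<beta> by (intro sin_monotone_2pi_le) auto
      then show ?thesis by simp
    next
      case False
      have "sin \<beta> \<le> sin (pi - (\<alpha> - \<beta>))"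
        using False \<alpha> \<beta> by (intro sin_monotone_2pi_le) auto
      also have "\<dots> = sin (\<alpha> - \<beta>)" by (rule sin_pi_minus)
      finally show ?thesis by simp
    qed
    then have "min (sin (\<omega> - \<beta>)) (sin \<beta>) * cmod a \<le> sin (\<alpha> - \<beta>) * cmod a"
      by (intro mult_right_mono) auto
    also have "\<dots> = cos \<beta> * Im a - sin \<beta> * Re a"
    proof -
      have "Re a = cmod a * cos \<alpha>" "Im a = cmod a * sin \<alpha>"
        using rcis_cmod_Arg[of a] unfolding \<alpha>_def by (metis Re_rcis, metis Im_rcis)
      then show ?thesis by (simp add: sin_diff algebra_simps)
    qed
    also have "\<dots> \<le> (cos \<beta> * Im a - sin \<beta> * Re a) - (cos \<beta> * Im b - sin \<beta> * Re b)"
    proof -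
      have "cos \<beta> * Im b \<le> cos \<beta> * \<bar>Im b\<bar>"
        using cos_gt_zero[of \<beta>] \<beta> by (intro mult_left_mono) auto
      then show ?thesis using b by simp
    qed
    also have "\<dots> = Im (cis (- \<beta>) * (a - b))" by (simp add: algebra_simps)
    also have "\<dots> \<le> cmod (cis (- \<beta>) * (a - b))" using abs_Im_le_cmod abs_le_D1 by blast
    also have "\<dots> = cmod (a - b)" by (simp add: norm_mult)
    finally show ?thesis .
  qed
  show ?thesis
  proof (cases "0 \<le> Arg a")
    case True
    then show ?thesis using upper[of a b] a b by simp
  next
    case False
    have "a \<notin> \<real>" using False by (auto simp: Reals_def Arg_of_real split: if_splits)
    then have "Arg (cnj a) = - Arg a" by (simp add: Arg_cnj)
    then have "min (sin (\<omega> - \<beta>)) (sin \<beta>) * cmod (cnj a) \<le> cmod (cnj a - cnj b)"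
      using False a b by (intro upper) auto
    then show ?thesis by (simp flip: complex_cnj_diff)
  qed
qed

text \<open>
  The lens \<open>2 |Im \<zeta>| cos \<beta> \<le> (1 - |\<zeta>|\<^sup>2) sin \<beta>\<close> is the closure of the preimage of the closed sector of half-angle
  \<open>\<beta>\<close> under \<open>\<zeta> \<mapsto> (1 - \<zeta>) / (1 + \<zeta>)\<close>. It is closed under multiplication: with moduli \<open>a\<close> and \<open>b\<close>
  of the factors this reduces to \<open>a + b \<le> 1 + a b\<close>.
\<close>

definition lens :: "real \<Rightarrow> complex set" where
  "lens \<beta> = {\<zeta>. cmod \<zeta> \<le> 1 \<and> 2 * \<bar>Im \<zeta>\<bar> * cos \<beta> \<le> sin \<beta> * (1 - (cmod \<zeta>)\<^sup>2)}"

lemma lens_mult: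
  assumes \<beta>: "0 < \<beta>" "\<beta> < pi / 2" and \<zeta>: "\<zeta> \<in> lens \<beta>" and \<xi>: "\<xi> \<in> lens \<beta>"
  shows "\<zeta> * \<xi> \<in> lens \<beta>"
proof -
  define a b where "a = cmod \<zeta>" and "b = cmod \<xi>"
  have ab: "0 \<le> a" "a \<le> 1" "0 \<le> b" "b \<le> 1" using \<zeta> \<xi> by (auto simp: lens_def a_def b_def)
  have c: "0 < cos \<beta>" "0 < sin \<beta>" using \<beta> cos_gt_zero[of \<beta>] sin_gt_zero[of \<beta>] by auto
  have "\<bar>Im (\<zeta> * \<xi>)\<bar> \<le> \<bar>Re \<zeta>\<bar> * \<bar>Im \<xi>\<bar> + \<bar>Im \<zeta>\<bar> * \<bar>Re \<xi>\<bar>"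
    using abs_triangle_ineq[of "Re \<zeta> * Im \<xi>" "Im \<zeta> * Re \<xi>"] by (simp add: abs_mult)
  also have "\<dots> \<le> a * \<bar>Im \<xi>\<bar> + \<bar>Im \<zeta>\<bar> * b"
    unfolding a_def b_def using abs_Re_le_cmod by (intro add_mono mult_mono) auto
  finally have "2 * \<bar>Im (\<zeta> * \<xi>)\<bar> * cos \<beta> \<le> 2 * (a * \<bar>Im \<xi>\<bar> + \<bar>Im \<zeta>\<bar> * b) * cos \<beta>"
    using c by (intro mult_right_mono mult_left_mono) auto
  also have "\<dots> = a * (2 * \<bar>Im \<xi>\<bar> * cos \<beta>) + b * (2 * \<bar>Im \<zeta>\<bar> * cos \<beta>)" by (simp add: algebra_simps)
  also have "\<dots> \<le> a * (sin \<beta> * (1 - b\<^sup>2)) + b * (sin \<beta> * (1 - a\<^sup>2))"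
    using \<zeta> \<xi> ab by (intro add_mono mult_left_mono) (auto simp: lens_def a_def b_def)
  also have "\<dots> = sin \<beta> * ((1 - a * b) * (a + b))" by (simp add: power2_eq_square algebra_simps)
  also have "\<dots> \<le> sin \<beta> * ((1 - a * b) * (1 + a * b))"
  proof -
    have "0 \<le> (1 - a) * (1 - b)" using ab by simp
    then have "a + b \<le> 1 + a * b" by (simp add: algebra_simps)
    moreover have "a * b \<le> 1" using ab by (simp add: mult_le_one)
    ultimately show ?thesis using c by (intro mult_left_mono) auto
  qed
  also have "\<dots> = sin \<beta> * (1 - (cmod (\<zeta> * \<xi>))\<^sup>2)"
    by (simp add: norm_mult a_def b_def power2_eq_square algebra_simps)
  finally show ?thesis using ab by (simp add: lens_def norm_mult a_def b_def mult_le_one)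
qed

lemma lens_power:
  assumes "0 < \<beta>" "\<beta> < pi / 2" "\<zeta> \<in> lens \<beta>"
  shows "\<zeta> ^ n \<in> lens \<beta>"
proof (induction n)
  case (Suc n) then show ?case using lens_mult[OF assms] by simp
qed (simp add: lens_def)

lemma one_minus_lens:
  assumes "0 < \<beta>" "\<beta> < pi / 2" "\<zeta> \<in> lens \<beta>"
  shows "cos \<beta> * \<bar>Im (1 - \<zeta>)\<bar> \<le> sin \<beta> * Re (1 - \<zeta>)"
proof -
  have s: "0 < sin \<beta>" using assms sin_gt_zero[of \<beta>] by auto
  have "0 \<le> (1 - cmod \<zeta>)\<^sup>2" by simp
  then have "1 - (cmod \<zeta>)\<^sup>2 \<le> 2 * (1 - cmod \<zeta>)" by (simp add: power2_eq_square algebra_simps)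
  also have "\<dots> \<le> 2 * Re (1 - \<zeta>)" using complex_Re_le_cmod[of \<zeta>] by simp
  finally have "sin \<beta> * (1 - (cmod \<zeta>)\<^sup>2) \<le> sin \<beta> * (2 * Re (1 - \<zeta>))" using s by (intro mult_left_mono) auto
  then have "2 * \<bar>Im \<zeta>\<bar> * cos \<beta> \<le> sin \<beta> * (2 * Re (1 - \<zeta>))"
    using assms(3) unfolding lens_def by (blast intro: order_trans)
  then have "2 * (cos \<beta> * \<bar>Im (1 - \<zeta>)\<bar>) \<le> 2 * (sin \<beta> * Re (1 - \<zeta>))"
    by (simp only: mult_ac) simp
  then show ?thesis by simp
qed

lemma one_minus_cpoly_lens:
  assumes \<beta>: "0 < \<beta>" "\<beta> < pi / 2" and \<zeta>: "\<zeta> \<in> lens \<beta>" and d: "convex_weights d N"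
  shows "cos \<beta> * \<bar>Im (1 - cpoly d N \<zeta>)\<bar> \<le> sin \<beta> * Re (1 - cpoly d N \<zeta>)"
proof -
  have c: "0 < cos \<beta>" using \<beta> cos_gt_zero[of \<beta>] by auto
  have d0: "0 \<le> d n" for n using d by (simp add: convex_weights_def)
  have "cos \<beta> * \<bar>Im (1 - cpoly d N \<zeta>)\<bar> = cos \<beta> * \<bar>\<Sum>n\<le>N. d n * Im (1 - \<zeta> ^ n)\<bar>"
    unfolding one_minus_cpoly[OF d] by simp
  also have "\<dots> \<le> cos \<beta> * (\<Sum>n\<le>N. d n * \<bar>Im (1 - \<zeta> ^ n)\<bar>)"
    using c d0 by (intro mult_left_mono order_trans[OF sum_abs] sum_mono) (auto simp: abs_mult)
  also have "\<dots> = (\<Sum>n\<le>N. d n * (cos \<beta> * \<bar>Im (1 - \<zeta> ^ n)\<bar>))"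
    by (simp add: sum_distrib_left mult_ac)
  also have "\<dots> \<le> (\<Sum>n\<le>N. d n * (sin \<beta> * Re (1 - \<zeta> ^ n)))"
    using one_minus_lens[OF \<beta> lens_power[OF \<beta> \<zeta>]] d0 by (intro sum_mono mult_left_mono) auto
  also have "\<dots> = sin \<beta> * Re (1 - cpoly d N \<zeta>)"
    unfolding one_minus_cpoly[OF d] by (simp add: sum_distrib_left mult_ac)
  finally show ?thesis .
qed

lemma norm_one_plus_polar: "(cmod (1 + of_real r * cis \<theta>))\<^sup>2 = 1 + 2 * r * cos \<theta> + r\<^sup>2"
  using norm_one_minus_polar[of "- r" \<theta>] by simp

lemma one_plus_polar_ge:
  assumes "0 \<le> r" "0 \<le> cos \<theta>"
  shows "1 \<le> cmod (1 + of_real r * cis \<theta>)"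
proof (rule power2_le_imp_le)
  show "1\<^sup>2 \<le> (cmod (1 + of_real r * cis \<theta>))\<^sup>2"
    unfolding norm_one_plus_polar using assms by simp
qed simp

lemma cayley_polar:
  fixes r \<theta> :: real
  defines "\<mu> \<equiv> of_real r * cis \<theta>"
  assumes r: "0 \<le> r" and \<theta>: "0 \<le> cos \<theta>"
  shows "1 - (cmod ((1 - \<mu>) / (1 + \<mu>)))\<^sup>2 = 4 * r * cos \<theta> / (cmod (1 + \<mu>))\<^sup>2"
    and "Im ((1 - \<mu>) / (1 + \<mu>)) = - 2 * r * sin \<theta> / (cmod (1 + \<mu>))\<^sup>2"
proof -
  have pos: "0 < (cmod (1 + \<mu>))\<^sup>2"
    using one_plus_polar_ge[OF r \<theta>] unfolding \<mu>_def by (intro zero_less_power) linarith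
  have "1 - (cmod ((1 - \<mu>) / (1 + \<mu>)))\<^sup>2 = ((cmod (1 + \<mu>))\<^sup>2 - (cmod (1 - \<mu>))\<^sup>2) / (cmod (1 + \<mu>))\<^sup>2"
    unfolding norm_divide power_divide using pos by (simp add: diff_divide_distrib[of _ _ "(cmod (1 + \<mu>))\<^sup>2"])
  also have "(cmod (1 + \<mu>))\<^sup>2 - (cmod (1 - \<mu>))\<^sup>2 = 4 * r * cos \<theta>"
    unfolding \<mu>_def norm_one_plus_polar norm_one_minus_polar by simp
  finally show "1 - (cmod ((1 - \<mu>) / (1 + \<mu>)))\<^sup>2 = 4 * r * cos \<theta> / (cmod (1 + \<mu>))\<^sup>2" .
  have "Im ((1 - \<mu>) / (1 + \<mu>)) = (- 2 * Im \<mu>) / (cmod (1 + \<mu>))\<^sup>2"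
    unfolding Im_divide cmod_power2 by (rule arg_cong2[where f = "(/)"]) (auto simp: algebra_simps)
  then show "Im ((1 - \<mu>) / (1 + \<mu>)) = - 2 * r * sin \<theta> / (cmod (1 + \<mu>))\<^sup>2"
    by (simp add: \<mu>_def)
qed

text \<open>The reason for the Cayley transform: it turns a truncated sector into a subset of the lens.\<close>

lemma cayley_polar_in_lens:
  assumes \<beta>: "0 < \<beta>" "\<beta> < pi / 2" and r: "0 \<le> r" and \<theta>: "\<bar>\<theta>\<bar> \<le> \<beta>"
  shows "(1 - of_real r * cis \<theta>) / (1 + of_real r * cis \<theta>) \<in> lens \<beta>"
proof -
  define \<mu> where "\<mu> = of_real r * cis \<theta>"
  have c: "0 \<le> cos \<theta>" using \<theta> \<beta> by (intro cos_ge_zero) auto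
  note eqs = cayley_polar[OF r c, folded \<mu>_def]
  have "0 \<le> 1 - (cmod ((1 - \<mu>) / (1 + \<mu>)))\<^sup>2" unfolding eqs(1) using r c by simp
  then have "(cmod ((1 - \<mu>) / (1 + \<mu>)))\<^sup>2 \<le> 1\<^sup>2" unfolding one_power2 by linarith
  then have n: "cmod ((1 - \<mu>) / (1 + \<mu>)) \<le> 1" by (rule power2_le_imp_le) simp
  have "0 \<le> sin (\<beta> - \<bar>\<theta>\<bar>)" using \<theta> \<beta> by (intro sin_ge_zero) auto
  then have "\<bar>sin \<theta>\<bar> * cos \<beta> \<le> sin \<beta> * cos \<theta>"
  proof -
    have "sin \<bar>\<theta>\<bar> = \<bar>sin \<theta>\<bar>" using sin_ge_zero[of "\<bar>\<theta>\<bar>"] \<theta> \<beta> by (auto simp: abs_if)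
    then show ?thesis using \<open>0 \<le> sin (\<beta> - \<bar>\<theta>\<bar>)\<close> by (simp add: sin_diff mult.commute)
  qed
  then have "4 * r * (\<bar>sin \<theta>\<bar> * cos \<beta>) / (cmod (1 + \<mu>))\<^sup>2 \<le> 4 * r * (sin \<beta> * cos \<theta>) / (cmod (1 + \<mu>))\<^sup>2"
    using r by (intro divide_right_mono mult_left_mono) auto
  then have "2 * \<bar>Im ((1 - \<mu>) / (1 + \<mu>))\<bar> * cos \<beta> \<le> sin \<beta> * (1 - (cmod ((1 - \<mu>) / (1 + \<mu>)))\<^sup>2)"
    unfolding eqs using r by (simp add: abs_mult abs_divide mult_ac)
  with n show ?thesis unfolding lens_def \<mu>_def by simp
qed

section \<open>The angle is inherited\<close>

text \<open>
  For each \<open>x\<close> the equation \<open>\<mu> y - B y = x\<close> is a fixed point problem for a contraction with factor \<open>1/2\<close>.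
\<close>

lemma resolvent_outside_ball:
  fixes B :: "'a::complex_banach \<Rightarrow>\<^sub>L 'a"
  assumes B: "B \<in> cbounded_ops" and \<mu>: "2 * norm B \<le> cmod \<mu>" "\<mu> \<noteq> 0"
  shows "\<mu> \<notin> op_spectrum B" "cmod \<mu> * norm (resolvent \<mu> B) \<le> 2"
proof -
  define f where "f = (\<lambda>x y. inverse \<mu> *\<^sub>C (x + B y))"
  have fix_iff: "f x y = y \<longleftrightarrow> (scalar_op \<mu> - B) y = x" for x y
  proof
    assume "f x y = y"
    then have "\<mu> *\<^sub>C f x y = \<mu> *\<^sub>C y" by simp
    then show "(scalar_op \<mu> - B) y = x"
      using \<mu> by (simp add: f_def scaleC_scaleC blinfun.diff_left algebra_simps)
  next
    assume "(scalar_op \<mu> - B) y = x"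
    then show "f x y = y"
      using \<mu> by (auto simp: f_def scaleC_scaleC blinfun.diff_left)
  qed
  have "\<exists>!y. f x y = y" for x
  proof (rule banach_fix_type[of "1 / 2"])
    show "\<forall>y z. dist (f x y) (f x z) \<le> 1 / 2 * dist y z"
    proof (intro allI)
      fix y z
      have "f x y - f x z = inverse \<mu> *\<^sub>C B (y - z)"
        by (simp add: f_def blinfun.diff_right flip: scaleC_diff_right)
      then have "dist (f x y) (f x z) = inverse (cmod \<mu>) * norm (B (y - z))"
        by (simp add: dist_norm norm_scaleC norm_inverse)
      also have "\<dots> \<le> inverse (cmod \<mu>) * (norm B * norm (y - z))"
        by (intro mult_left_mono norm_blinfun) auto
      also have "\<dots> \<le> inverse (cmod \<mu>) * ((cmod \<mu> / 2) * norm (y - z))"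
        using \<mu> by (intro mult_left_mono mult_right_mono) auto
      also have "\<dots> = 1 / 2 * dist y z" using \<mu> by (simp add: dist_norm)
      finally show "dist (f x y) (f x z) \<le> 1 / 2 * dist y z" .
    qed
  qed auto
  then obtain Q where Q: "\<And>x. f x (Q x) = Q x" and unique: "\<And>x y. f x y = y \<Longrightarrow> y = Q x" by metis
  have bound: "norm (Q x) \<le> 2 / cmod \<mu> * norm x" for x
  proof -
    have "\<mu> *\<^sub>C Q x = x + B (Q x)"
      using Q[of x] unfolding fix_iff by (simp add: blinfun.diff_left algebra_simps)
    then have "cmod \<mu> * norm (Q x) \<le> norm x + norm (B (Q x))"
      using norm_triangle_ineq by (metis norm_scaleC)
    also have "\<dots> \<le> norm x + cmod \<mu> / 2 * norm (Q x)"
      using \<mu> by (intro add_left_mono order_trans[OF norm_blinfun] mult_right_mono) auto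
    finally have "cmod \<mu> * norm (Q x) \<le> 2 * norm x" by simp
    then show ?thesis using \<mu> by (simp add: field_simps)
  qed
  obtain S where S: "is_op_inverse (scalar_op \<mu> - B) S" "norm S \<le> 2 / cmod \<mu>"
  proof (rule is_op_inverse_of_function[OF scalar_op_minus_in_cbounded_ops[OF B] _ _ _ bound])
    show "(scalar_op \<mu> - B) (Q x) = x" for x using Q[of x] by (simp only: fix_iff)
    show "Q ((scalar_op \<mu> - B) x) = x" for x
      using unique[of "(scalar_op \<mu> - B) x" x] fix_iff by simp
  qed auto
  show "\<mu> \<notin> op_spectrum B" "cmod \<mu> * norm (resolvent \<mu> B) \<le> 2"
    using is_op_inverse_resolvent[OF S(1)] S(2) \<mu> by (auto simp: field_simps)
qed


text \<open>
  The calculus for the Cayley transform \<open>B\<close> and \<open>\<phi> \<mu> = (1 - \<mu>) / (1 + \<mu>)\<close>. The rays have an angle \<open>\<beta>\<close>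
  strictly between \<open>\<omega>\<close> and \<open>\<omega>'\<close> and below \<open>\<pi>/2\<close>, and the outer curve is a circle beyond which the resolvent of \<open>B\<close>
  is bounded by the contraction principle.
\<close>

lemma angle_power_series_resolvent:
  fixes T :: "'a::complex_banach \<Rightarrow>\<^sub>L 'a"
  assumes a: "\<And>n. 0 \<le> a n" "a sums 1" and T: "T \<in> cbounded_ops" and m1: "- 1 \<notin> op_spectrum T"
    and \<omega>: "0 \<le> \<omega>" "\<omega> < pi / 2" and sect: "sectorial \<omega> (cayley T)"
    and \<omega>': "\<omega> < \<omega>'" "\<omega>' < pi"
  shows "\<exists>C\<ge>1. \<forall>z. z \<notin> (\<lambda>w. 1 - w) ` closure (sector \<omega>') \<longrightarrow>
      z \<notin> op_spectrum (power_series_op a T) \<and> norm (resolvent z (power_series_op a T)) \<le> C / cmod (z - 1)"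
proof -
  define B where "B = cayley T"
  obtain J where J: "is_op_inverse (id_blinfun + T) J"
  proof
    have inv: "is_op_inverse (scalar_op (- 1) - T) (resolvent (- 1) T)" by (rule resolvent_is_op_inverse[OF m1])
    have lin: "resolvent (- 1) T \<in> cbounded_ops" using inv by (simp add: is_op_inverse_def)
    show "is_op_inverse (id_blinfun + T) (- resolvent (- 1) T)"
    proof (rule is_op_inverseI)
      show "- resolvent (- 1) T \<in> cbounded_ops"
        using lin by (simp add: cbounded_ops_def blinfun.minus_left scaleC_minus_right)
      show "(id_blinfun + T) ((- resolvent (- 1) T) x) = x" for x
        using is_op_inverse_apply(1)[OF inv, of x]
        by (simp add: blinfun.add_left blinfun.diff_left blinfun.minus_left blinfun.minus_right scaleC_minus_left)
      show "(- resolvent (- 1) T) ((id_blinfun + T) x) = x" for x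
        using is_op_inverse_apply(2)[OF inv, of x]
        by (simp add: blinfun.add_left blinfun.diff_left blinfun.diff_right blinfun.add_right blinfun.minus_left
            blinfun.minus_right scaleC_minus_left)
    qed
  qed
  have JT: "J (T x) = x - J x" for x
    using is_op_inverse_apply(2)[OF J, of x] by (simp add: blinfun.add_left blinfun.add_right algebra_simps)
  have TJ: "T (J x) = x - J x" for x
    using is_op_inverse_apply(1)[OF J, of x] by (simp add: blinfun.add_left algebra_simps)
  have BJ: "B x = J x + J x - x" for x
    unfolding B_def cayley_def op_inverse_eq[OF J] by (simp add: blinfun.diff_left TJ)
  have TB: "T (B x) = B (T x)" for x
    by (simp add: BJ JT TJ blinfun.diff_right blinfun.add_right)
  have B: "B \<in> cbounded_ops" using sect by (simp add: sectorial_def B_def)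
  define \<beta> where "\<beta> = (\<omega> + min \<omega>' (pi / 2)) / 2"
  have angles: "0 < \<beta>" "\<beta> < pi / 2" "\<omega> < \<beta>" "\<beta> < \<omega>'" using \<omega> \<omega>' by (auto simp: \<beta>_def min_def)
  define \<omega>1 where "\<omega>1 = (\<omega> + \<beta>) / 2"
  have \<omega>1: "0 < \<omega>1" "\<omega> < \<omega>1" "\<omega>1 < \<beta>" "\<omega>1 < pi" using \<omega> angles by (auto simp: \<omega>1_def)
  have b: "0 < cos \<beta>" using cos_gt_zero[of \<beta>] angles by auto
  obtain C1 where C1: "\<And>\<mu>. \<mu> \<notin> closure (sector \<omega>1) \<Longrightarrow> \<mu> \<notin> op_spectrum B"
      "\<And>\<mu>. \<mu> \<notin> closure (sector \<omega>1) \<Longrightarrow> cmod \<mu> * norm (resolvent \<mu> B) \<le> C1"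
    using sect \<omega>1 unfolding sectorial_def norm_scalar_op_compose B_def by blast
  define M where "M = 2 * norm B + 1"
  have M: "0 < M" by (simp add: M_def add_nonneg_pos)
  define C where "C = max C1 2"
  define good where "good = {\<mu>. \<mu> \<notin> closure (sector \<omega>1) \<or> M \<le> cmod \<mu>}"
  have zero: "0 \<notin> good"
    using not_in_closure_sectorD(1)[OF \<omega>1(1), of 0] M by (auto simp: good_def)
  have res: "\<mu> \<notin> op_spectrum B" "cmod \<mu> * norm (resolvent \<mu> B) \<le> C" if "\<mu> \<in> good" for \<mu>
  proof -
    have "\<mu> \<notin> op_spectrum B \<and> cmod \<mu> * norm (resolvent \<mu> B) \<le> C"
    proof (cases "\<mu> \<in> closure (sector \<omega>1)")
      case True
      then have "2 * norm B \<le> cmod \<mu>" "\<mu> \<noteq> 0" using that zero by (auto simp: good_def M_def)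
      from resolvent_outside_ball[OF B this] show ?thesis by (simp add: C_def)
    next
      case False
      then show ?thesis using C1[of \<mu>] by (simp add: C_def)
    qed
    then show "\<mu> \<notin> op_spectrum B" "cmod \<mu> * norm (resolvent \<mu> B) \<le> C" by auto
  qed
  have inv: "is_op_inverse (scalar_op \<mu> - B) (resolvent \<mu> B)" if "\<mu> \<in> good" for \<mu>
    by (rule resolvent_is_op_inverse[OF res(1)[OF that]])
  have contour: "keyhole_contour \<beta> (ln M) 0 (\<lambda>_. ln M) (\<lambda>_. 0)"
    by unfold_locales (use angles in auto)
  have sector: "exp (log_polar u \<theta>) \<in> good" if "\<theta> \<in> {\<beta>..2*pi-\<beta>}" for u \<theta>
  proof -
    have "cos \<theta> \<le> cos \<beta>" using cos_le_off_sector[OF that] angles by simp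
    also have "\<dots> < cos \<omega>1" using \<omega>1 angles by (intro cos_monotone_0_pi) auto
    finally have "exp u * cos \<theta> < exp u * cos \<omega>1" by simp
    then have "\<not> cmod (exp (log_polar u \<theta>)) * cos \<omega>1 \<le> Re (exp (log_polar u \<theta>))"
      unfolding exp_log_polar by (simp add: norm_mult)
    then show ?thesis using closure_sector_subset[OF \<omega>1(1,4)] unfolding good_def by blast
  qed
  interpret keyhole_resolvent \<beta> "ln M" 0 "\<lambda>_. ln M" "\<lambda>_. 0" B "\<lambda>\<mu>. resolvent \<mu> B" C good
  proof (intro keyhole_resolvent.intro contour keyhole_resolvent_axioms.intro)
    show "exp (log_polar u \<theta>) \<in> good" if "ln M \<le> u" for u \<theta>
    proof -
      have "M \<le> exp u" using that M by (metis exp_le_cancel_iff exp_ln)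
      then show ?thesis by (simp add: good_def norm_exp_log_polar del: exp_add)
    qed
  qed (use B inv res zero sector in auto)
  have region: "\<exists>r \<theta>. \<mu> = of_real r * cis \<theta> \<and> 0 < r \<and> r \<le> M \<and> \<bar>\<theta>\<bar> \<le> \<beta>" if "\<mu> \<in> inner_region" for \<mu>
  proof -
    from that obtain u \<theta> where u: "\<mu> = exp (log_polar u \<theta>)" "\<bar>\<theta>\<bar> \<le> \<beta>" "u \<le> ln M"
      unfolding inner_region_def by blast
    have "exp u \<le> M" using u(3) M by (metis exp_le_cancel_iff exp_ln)
    then show ?thesis using u unfolding exp_log_polar by (intro exI[of _ "exp u"] exI[of _ \<theta>]) auto
  qed
  have cos_pos: "cos \<beta> \<le> cos \<theta>" "0 \<le> cos \<theta>" if "\<bar>\<theta>\<bar> \<le> \<beta>" for \<theta>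
    using cos_ge_in_sector[OF that] angles b by auto
  define \<phi> where "\<phi> = (\<lambda>\<mu>::complex. (1 - \<mu>) / (1 + \<mu>))"
  define U0 where "U0 = - {- 1 :: complex}"
  have lens: "\<phi> \<mu> \<in> lens \<beta>" if "\<mu> \<in> inner_region" for \<mu>
    using region[OF that] cayley_polar_in_lens[OF angles(1,2)] unfolding \<phi>_def by fastforce
  define \<kappa> where "\<kappa> = 2 * cos \<beta> / (1 + M)\<^sup>2"
  have \<kappa>: "0 < \<kappa>" using b M by (simp add: \<kappa>_def)
  have \<phi>_der: "(\<phi> has_field_derivative - 2 / (1 + \<mu>)\<^sup>2) (at \<mu>)" if "1 + \<mu> \<noteq> 0" for \<mu>
    unfolding \<phi>_def using that by (auto intro!: derivative_eq_intros simp: power2_eq_square field_simps)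
  have exp_le: "exp t \<le> M" if "t \<le> ln M" for t using that M by (metis exp_le_cancel_iff exp_ln)
  interpret keyhole_calculus \<beta> "ln M" 0 "\<lambda>_. ln M" "\<lambda>_. 0" B "\<lambda>\<mu>. resolvent \<mu> B" C good
      T "\<lambda>x. x + T x" \<phi> "\<lambda>\<mu>. 1 / (1 + \<mu>)" U0 \<kappa> 4
  proof unfold_locales
    show "T \<in> cbounded_ops" by (rule T)
    show "open U0" by (simp add: U0_def open_Compl)
    show "0 \<in> U0" by (simp add: U0_def)
    show "inner_region \<subseteq> U0"
    proof
      fix \<mu> assume "\<mu> \<in> inner_region"
      then obtain r \<theta> where \<mu>: "\<mu> = of_real r * cis \<theta>" "0 < r" "\<bar>\<theta>\<bar> \<le> \<beta>" using region by blast
      have "1 \<le> cmod (1 + \<mu>)" unfolding \<mu>(1) using \<mu> cos_pos by (intro one_plus_polar_ge) auto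
      then show "\<mu> \<in> U0" by (auto simp: U0_def)
    qed
    show "\<phi> holomorphic_on U0" "(\<lambda>\<mu>. 1 / (1 + \<mu>)) holomorphic_on U0"
      unfolding \<phi>_def U0_def by (auto intro!: holomorphic_intros simp: add_eq_0_iff)
    show "\<phi> 0 = 1" by (simp add: \<phi>_def)
    show "T ((resolvent \<mu> B) x) =
        \<phi> \<mu> *\<^sub>C (resolvent \<mu> B) x + (1 / (1 + \<mu>)) *\<^sub>C (x + T x)"
      if "\<mu> \<in> good" "\<mu> \<in> U0" for \<mu> x
    proof -
      define y where "y = (resolvent \<mu> B) x"
      have nz: "1 + \<mu> \<noteq> 0" using that by (auto simp: U0_def add_eq_0_iff)
      have x: "x = \<mu> *\<^sub>C y - B y"
        using R_right[OF that(1), of x] by (simp add: y_def)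
      have Bsum: "B y + T (B y) = y - T y"
        by (simp add: BJ blinfun.add_right blinfun.diff_right TJ)
      have "x + T x = \<mu> *\<^sub>C y + \<mu> *\<^sub>C T y - (B y + T (B y))"
        unfolding x by (simp add: blinfun.diff_right cbounded_ops_scaleC[OF T])
      also have "\<dots> = (1 + \<mu>) *\<^sub>C T y - (1 - \<mu>) *\<^sub>C y"
        unfolding Bsum by (simp add: scaleC_add_left scaleC_diff_left)
      finally have "(1 / (1 + \<mu>)) *\<^sub>C (x + T x) = T y - \<phi> \<mu> *\<^sub>C y"
        using nz by (simp add: scaleC_diff_right scaleC_scaleC \<phi>_def)
      then show ?thesis by (simp add: y_def)
    qed
    show "(resolvent \<mu> B) (T x) = T ((resolvent \<mu> B) x)"
      if "\<mu> \<in> good" for \<mu> x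
    proof -
      define y where "y = (resolvent \<mu> B) x"
      have x: "x = \<mu> *\<^sub>C y - B y" using R_right[OF that, of x] by (simp add: y_def)
      have "T x = (scalar_op \<mu> - B) (T y)"
        unfolding x by (simp add: blinfun.diff_right blinfun.diff_left cbounded_ops_scaleC[OF T] TB)
      then show ?thesis using is_op_inverse_apply(2)[OF inv[OF that]] by (simp add: y_def)
    qed
    show "0 < \<kappa>" by (rule \<kappa>)
    show "cmod (\<phi> \<mu>) \<le> 1" if "\<mu> \<in> inner_region" for \<mu>
      using lens[OF that] by (simp add: lens_def)
    show "cmod (\<phi> (exp (log_polar t \<theta>))) \<le> 1 - \<kappa> * exp t" if "t \<le> ln M" "\<theta> \<in> {\<beta>, 0, -\<beta>}" for t \<theta>
    proof (rule power2_le_imp_le)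
      define r where "r = exp t"
      have r: "0 < r" "r \<le> M" using exp_le[OF that(1)] by (auto simp: r_def)
      have \<theta>: "\<bar>\<theta>\<bar> \<le> \<beta>" using that angles by auto
      define \<mu> where "\<mu> = of_real r * cis \<theta>"
      have ge1: "1 \<le> cmod (1 + \<mu>)" unfolding \<mu>_def using r cos_pos[OF \<theta>] by (intro one_plus_polar_ge) auto
      have le: "cmod (1 + \<mu>) \<le> 1 + M"
        using norm_triangle_ineq[of 1 \<mu>] r by (simp add: \<mu>_def norm_mult)
      have "2 * \<kappa> * r = 4 * r * cos \<beta> / (1 + M)\<^sup>2" by (simp add: \<kappa>_def)
      also have "\<dots> \<le> 4 * r * cos \<theta> / (cmod (1 + \<mu>))\<^sup>2"
      proof (rule frac_le)
        show "4 * r * cos \<beta> \<le> 4 * r * cos \<theta>" using r cos_pos[OF \<theta>] by (intro mult_left_mono) auto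
        show "0 < (cmod (1 + \<mu>))\<^sup>2" using ge1 by (intro zero_less_power) linarith
        show "(cmod (1 + \<mu>))\<^sup>2 \<le> (1 + M)\<^sup>2" using le by (intro power_mono) auto
        show "0 \<le> 4 * r * cos \<theta>" using r cos_pos[OF \<theta>] by auto
      qed
      also have "\<dots> = 1 - (cmod (\<phi> \<mu>))\<^sup>2"
        unfolding \<phi>_def \<mu>_def using r cos_pos[OF \<theta>] by (intro cayley_polar(1)[symmetric]) auto
      finally have "(cmod (\<phi> \<mu>))\<^sup>2 \<le> 1 - 2 * \<kappa> * r" by simp
      also have "\<dots> \<le> (1 - \<kappa> * r)\<^sup>2"
        using zero_le_power2[of "\<kappa> * r"] unfolding power2_diff by simp
      finally show "(cmod (\<phi> (exp (log_polar t \<theta>))))\<^sup>2 \<le> (1 - \<kappa> * exp t)\<^sup>2"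
        unfolding exp_log_polar \<mu>_def r_def .
      have "2 * (\<kappa> * r) \<le> 1 - 0"
        using \<open>(cmod (\<phi> \<mu>))\<^sup>2 \<le> 1 - 2 * \<kappa> * r\<close> zero_le_power2[of "cmod (\<phi> \<mu>)"] by linarith
      then show "0 \<le> 1 - \<kappa> * exp t" unfolding r_def by simp
    qed
    show "cmod (\<phi> (exp (log_polar t \<theta>)) - \<phi> (of_real (exp t))) \<le> 4 * exp t"
      if "t \<le> ln M" "\<theta> \<in> {\<beta>, -\<beta>}" for t \<theta>
    proof -
      define \<mu> \<nu> where "\<mu> = exp (log_polar t \<theta>)" and "\<nu> = complex_of_real (exp t)"
      have "0 \<le> cos \<theta>" using that b by auto
      then have g\<mu>: "1 \<le> cmod (1 + \<mu>)" unfolding \<mu>_def exp_log_polar by (intro one_plus_polar_ge) auto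
      have g\<nu>: "1 \<le> cmod (1 + \<nu>)" using one_plus_polar_ge[of "exp t" 0] by (simp add: \<nu>_def)
      have nz: "1 + \<mu> \<noteq> 0" "1 + \<nu> \<noteq> 0" using g\<mu> g\<nu> by auto
      have "\<phi> \<mu> - \<phi> \<nu> = 2 * (\<nu> - \<mu>) / ((1 + \<mu>) * (1 + \<nu>))"
        unfolding \<phi>_def using nz by (simp add: divide_simps) (simp add: algebra_simps)
      then have "cmod (\<phi> \<mu> - \<phi> \<nu>) = 2 * cmod (\<nu> - \<mu>) / (cmod (1 + \<mu>) * cmod (1 + \<nu>))"
        by (simp only: norm_divide norm_mult norm_numeral)
      also have "\<dots> \<le> 2 * cmod (\<nu> - \<mu>) / 1"
        using mult_mono[OF g\<mu> g\<nu>] by (intro divide_left_mono) auto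
      also have "\<dots> \<le> 2 * (cmod \<nu> + cmod \<mu>)" using norm_triangle_ineq4[of \<nu> \<mu>] by simp
      also have "\<dots> = 4 * exp t" unfolding \<mu>_def \<nu>_def norm_exp_log_polar by simp
      finally show ?thesis by (simp add: \<mu>_def \<nu>_def)
    qed
    show "cmod (deriv \<phi> (of_real (exp t))) \<le> 4" for t
    proof -
      define \<nu> where "\<nu> = complex_of_real (exp t)"
      have g\<nu>: "1 \<le> cmod (1 + \<nu>)" using one_plus_polar_ge[of "exp t" 0] by (simp add: \<nu>_def)
      then have nz: "1 + \<nu> \<noteq> 0" by auto
      have "cmod (deriv \<phi> \<nu>) = 2 / (cmod (1 + \<nu>))\<^sup>2"
        using DERIV_imp_deriv[OF \<phi>_der[OF nz]] by (simp add: norm_divide norm_power)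
      also have "\<dots> \<le> 2 / 1" using g\<nu> by (intro divide_left_mono) (auto simp: one_le_power)
      finally show ?thesis by (simp add: \<nu>_def)
    qed
  qed simp
  define c where "c = min (sin (\<omega>' - \<beta>)) (sin \<beta>)"
  have c: "0 < c" using angles \<omega>' by (auto simp: c_def intro!: sin_gt_zero)
  show ?thesis
  proof (intro exI conjI allI impI)
    show "1 \<le> max 1 (resolvent_const c)" by simp
    fix z assume "z \<notin> (\<lambda>w. 1 - w) ` closure (sector \<omega>')"
    then have z: "1 - z \<notin> closure (sector \<omega>')" by (auto simp: image_iff dest: bspec[where x = "1 - z"])
    have \<omega>'0: "0 < \<omega>'" using \<omega> \<omega>' by simp
    have z1: "z \<noteq> 1" and arg: "\<omega>' \<le> \<bar>Arg (1 - z)\<bar>" using not_in_closure_sectorD[OF \<omega>'0 z] by auto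
    have sep: "c * cmod (1 - z) \<le> cmod (z - cpoly (trunc_weights a N) N (\<phi> \<mu>))" if \<mu>: "\<mu> \<in> inner_region" for N \<mu>
    proof -
      have "c * cmod (1 - z) \<le> cmod ((1 - z) - (1 - cpoly (trunc_weights a N) N (\<phi> \<mu>)))"
        unfolding c_def
        by (rule sector_separation[OF angles(1,2,4) arg
              one_minus_cpoly_lens[OF angles(1,2) lens[OF \<mu>] convex_trunc_weights[OF a]]])
      then show ?thesis by (simp add: norm_minus_commute)
    qed
    note res = power_series_resolvent[OF a c z1 sep]
    show "z \<notin> op_spectrum (power_series_op a T)" by (rule res(1))
    have "resolvent_const c / cmod (1 - z) \<le> max 1 (resolvent_const c) / cmod (z - 1)"
      unfolding norm_minus_commute[of z 1] by (rule divide_right_mono) auto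
    with res(2) show "norm (resolvent z (power_series_op a T)) \<le> max 1 (resolvent_const c) / cmod (z - 1)"
      by (rule order_trans)
  qed
qed

theorem theorem1p2:
  fixes c :: "nat \<Rightarrow> real" and \<sigma> :: real and T :: "'a::complex_banach \<Rightarrow>\<^sub>L 'a"
  assumes "\<forall>n. 0 \<le> c n" and "c sums 1"
    and "1 \<le> \<sigma>" and "ritt_stolz_type \<sigma> T"
  shows "ritt_stolz_type \<sigma> (power_series_op c T) \<and>
         (\<forall>\<omega>. 0 \<le> \<omega> \<and> \<omega> < pi / 2 \<and> sectorial \<omega> (cayley T)
            \<longrightarrow> ritt_of_angle \<omega> (power_series_op c T))"
proof (intro conjI allI impI)
  have c: "0 \<le> c n" for n using assms(1) by simp
  show type: "ritt_stolz_type \<sigma> (power_series_op c T)"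
    by (rule stolz_type_power_series[OF c assms(2-4)])
  fix \<omega> assume \<omega>: "0 \<le> \<omega> \<and> \<omega> < pi / 2 \<and> sectorial \<omega> (cayley T)"
  have T: "T \<in> cbounded_ops" using assms(4) by (simp add: ritt_stolz_type_def)
  have spectrum: "op_spectrum S \<subseteq> stolz (\<sigma> + 1)" if "ritt_stolz_type \<sigma> S" for S :: "'a \<Rightarrow>\<^sub>L 'a"
  proof -
    have "\<exists>C. \<forall>z. z \<notin> stolz (\<sigma> + 1) \<longrightarrow> z \<notin> op_spectrum S \<and> norm (scalar_op (1 - z) o\<^sub>L resolvent z S) \<le> C"
      using that unfolding ritt_stolz_type_def by simp
    then show ?thesis by blast
  qed
  have m1: "- 1 \<notin> op_spectrum T" using spectrum[OF assms(4)] by (auto simp: stolz_iff)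
  show "ritt_of_angle \<omega> (power_series_op c T)"
    unfolding ritt_of_angle_def
  proof (intro conjI allI impI)
    show "power_series_op c T \<in> cbounded_ops" using type by (simp add: ritt_stolz_type_def)
    show "op_spectrum (power_series_op c T) \<subseteq> ball 0 1 \<union> {1}"
      using spectrum[OF type] by (auto simp: stolz_iff)
    show "\<exists>C\<ge>1. \<forall>z. z \<notin> (\<lambda>w. 1 - w) ` closure (sector \<omega>') \<longrightarrow>
        z \<notin> op_spectrum (power_series_op c T) \<and> norm (resolvent z (power_series_op c T)) \<le> C / cmod (z - 1)"
      if "\<omega> < \<omega>' \<and> \<omega>' < pi" for \<omega>'
      by (rule angle_power_series_resolvent[OF c assms(2) T m1]) (use \<omega> that in auto)
  qed
qed

end
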